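(* For every $q\ge 2$ there is an integer $\sigma$ such that the following holds. For every $\varepsilon>0$, no algorithm solves every $n$-vertex instance of Edge Deletion to $q$-Coloring that is given with a $(\sigma,6)$-hub of size $p$, in time $(q-\varepsilon)^p\cdot n^{\mathcal{O}(1)}$, unless the Max 3-Sat Hypothesis (M3SH) fails.
   Context: For a graph $G$, a set $Q\subseteq V(G)$ is a $(\sigma,\delta)$-hub of $G$ if every connected component of $G-Q$ has at most $\sigma$ vertices and each such component is adjacent to at most $\delta$ vertices of $Q$. Edge Deletion to $q$-Coloring: given a graph $G$, find a minimum-size set $X$ of edges such that $G\setminus X$ admits a proper $q$-coloring. Max 3-Sat: given a CNF formula with at most three literals per clause, find the minimum number of clauses whose deletion makes the formula satisfiable (equivalently an assignment violating fewest clauses). M3SH: there is no $\epsilon>0$ such that every $n$-variable instance of Max 3-Sat can be solved in time $(2-\epsilon)^n\cdot n^{\mathcal{O}(1)}$. *)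

theory Defs
  imports Complex_Main "HOL-Library.Log_Nat"
begin

section \<open>Algorithms: random access machines with logarithmic cost\<close>

text \<open>
  Exponential running times such as $(2-\varepsilon)^n$ are sensitive to polynomial slowdowns
  of the machine model, so Turing machines are not adequate. We use the random access machine with
  the logarithmic cost measure, in structured form. A program addresses a finite number of
  memory banks, each an infinite array of natural numbers; scalar variables are cells with
  constant index.
\<close>

type_synonym store = "nat \<Rightarrow> nat \<Rightarrow> nat"

datatype expr =
    Num nat
  | Cell nat expr
  | Add expr expr
  | Sub expr expr
  | Mul expr expr
  | Quot expr expr

datatype prog =
    Skip
  | Assign nat expr expr
  | Seq prog prog
  | Cond expr prog prog
  | While expr prog

fun eval :: "store \<Rightarrow> expr \<Rightarrow> nat" where
  "eval s (Num k) = k"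
| "eval s (Cell a e) = s a (eval s e)"
| "eval s (Add e f) = eval s e + eval s f"
| "eval s (Sub e f) = eval s e - eval s f"
| "eval s (Mul e f) = eval s e * eval s f"
| "eval s (Quot e f) = eval s e div eval s f"

definition bits :: "nat \<Rightarrow> nat" where
  "bits k = 1 + floorlog 2 k"

text \<open>Every node of an expression is charged the length of its value, so that operands, results
  and addresses are all paid for.\<close>

fun cost :: "store \<Rightarrow> expr \<Rightarrow> nat" where
  "cost s (Num k) = bits k"
| "cost s (Cell a e) = cost s e + bits (s a (eval s e))"
| "cost s (Add e f) = cost s e + cost s f + bits (eval s e + eval s f)"
| "cost s (Sub e f) = cost s e + cost s f + bits (eval s e - eval s f)"
| "cost s (Mul e f) = cost s e + cost s f + bits (eval s e * eval s f)"
| "cost s (Quot e f) = cost s e + cost s f + bits (eval s e div eval s f)"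

text \<open>\<open>exec P s t s'\<close>: started in store \<open>s\<close>, program \<open>P\<close> halts in store \<open>s'\<close> after time \<open>t\<close>.\<close>

inductive exec :: "prog \<Rightarrow> store \<Rightarrow> nat \<Rightarrow> store \<Rightarrow> bool" where
  Skip: "exec Skip s 1 s"
| Assign: "exec (Assign a i e) s (1 + cost s i + cost s e)
     (s(a := (s a)(eval s i := eval s e)))"
| Seq: "exec P s t s' \<Longrightarrow> exec P' s' t' s'' \<Longrightarrow> exec (Seq P P') s (t + t') s''"
| CondTrue: "eval s b \<noteq> 0 \<Longrightarrow> exec P s t s' \<Longrightarrow> exec (Cond b P P') s (1 + cost s b + t) s'"
| CondFalse: "eval s b = 0 \<Longrightarrow> exec P' s t s' \<Longrightarrow> exec (Cond b P P') s (1 + cost s b + t) s'"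
| WhileFalse: "eval s b = 0 \<Longrightarrow> exec (While b P) s (1 + cost s b) s"
| WhileTrue: "eval s b \<noteq> 0 \<Longrightarrow> exec P s t s' \<Longrightarrow> exec (While b P) s' t' s'' \<Longrightarrow>
     exec (While b P) s (1 + cost s b + t + t') s''"

inductive_cases exec_SkipE: "exec Skip s t s'"
inductive_cases exec_AssignE: "exec (Assign a i e) s t s'"
inductive_cases exec_SeqE: "exec (Seq P P') s t s'"
inductive_cases exec_CondE: "exec (Cond b P P') s t s'"
inductive_cases exec_WhileE: "exec (While b P) s t s'"

lemma exec_deterministic:
  "exec P s t s' \<Longrightarrow> exec P s u s'' \<Longrightarrow> u = t \<and> s'' = s'"
proof (induction arbitrary: u s'' rule: exec.induct)
  case (Skip s)
  from Skip.prems show ?case by (rule exec_SkipE) simp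
next
  case (Assign a i e s)
  from Assign.prems show ?case by (rule exec_AssignE) simp
next
  case (Seq P s t s' P' t' s3)
  from Seq.prems show ?case by (rule exec_SeqE) (auto dest: Seq.IH)
next
  case (CondTrue s b P t s' P')
  from CondTrue.prems show ?case by (rule exec_CondE) (use CondTrue.hyps(1) in \<open>auto dest: CondTrue.IH\<close>)
next
  case (CondFalse s b P' t s' P)
  from CondFalse.prems show ?case by (rule exec_CondE) (use CondFalse.hyps(1) in \<open>auto dest: CondFalse.IH\<close>)
next
  case (WhileFalse s b P)
  from WhileFalse.prems show ?case by (rule exec_WhileE) (use WhileFalse.hyps in auto)
next
  case (WhileTrue s b P t s' t' s3)
  from WhileTrue.prems show ?case by (rule exec_WhileE) (use WhileTrue.hyps(1) in \<open>auto dest: WhileTrue.IH\<close>)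
qed

text \<open>A list is passed in bank 0: its length in cell 0, its elements in the cells following it.
  All other cells are initially zero.\<close>

definition input_store :: "nat list \<Rightarrow> store" where
  "input_store xs = (\<lambda>a i. if a = 0 \<and> i \<le> length xs then (length xs # xs) ! i else 0)"

definition output_list :: "store \<Rightarrow> nat list" where
  "output_list s = map (s 0) [1..<Suc (s 0 0)]"

definition computes_within :: "prog \<Rightarrow> nat list \<Rightarrow> (nat list \<Rightarrow> bool) \<Rightarrow> real \<Rightarrow> bool" where
  "computes_within P xs correct T \<longleftrightarrow>
     (\<exists>s t. exec P (input_store xs) t s \<and> correct (output_list s) \<and> real t \<le> T)"


section \<open>Max 3-Sat\<close>

text \<open>The variables of an \<open>n\<close>-variable formula are \<open>0, \<dots>, n - 1\<close>. A formula is a set of clauses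
  (no repetitions), hence its size is polynomial in \<open>n\<close>.\<close>

type_synonym literal = "nat \<times> bool"
type_synonym cnf = "literal set set"

definition cnf3 :: "nat \<Rightarrow> cnf \<Rightarrow> bool" where
  "cnf3 n F \<longleftrightarrow> (\<forall>C\<in>F. C \<subseteq> {..<n} \<times> UNIV \<and> card C \<le> 3)"

definition satisfiable :: "cnf \<Rightarrow> bool" where
  "satisfiable F \<longleftrightarrow> (\<exists>\<alpha> :: nat \<Rightarrow> bool. \<forall>C\<in>F. \<exists>(v, b)\<in>C. \<alpha> v = b)"

definition min_clause_deletion :: "cnf \<Rightarrow> nat" where
  "min_clause_deletion F = (LEAST k. \<exists>D. D \<subseteq> F \<and> card D = k \<and> satisfiable (F - D))"

definition literal_code :: "literal \<Rightarrow> nat" where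
  "literal_code l = 2 * fst l + (if snd l then 1 else 0)"

definition encodes_cnf :: "nat \<Rightarrow> cnf \<Rightarrow> nat list \<Rightarrow> bool" where
  "encodes_cnf n F xs \<longleftrightarrow>
     (\<exists>Cs :: literal list list.
        (\<forall>C\<in>set Cs. distinct C) \<and> distinct (map set Cs) \<and> set ` set Cs = F \<and>
        xs = [n, length Cs] @ concat (map (\<lambda>C. length C # map literal_code C) Cs))"

text \<open>In the time bounds, $n^{O(1)}$ is rendered as \<open>(n + 2) ^ c\<close> for some \<open>c\<close>; the shift
  takes care of constant factors and of \<open>n \<le> 1\<close>.\<close>

definition max3sat_solvable_in_base :: "real \<Rightarrow> bool" where
  "max3sat_solvable_in_base b \<longleftrightarrow>
     (\<exists>P c. \<forall>n F xs. cnf3 n F \<and> encodes_cnf n F xs \<longrightarrow>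
        computes_within P xs (\<lambda>ys. ys = [min_clause_deletion F]) (b ^ n * (real n + 2) ^ c))"

definition M3SH :: bool where
  "M3SH \<longleftrightarrow> \<not> (\<exists>\<epsilon>>0. max3sat_solvable_in_base (2 - \<epsilon>))"


section \<open>Graphs, hubs and Edge Deletion to \<open>q\<close>-Coloring\<close>

definition simple_graph :: "'a set \<Rightarrow> 'a set set \<Rightarrow> bool" where
  "simple_graph V E \<longleftrightarrow> finite V \<and> (\<forall>e\<in>E. e \<subseteq> V \<and> card e = 2)"

text \<open>The components of the subgraph induced by \<open>S\<close>.\<close>

definition components :: "'a set \<Rightarrow> 'a set set \<Rightarrow> 'a set set" where
  "components S E = (\<lambda>v. {(x, y). x \<in> S \<and> y \<in> S \<and> {x, y} \<in> E}\<^sup>* `` {v}) ` S"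

definition hub :: "nat \<Rightarrow> nat \<Rightarrow> 'a set \<Rightarrow> 'a set set \<Rightarrow> 'a set \<Rightarrow> bool" where
  "hub \<sigma> \<delta> V E Q \<longleftrightarrow>
     Q \<subseteq> V \<and>
     (\<forall>C\<in>components (V - Q) E.
        card C \<le> \<sigma> \<and> card {w \<in> Q. \<exists>v\<in>C. {v, w} \<in> E} \<le> \<delta>)"

definition colorable :: "nat \<Rightarrow> 'a set \<Rightarrow> 'a set set \<Rightarrow> bool" where
  "colorable q V E \<longleftrightarrow>
     (\<exists>c :: 'a \<Rightarrow> nat. (\<forall>v\<in>V. c v < q) \<and> (\<forall>u v. {u, v} \<in> E \<longrightarrow> c u \<noteq> c v))"

definition min_edge_deletion :: "nat \<Rightarrow> 'a set \<Rightarrow> 'a set set \<Rightarrow> 'a set set \<Rightarrow> bool" where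
  "min_edge_deletion q V E X \<longleftrightarrow>
     is_arg_min card (\<lambda>Y. Y \<subseteq> E \<and> colorable q V (E - Y)) X"

text \<open>An edge set is listed as \<open>u\<^sub>1, v\<^sub>1, u\<^sub>2, v\<^sub>2, \<dots>\<close>, every edge exactly once.\<close>

definition encodes_edges :: "nat set set \<Rightarrow> nat list \<Rightarrow> bool" where
  "encodes_edges E xs \<longleftrightarrow>
     (\<exists>es :: (nat \<times> nat) list.
        distinct (map (\<lambda>(u, v). {u, v}) es) \<and> set (map (\<lambda>(u, v). {u, v}) es) = E \<and>
        xs = concat (map (\<lambda>(u, v). [u, v]) es))"

definition encodes_instance :: "nat \<Rightarrow> nat set set \<Rightarrow> nat set \<Rightarrow> nat list \<Rightarrow> bool" where
  "encodes_instance n E Q xs \<longleftrightarrow>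
     (\<exists>es qs. encodes_edges E es \<and> distinct qs \<and> set qs = Q \<and>
        xs = [n, card E] @ es @ [card Q] @ qs)"

definition edge_deletion_solvable_in_base :: "nat \<Rightarrow> nat \<Rightarrow> nat \<Rightarrow> real \<Rightarrow> bool" where
  "edge_deletion_solvable_in_base q \<sigma> \<delta> b \<longleftrightarrow>
     (\<exists>P c. \<forall>n E Q p xs.
        simple_graph {..<n} E \<and> hub \<sigma> \<delta> {..<n} E Q \<and> card Q = p \<and> encodes_instance n E Q xs \<longrightarrow>
        computes_within P xs (\<lambda>ys. \<exists>X. min_edge_deletion q {..<n} E X \<and> encodes_edges X ys)
          (b ^ p * (real n + 2) ^ c))"

end

theory Submission
  imports Defs
begin

text \<open>
  Let \<open>b < q\<close> be the base of an algorithm for Edge Deletion to \<open>q\<close>-Coloring. Cut the \<open>n\<close> variables of a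
  formula into blocks of \<open>k\<close> variables and write the value \<open>x < 2\<^sup>k\<close> of a block as \<open>x = q \<cdot> g + a\<close> with \<open>a < q\<close>.
  All quotients \<open>g\<close> are guessed exhaustively, with \<open>C = 2\<^sup>k div q + 1\<close> choices per block, whereas \<open>a\<close> becomes the
  colour of a hub vertex. As \<open>C \<cdot> b < 2\<^sup>k\<close> for large \<open>k\<close>, running the algorithm once for every guess takes time
  \<open>(C \<cdot> b)\<close> to the power \<open>n / k\<close>, up to polynomial factors, and this has a base below 2.

  Colours get names from \<open>q\<close> further hub vertices, the references. For every clause and every triple of
  colours of its three blocks that satisfies the clause, a gadget adjacent to the three block vertices
  and the three references costs 12 if all three colours agree and 13 otherwise; hence a satisfied
  clause saves exactly one deletion. Every gadget also penalizes equal references, which keeps them distinct.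
\<close>

section \<open>The gadget\<close>

text \<open>Writing a block as several q-ary digits, one hub vertex each, would make a literal
  depend on all of them, and the number of hub neighbours would grow as \<epsilon> shrinks. Guessing
  every digit but the lowest leaves one hub vertex per block: a literal needs a single port, and the
  gadget depends on \<open>q\<close> only. Rounding costs little, since \<open>C\<close> exceeds 2 ^
  k / q by at most 1, which any b < q absorbs once k is large.

  The comparison of three ports with three references uses up the six hub neighbours. Distinctness
  of the references is therefore enforced in separate components, each adjacent to two references
  only. It is charged in every gadget, so that a collision costs at least as much as all matched
  gadgets together can save.

  Of the answers of the given algorithm only the size matters: 13 times the number of gadgets minus
  the optimum is the largest number of clauses satisfied under the current guess. The references
  enlarge the hub by a constant, hence the time by the constant factor b ^ q.\<close>

text \<open>Vertices of a gadget: \<open>Ref a\<close> is the reference vertex of colour \<open>a\<close>, the ports are placed on hub vertices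
  when the gadget is instantiated, and every edge is stored as a pair \<open>(s, k)\<close> joining \<open>s\<close> to \<open>Inner k\<close>. The ports
  \<open>0, 1, 2\<close> are to be compared with the ports \<open>3, 4, 5\<close>.\<close>

datatype 'i sym = Ref nat | Port nat | Inner 'i

fun outer :: "'i sym \<Rightarrow> bool" where
  "outer (Inner _) = False" | "outer _ = True"

text \<open>For a fixed colouring the cheapest deletion removes exactly the monochromatic edges, so
  all costs below are sizes of such sets.\<close>

definition mono_pairs :: "('i sym \<times> 'i) set \<Rightarrow> ('i sym \<Rightarrow> nat) \<Rightarrow> ('i sym \<times> 'i) set" where
  "mono_pairs D d = {(s, k) \<in> D. d s = d (Inner k)}"

definition ports_match :: "('i sym \<Rightarrow> nat) \<Rightarrow> bool" where
  "ports_match d \<longleftrightarrow> (\<forall>j<3. d (Port j) = d (Port (j + 3)))"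

text \<open>Consider the 4-cycle X, u, R, v. Each edge of it with ends c, w pays [c \<noteq> h] +
  [w \<noteq> h] + [c = w] \<ge> 1, and every vertex lies on two edges, whence the factor 2 and the
  total 4. The total is exactly 4 only if no edge has both ends different from h, that is, X = R = h
  or u = v = h. So x \<noteq> r and u \<noteq> v force a fifth unit, unless a broken copy x \<noteq>
  X or r \<noteq> R already supplies it.\<close>

lemma potts_main_lower:
  fixes x r u v X R h :: nat
  shows "(4::nat) + of_bool (x \<noteq> r \<and> u \<noteq> v) \<le>
    4 * of_bool (x \<noteq> X) + 4 * of_bool (r \<noteq> R)
    + 2 * (of_bool (X \<noteq> h) + of_bool (R \<noteq> h) + of_bool (u \<noteq> h) + of_bool (v \<noteq> h))
    + of_bool (X = u) + of_bool (X = v) + of_bool (R = u) + of_bool (R = v)"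
  by (cases "x = X"; cases "r = R"; cases "X = h"; cases "R = h"; cases "u = h"; cases "v = h")
    (simp_all add: of_bool_def)

text \<open>Pigeonhole: \<open>q - 1\<close> distinct colours do not fit into the
  \<open>q - 2\<close> colours other than \<open>a\<close> and \<open>b\<close>.\<close>

lemma clique_lower:
  fixes z :: "nat \<Rightarrow> nat"
  assumes "a < q" "b < q" "a \<noteq> b" "\<And>k. z k < q"
  shows "(\<exists>k<q-1. z k = a \<or> z k = b) \<or> (\<exists>k<q-1. \<exists>k'<k. z k' = z k)"
proof (rule ccontr)
  assume n: "\<not> ?thesis"
  have "inj_on z {..<q-1}"
    by (rule inj_onI) (metis n lessThan_iff linorder_neqE_nat)
  moreover have "z ` {..<q-1} \<subseteq> {..<q} - {a,b}" using n assms(4) by auto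
  ultimately have "q - 1 \<le> card ({..<q} - {a,b})"
    by (metis card_image card_lessThan card_mono finite_Diff finite_lessThan)
  also have "\<dots> = q - 2" using assms by (simp add: card_Diff_subset)
  finally show False using assms by auto
qed

lemma clique_upper:
  assumes "b < q"
  obtains z :: "nat \<Rightarrow> nat" where "bij_betw z {..<q-1} ({..<q} - {b})" "\<And>k. z k < q"
proof -
  have "card ({..<q} - {b}) = q - 1" using assms by simp
  then obtain z where z: "bij_betw z {..<q-1} ({..<q} - {b})"
    by (metis atLeast0LessThan ex_bij_betw_nat_finite finite_Diff finite_lessThan)
  show ?thesis
  proof (rule that)
    \<comment> \<open>The default \<open>b\<close> beyond the clique only keeps all values below
      \<open>q\<close>.\<close>
    show "bij_betw (\<lambda>k. if k < q - 1 then z k else b) {..<q-1} ({..<q} - {b})"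
      using z by (rule bij_betw_cong[THEN iffD1, rotated]) simp
    show "(if k < q - 1 then z k else b) < q" for k
      using bij_betwE[OF z] assms by auto
  qed
qed

text \<open>\<open>Clq e 0, \<dots>, Clq e (q - 2)\<close> is a clique joined to both ends \<open>s\<close> and \<open>t\<close> of the \<open>e\<close>-th equality constraint;
  together they cost exactly \<open>[s \<noteq> t]\<close>. \<open>Copy j\<close> copies port \<open>j\<close>, \<open>Shadow a b\<close> copies \<open>Ref a\<close> and is adjacent to
  \<open>Ref b\<close>.\<close>

datatype iv = Lt | Rt | Mid nat | Copy nat | Shadow nat nat | Clq nat nat

section \<open>Equality constraints realised by cliques\<close>

fun is_Clq :: "iv \<Rightarrow> bool" where "is_Clq (Clq _ _) = True" | "is_Clq _ = False"

definition clique_pairs :: "nat \<Rightarrow> nat \<Rightarrow> iv sym \<Rightarrow> iv \<Rightarrow> (iv sym \<times> iv) set" where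
  "clique_pairs q e s t = (\<lambda>k. (s, Clq e k)) ` {..<q-1} \<union> (\<lambda>k. (Inner t, Clq e k)) ` {..<q-1}
     \<union> {(Inner (Clq e k'), Clq e k) | k k'. k' < k \<and> k < q - 1}"

text \<open>\<open>EL\<close> may repeat a constraint: the position \<open>e\<close> names the
  clique, so repetitions act as integer weights without creating parallel edges.\<close>

definition expand :: "nat \<Rightarrow> (iv sym \<times> iv) list \<Rightarrow> (iv sym \<times> iv) list \<Rightarrow> (iv sym \<times> iv) set" where
  "expand q EL NL = set NL \<union> (\<Union>e<length EL. clique_pairs q e (fst (EL!e)) (snd (EL!e)))"

text \<open>A Potts energy: the couplings in \<open>EL\<close> favour equal colours, those in
  \<open>NL\<close> different ones. Only the latter are edges of a colouring problem.\<close>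

definition potts :: "(iv sym \<times> iv) list \<Rightarrow> (iv sym \<times> iv) list \<Rightarrow> (iv sym \<Rightarrow> nat) \<Rightarrow> nat" where
  "potts EL NL d = (\<Sum>(s,t)\<leftarrow>EL. of_bool (d s \<noteq> d (Inner t))) + (\<Sum>(s,t)\<leftarrow>NL. of_bool (d s = d (Inner t)))"

text \<open>Keeps the clique vertices out of the constraints, so that they can be recoloured freely
  and the edges of different cliques stay apart.\<close>

definition no_Clq :: "(iv sym \<times> iv) list \<Rightarrow> bool" where
  "no_Clq L \<longleftrightarrow> (\<forall>(s,t)\<in>set L. s \<notin> Inner ` Collect is_Clq \<and> \<not> is_Clq t)"

lemma finite_clique_pairs [simp]: "finite (clique_pairs q e s t)"
proof -
  have "{(Inner (Clq e k'), Clq e k) | k k'. k' < k \<and> k < q - 1} \<subseteq>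
     (\<lambda>(k,k'). (Inner (Clq e k'), Clq e k)) ` ({..<q} \<times> {..<q})" by auto
  then show ?thesis unfolding clique_pairs_def by (auto dest: finite_subset)
qed

lemma clique_pairs_snd: "x \<in> clique_pairs q e s t \<Longrightarrow> \<exists>k<q-1. snd x = Clq e k"
  by (auto simp: clique_pairs_def)

lemma finite_expand: "finite (expand q EL NL)"
  by (simp add: expand_def)

lemma finite_mono_pairs: "finite D \<Longrightarrow> finite (mono_pairs D d)"
  by (rule finite_subset[of _ D]) (auto simp: mono_pairs_def)

lemma card_mono_pairs_list:
  "distinct NL \<Longrightarrow> card (mono_pairs (set NL) d) = (\<Sum>(s,t)\<leftarrow>NL. of_bool (d s = d (Inner t)))"
proof (induction NL)
  case Nil then show ?case by (simp add: mono_pairs_def)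
next
  case (Cons x NL)
  obtain s t where x: "x = (s,t)" by force
  have "mono_pairs (set (x # NL)) d = (if d s = d (Inner t) then {x} else {}) \<union> mono_pairs (set NL) d"
    by (auto simp: mono_pairs_def x)
  moreover have "x \<notin> mono_pairs (set NL) d" using Cons by (auto simp: mono_pairs_def)
  ultimately show ?case using Cons by (auto simp: x finite_mono_pairs)
qed

lemma card_mono_pairs_expand:
  assumes "no_Clq NL" "distinct NL"
  shows "card (mono_pairs (expand q EL NL) d) = (\<Sum>(s,t)\<leftarrow>NL. of_bool (d s = d (Inner t)))
    + (\<Sum>e<length EL. card (mono_pairs (clique_pairs q e (fst (EL!e)) (snd (EL!e))) d))"
proof -
  let ?M = "\<lambda>e. mono_pairs (clique_pairs q e (fst (EL!e)) (snd (EL!e))) d"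
  have s: "\<exists>k. snd x = Clq e k" if "x \<in> ?M e" for x e
    using that clique_pairs_snd by (fastforce simp: mono_pairs_def)
  have "mono_pairs (expand q EL NL) d = mono_pairs (set NL) d \<union> (\<Union>e<length EL. ?M e)"
    by (auto simp: mono_pairs_def expand_def)
  moreover have "mono_pairs (set NL) d \<inter> (\<Union>e<length EL. ?M e) = {}"
    using assms(1) s by (fastforce simp: no_Clq_def mono_pairs_def)
  moreover have "card (\<Union>e<length EL. ?M e) = (\<Sum>e<length EL. card (?M e))"
  proof (rule card_UN_disjoint)
    show "\<forall>e\<in>{..<length EL}. \<forall>j\<in>{..<length EL}. e \<noteq> j \<longrightarrow> ?M e \<inter> ?M j = {}"
      by (metis (no_types, lifting) disjoint_iff iv.inject(4) s)
  qed (auto simp: finite_mono_pairs)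
  ultimately show ?thesis
    using assms(2) by (simp add: card_Un_disjoint finite_mono_pairs card_mono_pairs_list)
qed

lemma clique_pairs_lower:
  assumes "\<And>s. d s < q"
  shows "of_bool (d s \<noteq> d (Inner t)) \<le> card (mono_pairs (clique_pairs q e s t) d)"
proof (cases "d s = d (Inner t)")
  case False
  let ?z = "\<lambda>k. d (Inner (Clq e k))"
  have "(\<exists>k<q-1. ?z k = d s \<or> ?z k = d (Inner t)) \<or> (\<exists>k<q-1. \<exists>k'<k. ?z k' = ?z k)"
    by (rule clique_lower) (use assms False in auto)
  then have "mono_pairs (clique_pairs q e s t) d \<noteq> {}"
  proof (elim disjE exE conjE)
    fix k assume "k < q - 1" "?z k = d s" then have "(s, Clq e k) \<in> mono_pairs (clique_pairs q e s t) d"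
      by (auto simp: mono_pairs_def clique_pairs_def)
    then show ?thesis by auto
  next
    fix k assume "k < q - 1" "?z k = d (Inner t)" then have "(Inner t, Clq e k) \<in> mono_pairs (clique_pairs q e s t) d"
      by (auto simp: mono_pairs_def clique_pairs_def)
    then show ?thesis by auto
  next
    fix k k' assume "k < q - 1" "k' < k" "?z k' = ?z k" then have "(Inner (Clq e k'), Clq e k) \<in> mono_pairs (clique_pairs q e s t) d"
      by (auto simp: mono_pairs_def clique_pairs_def)
    then show ?thesis by auto
  qed
  then show ?thesis by (simp add: Suc_le_eq card_gt_0_iff finite_mono_pairs)
qed simp

lemma expand_lower:
  assumes "no_Clq NL" "distinct NL" "\<And>s. d s < q"
  shows "potts EL NL d \<le> card (mono_pairs (expand q EL NL) d)"
proof -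
  have "(\<Sum>(s,t)\<leftarrow>EL. of_bool (d s \<noteq> d (Inner t))) = (\<Sum>e<length EL. of_bool (d (fst (EL!e)) \<noteq> d (Inner (snd (EL!e)))))"
    by (simp add: sum_list_sum_nth case_prod_beta atLeast0LessThan)
  also have "\<dots> \<le> (\<Sum>e<length EL. card (mono_pairs (clique_pairs q e (fst (EL!e)) (snd (EL!e))) d))"
    by (intro sum_mono clique_pairs_lower assms)
  finally show ?thesis by (simp add: card_mono_pairs_expand assms potts_def)
qed

text \<open>A clique whose constraint has a target of colour b is coloured by a bijection onto the
  colours other than b. Its inner edges and those to the target are then proper; at most one edge to
  the source is monochromatic, and none if the source has colour b too.\<close>

lemma expand_upper:
  assumes NL: "no_Clq NL" "distinct NL" and EL: "no_Clq EL" and d: "\<And>s. d s < q"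
  obtains d' where "\<And>s. d' s < q" "\<And>a. d' (Ref a) = d (Ref a)" "\<And>j. d' (Port j) = d (Port j)"
    "card (mono_pairs (expand q EL NL) d') \<le> potts EL NL d"
proof -
  have "\<exists>z. bij_betw z {..<q-1} ({..<q} - {b}) \<and> (\<forall>k::nat. z k < q)" if "b < q" for b
    using clique_upper[OF that] by metis
  then obtain f where f: "\<And>b. b < q \<Longrightarrow> bij_betw (f b) {..<q-1} ({..<q} - {b})" "\<And>b k. b < q \<Longrightarrow> f b k < q"
    by metis
  define d' where "d' = (\<lambda>x. case x of Inner (Clq e k) \<Rightarrow> f (d (Inner (snd (EL!e)))) k | _ \<Rightarrow> d x)"
  have d'_eq: "d' s = d s" if "s \<notin> Inner ` Collect is_Clq" for s
    using that by (auto simp: d'_def split: sym.splits iv.splits)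
  have c: "card (mono_pairs (clique_pairs q e (fst (EL!e)) (snd (EL!e))) d') \<le> of_bool (d (fst (EL!e)) \<noteq> d (Inner (snd (EL!e))))"
    if e: "e < length EL" for e
  proof -
    obtain s t where st: "EL!e = (s,t)" by force
    have mem: "(s,t) \<in> set EL" using e st by (metis nth_mem)
    have eq: "d' s = d s" "d' (Inner t) = d (Inner t)" 
      using mem EL by (auto intro!: d'_eq simp: no_Clq_def)
    let ?b = "d (Inner t)"
    have z: "d' (Inner (Clq e k)) = f ?b k" for k by (simp add: d'_def st)
    have inj: "f ?b k' \<noteq> f ?b k" if "k' < k" "k < q-1" for k k'
      using f(1)[OF d[of "Inner t"]] that unfolding bij_betw_def inj_on_def
      by (metis lessThan_iff less_trans nat_neq_iff)
    have ne: "f ?b k \<noteq> ?b" if "k < q-1" for k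
      using bij_betwE[OF f(1)[OF d[of "Inner t"]]] that by auto
    have sub: "mono_pairs (clique_pairs q e s t) d' \<subseteq> (\<lambda>k. (s, Clq e k)) ` {k\<in>{..<q-1}. f ?b k = d s}"
      using inj ne by (auto simp: mono_pairs_def clique_pairs_def z eq) metis
    show ?thesis
    proof (cases "d s = ?b")
      case True
      then have "mono_pairs (clique_pairs q e s t) d' = {}" using sub ne by auto
      then show ?thesis by (simp add: st)
    next
      case False
      have "card (mono_pairs (clique_pairs q e s t) d') \<le> card {k\<in>{..<q-1}. f ?b k = d s}"
        by (rule order_trans[OF card_mono[OF _ sub] card_image_le]) auto
      also have "\<dots> \<le> 1"
        using inj by (subst card_le_Suc0_iff_eq[unfolded One_nat_def[symmetric]]) (auto, metis nat_neq_iff)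
      finally show ?thesis using False by (simp add: st)
    qed
  qed
  show ?thesis
  proof (rule that)
    show "d' s < q" for s using d f by (auto simp: d'_def split: sym.splits iv.splits)
    show "d' (Ref a) = d (Ref a)" "d' (Port j) = d (Port j)" for a j by (auto simp: d'_def)
    have "(\<Sum>(s,t)\<leftarrow>NL. of_bool (d' s = d' (Inner t))) = (\<Sum>(s,t)\<leftarrow>NL. of_bool (d s = d (Inner t)) :: nat)"
      using NL(1) by (intro arg_cong[of _ _ sum_list] map_cong) (auto simp: no_Clq_def image_iff d'_eq)
    moreover have "(\<Sum>e<length EL. card (mono_pairs (clique_pairs q e (fst (EL!e)) (snd (EL!e))) d'))
       \<le> (\<Sum>e<length EL. of_bool (d (fst (EL!e)) \<noteq> d (Inner (snd (EL!e)))))"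
      by (intro sum_mono c) auto
    moreover have "(\<Sum>(s,t)\<leftarrow>EL. of_bool (d s \<noteq> d (Inner t))) = (\<Sum>e<length EL. of_bool (d (fst (EL!e)) \<noteq> d (Inner (snd (EL!e)))) :: nat)"
      by (simp add: sum_list_sum_nth case_prod_beta atLeast0LessThan)
    ultimately show "card (mono_pairs (expand q EL NL) d') \<le> potts EL NL d"
      by (simp add: card_mono_pairs_expand NL potts_def)
  qed
qed

text \<open>Different ports may be placed on the same hub vertex, so an inner vertex gets at most
  one outer neighbour; together with antisymmetry on inner vertices this excludes parallel edges.
  \<open>lab\<close> is constant along inner edges: once the hub is removed, every component lies in
  one label class, and a class sees at most 6 outer symbols.\<close>

definition gadget_graph :: "nat \<Rightarrow> 'i set \<Rightarrow> ('i sym \<times> 'i) set \<Rightarrow> ('i \<Rightarrow> (nat \<times> nat) option) \<Rightarrow> bool" where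
  "gadget_graph q I D lab \<longleftrightarrow> finite I \<and> finite D
    \<and> (\<forall>s k. (s, k) \<in> D \<longrightarrow> k \<in> I)
    \<and> (\<forall>l k. (Inner l, k) \<in> D \<longrightarrow> l \<in> I \<and> lab l = lab k \<and> (Inner k, l) \<notin> D)
    \<and> (\<forall>a k. (Ref a, k) \<in> D \<longrightarrow> a < q) \<and> (\<forall>j k. (Port j, k) \<in> D \<longrightarrow> j < 6)
    \<and> (\<forall>s s' k. (s, k) \<in> D \<longrightarrow> (s', k) \<in> D \<longrightarrow> outer s \<longrightarrow> outer s' \<longrightarrow> s = s')
    \<and> (\<forall>L. card {s. outer s \<and> (\<exists>k. (s, k) \<in> D \<and> lab k = L)} \<le> 6)"

definition gadget_lower :: "nat \<Rightarrow> ('i sym \<times> 'i) set \<Rightarrow> bool" where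
  "gadget_lower q D \<longleftrightarrow> (\<forall>d :: 'i sym \<Rightarrow> nat. (\<forall>s. d s < q) \<longrightarrow>
     13 + of_bool (\<not> inj_on (\<lambda>a. d (Ref a)) {..<q}) \<le> card (mono_pairs D d) + of_bool (ports_match d))"

text \<open>Only inner vertices may be recoloured, since the hub vertices are shared by all
  gadgets.\<close>

definition gadget_upper :: "nat \<Rightarrow> ('i sym \<times> 'i) set \<Rightarrow> bool" where
  "gadget_upper q D \<longleftrightarrow> (\<forall>d :: 'i sym \<Rightarrow> nat. (\<forall>s. d s < q) \<longrightarrow> inj_on (\<lambda>a. d (Ref a)) {..<q} \<longrightarrow>
     (\<exists>d'. (\<forall>s. d' s < q) \<and> (\<forall>a. d' (Ref a) = d (Ref a)) \<and> (\<forall>j. d' (Port j) = d (Port j))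
        \<and> card (mono_pairs D d') + of_bool (ports_match d) \<le> 13))"

lemma gadget_graphD:
  assumes "gadget_graph q I D lab"
  shows "finite I" "finite D" "(s, k) \<in> D \<Longrightarrow> k \<in> I"
    "(Inner l, k) \<in> D \<Longrightarrow> l \<in> I" "(Inner l, k) \<in> D \<Longrightarrow> lab l = lab k" "(Inner l, k) \<in> D \<Longrightarrow> (Inner k, l) \<notin> D"
    "(Ref a, k) \<in> D \<Longrightarrow> a < q" "(Port j, k) \<in> D \<Longrightarrow> j < 6"
    "\<lbrakk>(s, k) \<in> D; (s', k) \<in> D; outer s; outer s'\<rbrakk> \<Longrightarrow> s = s'"
    "card {s. outer s \<and> (\<exists>k. (s, k) \<in> D \<and> lab k = L)} \<le> 6"
  using assms unfolding gadget_graph_def by (simp_all, blast+)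

section \<open>The concrete gadget\<close>

definition ref_pairs :: "nat \<Rightarrow> (nat \<times> nat) list" where
  "ref_pairs q = filter (\<lambda>(a,b). a < b) (List.product [0..<q] [0..<q])"

lemma set_ref_pairs: "set (ref_pairs q) = {(a,b). a < b \<and> b < q}"
  by (auto simp: ref_pairs_def)

lemma distinct_ref_pairs: "distinct (ref_pairs q)"
  by (simp add: ref_pairs_def distinct_product)

text \<open>Repetitions give the weights 4 and 2 of \<open>potts_main_lower\<close>. The copies
  detach the ports from the comparison, which then takes place among inner vertices even if two
  ports share a hub vertex. \<open>Shadow a b\<close> follows \<open>Ref a\<close> and, by
  \<open>neq_list\<close>, avoids \<open>Ref b\<close>; this is free of charge iff the two
  references differ.\<close>

definition eq_list :: "nat \<Rightarrow> (iv sym \<times> iv) list" where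
  "eq_list q = concat (map (\<lambda>j. replicate 4 (Port j, Copy j)) [0,1,2,3,4,5])
     @ concat (map (\<lambda>i. concat (replicate 2 [(Inner (Copy i), Mid i), (Inner (Copy (i+3)), Mid i), (Inner Lt, Mid i), (Inner Rt, Mid i)])) [0,1,2])
     @ map (\<lambda>(a,b). (Ref a, Shadow a b)) (ref_pairs q)"

definition neq_list :: "nat \<Rightarrow> (iv sym \<times> iv) list" where
  "neq_list q = (Inner Lt, Rt) # concat (map (\<lambda>j. [(Inner (Copy j), Lt), (Inner (Copy j), Rt)]) [0,1,2,3,4,5])
     @ map (\<lambda>(a,b). (Ref b, Shadow a b)) (ref_pairs q)"

lemma no_Clq_lists: "no_Clq (eq_list q)" "no_Clq (neq_list q)"
  by (auto simp: no_Clq_def eq_list_def neq_list_def set_ref_pairs numeral_eq_Suc)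

lemma distinct_neq_list: "distinct (neq_list q)"
  by (auto simp: neq_list_def distinct_map distinct_ref_pairs inj_on_def)

text \<open>With \<open>u = Lt\<close> and \<open>v = Rt\<close>, the part of the gadget for the pair \<open>(x, r)\<close> of ports costs 4 if \<open>x = r\<close> or
  \<open>u = v\<close>, and at least 5 otherwise. Paying for the edge \<open>uv\<close> thus releases all three pairs at once.\<close>

definition part_cost :: "(iv sym \<Rightarrow> nat) \<Rightarrow> nat \<Rightarrow> nat" where
  "part_cost d i = (let x = d (Port i); r = d (Port (i+3)); u = d (Inner Lt); v = d (Inner Rt);
     X = d (Inner (Copy i)); R = d (Inner (Copy (i+3))); h = d (Inner (Mid i)) in
     4 * of_bool (x \<noteq> X) + 4 * of_bool (r \<noteq> R)
    + 2 * (of_bool (X \<noteq> h) + of_bool (R \<noteq> h) + of_bool (u \<noteq> h) + of_bool (v \<noteq> h))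
    + of_bool (X = u) + of_bool (X = v) + of_bool (R = u) + of_bool (R = v))"

lemma potts_lists:
  "potts (eq_list q) (neq_list q) d = of_bool (d (Inner Lt) = d (Inner Rt)) + part_cost d 0 + part_cost d 1 + part_cost d 2
    + (\<Sum>(a,b)\<leftarrow>ref_pairs q. of_bool (d (Ref a) \<noteq> d (Inner (Shadow a b))) + of_bool (d (Ref b) = d (Inner (Shadow a b))))"
  by (simp add: sum_list_addf potts_def eq_list_def neq_list_def part_cost_def Let_def numeral_eq_Suc comp_def case_prod_unfold)

lemma all_less_3: "(\<forall>j<3. P j) \<longleftrightarrow> P 0 \<and> P 1 \<and> P (2::nat)"
  by (auto simp: numeral_eq_Suc less_Suc_eq)

text \<open>13 is 4 + 4 + 4 + 1. The three parts always cost 12; if the ports do not match, the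
  thirteenth unit is the monochromatic edge between \<open>Lt\<close> and \<open>Rt\<close> or, if
  these differ, the fifth unit of an unmatched part.\<close>

lemma potts_lists_lower:
  assumes "\<And>s. d s < q"
  shows "13 + of_bool (\<not> inj_on (\<lambda>a. d (Ref a)) {..<q}) \<le> potts (eq_list q) (neq_list q) d + of_bool (ports_match d)"
proof -
  let ?u = "d (Inner Lt)" and ?v = "d (Inner Rt)"
  have p: "4 + of_bool (d (Port i) \<noteq> d (Port (i+3)) \<and> ?u \<noteq> ?v) \<le> part_cost d i" for i
    using potts_main_lower[of "d (Port i)" "d (Port (i+3))" ?u ?v] unfolding part_cost_def Let_def by simp
  have "of_bool (\<not> inj_on (\<lambda>a. d (Ref a)) {..<q})
    \<le> (\<Sum>(a,b)\<leftarrow>ref_pairs q. of_bool (d (Ref a) \<noteq> d (Inner (Shadow a b))) + of_bool (d (Ref b) = d (Inner (Shadow a b))) :: nat)"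
    (is "_ \<le> ?S")
  proof (cases "inj_on (\<lambda>a. d (Ref a)) {..<q}")
    case False
    then obtain a b where ab: "a < b" "b < q" "d (Ref a) = d (Ref b)"
      unfolding inj_on_def by (metis lessThan_iff nat_neq_iff)
    then have "(a,b) \<in> set (ref_pairs q)" by (simp add: set_ref_pairs)
    then have "(case (a,b) of (a,b) \<Rightarrow> of_bool (d (Ref a) \<noteq> d (Inner (Shadow a b))) + of_bool (d (Ref b) = d (Inner (Shadow a b)))) \<le> ?S"
      by (intro member_le_sum_list) (auto simp: image_iff intro!: bexI[of _ "(a,b)"])
    then show ?thesis using ab by (cases "d (Ref b) = d (Inner (Shadow a b))") auto
  qed simp
  then show ?thesis
    using p[of 0] p[of 1] p[of 2] unfolding potts_lists ports_match_def all_less_3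
    by (auto simp: of_bool_def split: if_splits)
qed

lemma potts_lists_upper:
  fixes d :: "iv sym \<Rightarrow> nat"
  assumes d: "\<And>s. d s < q" and inj: "inj_on (\<lambda>a. d (Ref a)) {..<q}" and q: "q \<ge> 2"
  obtains d' where "\<And>s. d' s < q" "\<And>a. d' (Ref a) = d (Ref a)" "\<And>j. d' (Port j) = d (Port j)"
    "potts (eq_list q) (neq_list q) d' + of_bool (ports_match d) \<le> 13"
proof -
  \<comment> \<open>If the ports match, \<open>Lt\<close> and \<open>Rt\<close> get the colours 0
    and 1 (this is where \<open>q \<ge> 2\<close> enters) and \<open>Mid i\<close> follows port i;
    otherwise \<open>Lt\<close>, \<open>Rt\<close> and every \<open>Mid i\<close> get 0. In both
    cases the copies are faithful and each part costs 4.\<close>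
  define d' where "d' = (\<lambda>x. case x of Inner Rt \<Rightarrow> of_bool (ports_match d) | Inner (Mid i) \<Rightarrow> if ports_match d then d (Port i) else 0
     | Inner (Copy j) \<Rightarrow> d (Port j) | Inner (Shadow a b) \<Rightarrow> d (Ref a) | Ref a \<Rightarrow> d x | Port j \<Rightarrow> d x | _ \<Rightarrow> 0)"
  show ?thesis
  proof (rule that)
    show "d' s < q" for s using d q by (auto simp: d'_def split: sym.splits iv.splits)
    show "d' (Ref a) = d (Ref a)" "d' (Port j) = d (Port j)" for a j by (auto simp: d'_def)
    have z: "(\<Sum>(a,b)\<leftarrow>ref_pairs q. of_bool (d' (Ref a) \<noteq> d' (Inner (Shadow a b))) + of_bool (d' (Ref b) = d' (Inner (Shadow a b)))) = (0::nat)"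
      using inj by (auto simp: d'_def set_ref_pairs inj_on_def) (metis lessThan_iff less_irrefl less_trans)
    have pc: "part_cost d' i = 4" if "i < 3" for i
    proof (cases "ports_match d")
      case True
      then have "d (Port i) = d (Port (i+3))" using that by (auto simp: ports_match_def)
      then show ?thesis by (auto simp: part_cost_def d'_def True Let_def of_bool_def)
    next
      case False
      then show ?thesis by (auto simp: part_cost_def d'_def Let_def of_bool_def)
    qed
    have "d' (Inner Lt) = 0" "d' (Inner Rt) = of_bool (ports_match d)" by (auto simp: d'_def)
    then show "potts (eq_list q) (neq_list q) d' + of_bool (ports_match d) \<le> 13"
      unfolding potts_lists z using pc by auto
  qed
qed

text \<open>Every shadow forms a class with the clique of its equality constraint and sees two
  references; all other vertices share the class \<open>None\<close> and see the six ports. A clique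
  takes the class of the target of its constraint.\<close>

fun eq_label :: "nat \<Rightarrow> iv \<Rightarrow> (nat \<times> nat) option" where
  "eq_label q (Shadow a b) = Some (a, b)"
| "eq_label q (Clq e k) = (case snd (eq_list q ! e) of Shadow a b \<Rightarrow> Some (a, b) | _ \<Rightarrow> None)"
| "eq_label q _ = None"

lemma eq_list_cases:
  assumes "(s, t) \<in> set (eq_list q)"
  obtains j where "s = Port j" "t = Copy j" "j < 6"
  | i l where "s = Inner l" "t = Mid i" "l \<in> {Lt, Rt, Copy i, Copy (i+3)}"
  | a b where "s = Ref a" "t = Shadow a b" "a < b" "b < q"
  using assms by (auto simp: eq_list_def set_ref_pairs)

lemma neq_list_cases:
  assumes "(s, t) \<in> set (neq_list q)"
  obtains "s = Inner Lt" "t = Rt"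
  | j where "s = Inner (Copy j)" "t = Lt \<or> t = Rt" 
  | a b where "s = Ref b" "t = Shadow a b" "a < b" "b < q"
  using assms by (auto simp: neq_list_def set_ref_pairs)

lemma expand_cases:
  assumes "(s, t) \<in> expand q EL NL"
  obtains "(s, t) \<in> set NL"
  | e k s' t' where "e < length EL" "EL ! e = (s', t')" "(s', t') \<in> set EL" "k < q - 1" "t = Clq e k"
     "s = s' \<or> s = Inner t' \<or> (\<exists>k'<k. s = Inner (Clq e k'))"
proof -
  have "(s, t) \<in> set NL \<or> (\<exists>e<length EL. (s,t) \<in> clique_pairs q e (fst (EL!e)) (snd (EL!e)))"
    using assms by (auto simp: expand_def)
  then show ?thesis
  proof
    assume "\<exists>e<length EL. (s,t) \<in> clique_pairs q e (fst (EL!e)) (snd (EL!e))"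
    then obtain e where e: "e < length EL" "(s,t) \<in> clique_pairs q e (fst (EL!e)) (snd (EL!e))" by blast
    obtain s' t' where st: "EL ! e = (s', t')" by force
    then have "(s',t') \<in> set EL" using e(1) by (metis nth_mem)
    then show ?thesis using e st that(2) by (auto simp: clique_pairs_def)
  qed (use that(1) in blast)
qed

lemma gadget_label_inner:
  assumes "(Inner l, k) \<in> expand q (eq_list q) (neq_list q)"
  shows "eq_label q l = eq_label q k"
  using assms
proof (cases rule: expand_cases)
  case 1 then show ?thesis by (cases rule: neq_list_cases) auto
next
  case (2 e k s' t')
  from 2(3) show ?thesis by (cases rule: eq_list_cases) (use 2 in auto)
qed

text \<open>Plain inner edges lead from copies to \<open>Lt\<close> or \<open>Rt\<close>, or from
  \<open>Lt\<close> to \<open>Rt\<close>, never back. Edges into a clique come from outside it or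
  from a smaller index.\<close>

lemma gadget_antisym:
  assumes "(Inner l, k) \<in> expand q (eq_list q) (neq_list q)"
  shows "(Inner k, l) \<notin> expand q (eq_list q) (neq_list q)"
proof
  assume r: "(Inner k, l) \<in> expand q (eq_list q) (neq_list q)"
  show False using assms
  proof (cases rule: expand_cases)
    case 1
    then show False
    proof (cases rule: neq_list_cases)
      case 1 with r show False by (cases rule: expand_cases) (auto elim: neq_list_cases)
    next
      case 2 with r show False by (cases rule: expand_cases) (auto elim: neq_list_cases)
    qed auto
  next
    case (2 e k' s' t')
    note l = this
    from r show False
    proof (cases rule: expand_cases)
      case 1 then show False using l(5) no_Clq_lists(2)[of q] by (auto simp: no_Clq_def)
    next
      case (2 e2 k2 s2 t2)
      have nz: "s' \<noteq> Inner (Clq a b)" "t' \<noteq> Clq a b" "s2 \<noteq> Inner (Clq a b)" "t2 \<noteq> Clq a b" for a b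
        using no_Clq_lists(1)[of q] l(3) 2(3) by (auto simp: no_Clq_def)
      have "k2 < k'" using l(6) nz 2(5) by (metis iv.inject(4) sym.inject(3))
      moreover have "k' < k2" using 2(6) nz l(5) by (metis iv.inject(4) sym.inject(3))
      ultimately show False by simp
    qed
  qed
qed

lemma gadget_outer_label:
  assumes "(s, k) \<in> expand q (eq_list q) (neq_list q)" "outer s"
  shows "case eq_label q k of None \<Rightarrow> \<exists>j<6. s = Port j | Some (a, b) \<Rightarrow> a < q \<and> b < q \<and> (s = Ref a \<or> s = Ref b)"
  using assms(1)
proof (cases rule: expand_cases)
  case 1 then show ?thesis using assms(2) by (cases rule: neq_list_cases) auto
next
  case (2 e k' s' t')
  from 2(3) show ?thesis by (cases rule: eq_list_cases) (use 2 assms(2) in auto)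
qed

lemma gadget_outer_unique:
  assumes "(s, k) \<in> expand q (eq_list q) (neq_list q)" "outer s"
    "(s', k) \<in> expand q (eq_list q) (neq_list q)" "outer s'"
  shows "s = s'"
  using assms(1)
proof (cases rule: expand_cases)
  case 1
  from assms(3) show ?thesis
  proof (cases rule: expand_cases)
    case 1
    with \<open>(s,k) \<in> set (neq_list q)\<close> show ?thesis using assms(2,4) by (auto elim!: neq_list_cases)
  next
    case 2 with \<open>(s,k) \<in> set (neq_list q)\<close> show ?thesis using no_Clq_lists(2)[of q] by (auto simp: no_Clq_def)
  qed
next
  case (2 e k' s1 t1)
  note a = this
  from assms(3) show ?thesis
  proof (cases rule: expand_cases)
    case 1 with a show ?thesis using no_Clq_lists(2)[of q] by (auto simp: no_Clq_def)
  next
    case (2 e2 k2 s2 t2)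
    then show ?thesis using a assms(2,4) by auto
  qed
qed

lemma gadget_expand:
  assumes q: "q \<ge> 2"
  defines "D \<equiv> expand q (eq_list q) (neq_list q)"
  shows "gadget_graph q (snd ` D \<union> {l. Inner l \<in> fst ` D}) D (eq_label q)"
    "gadget_lower q D" "gadget_upper q D"
  unfolding gadget_graph_def gadget_lower_def gadget_upper_def
proof (intro conjI)
  have f: "finite D" by (simp add: D_def finite_expand)
  have "finite {l. Inner l \<in> fst ` D}"
    using finite_vimageI[OF finite_imageI[OF f, of fst], of Inner] by (simp add: vimage_def inj_def)
  then show "finite (snd ` D \<union> {l. Inner l \<in> fst ` D})" "finite D" using f by auto
  show "\<forall>s k. (s,k) \<in> D \<longrightarrow> k \<in> snd ` D \<union> {l. Inner l \<in> fst ` D}" by force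
  show "\<forall>l k. (Inner l, k) \<in> D \<longrightarrow> l \<in> snd ` D \<union> {l. Inner l \<in> fst ` D} \<and> eq_label q l = eq_label q k \<and> (Inner k, l) \<notin> D"
    using gadget_label_inner gadget_antisym unfolding D_def by force
  note ol = gadget_outer_label[of _ _ q, folded D_def]
  show "\<forall>a k. (Ref a, k) \<in> D \<longrightarrow> a < q"
    using ol[of "Ref _"] by (fastforce split: option.splits)
  show "\<forall>j k. (Port j, k) \<in> D \<longrightarrow> j < 6"
    using ol[of "Port _"] by (fastforce split: option.splits)
  show "\<forall>s s' k. (s, k) \<in> D \<longrightarrow> (s', k) \<in> D \<longrightarrow> outer s \<longrightarrow> outer s' \<longrightarrow> s = s'"
    using gadget_outer_unique unfolding D_def by blast
  show "\<forall>L. card {s. outer s \<and> (\<exists>k. (s, k) \<in> D \<and> eq_label q k = L)} \<le> 6"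
  proof
    fix L
    show "card {s. outer s \<and> (\<exists>k. (s, k) \<in> D \<and> eq_label q k = L)} \<le> 6"
    proof (cases L)
      case None
      have "{s. outer s \<and> (\<exists>k. (s, k) \<in> D \<and> eq_label q k = L)} \<subseteq> Port ` {..<6}"
        using ol None by fastforce
      from surj_card_le[OF _ this] show ?thesis by simp
    next
      case (Some ab)
      have "{s. outer s \<and> (\<exists>k. (s, k) \<in> D \<and> eq_label q k = L)} \<subseteq> {Ref (fst ab), Ref (snd ab)}"
        using ol Some by (fastforce split: prod.splits)
      then have "card {s. outer s \<and> (\<exists>k. (s, k) \<in> D \<and> eq_label q k = L)} \<le> card {Ref (fst ab) :: iv sym, Ref (snd ab)}"
        by (rule card_mono[rotated]) simp
      also have "\<dots> \<le> 6" by (simp add: card_insert_if)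
      finally show ?thesis .
    qed
  qed
  show "\<forall>d. (\<forall>s. d s < q) \<longrightarrow> 13 + of_bool (\<not> inj_on (\<lambda>a. d (Ref a)) {..<q}) \<le> card (mono_pairs D d) + of_bool (ports_match d)"
  proof (intro allI impI)
    fix d :: "iv sym \<Rightarrow> nat" assume d: "\<forall>s. d s < q"
    have "potts (eq_list q) (neq_list q) d \<le> card (mono_pairs D d)"
      unfolding D_def by (rule expand_lower) (use d no_Clq_lists distinct_neq_list in auto)
    then show "13 + of_bool (\<not> inj_on (\<lambda>a. d (Ref a)) {..<q}) \<le> card (mono_pairs D d) + of_bool (ports_match d)"
      using potts_lists_lower[of d q, OF d[rule_format]] by linarith
  qed
  show "\<forall>d :: iv sym \<Rightarrow> nat. (\<forall>s. d s < q) \<longrightarrow> inj_on (\<lambda>a. d (Ref a)) {..<q} \<longrightarrow>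
          (\<exists>d'. (\<forall>s. d' s < q) \<and> (\<forall>a. d' (Ref a) = d (Ref a)) \<and> (\<forall>j. d' (Port j) = d (Port j))
             \<and> card (mono_pairs D d') + of_bool (ports_match d) \<le> 13)"
  proof (intro allI impI)
    fix d :: "iv sym \<Rightarrow> nat" assume d: "\<forall>s. d s < q" "inj_on (\<lambda>a. d (Ref a)) {..<q}"
    obtain d1 where d1: "\<And>s. d1 s < q" "\<And>a. d1 (Ref a) = d (Ref a)" "\<And>j. d1 (Port j) = d (Port j)"
      "potts (eq_list q) (neq_list q) d1 + of_bool (ports_match d) \<le> 13"
      by (rule potts_lists_upper[of d q]) (use d q in auto)
    obtain d2 where d2: "\<And>s. d2 s < q" "\<And>a. d2 (Ref a) = d1 (Ref a)" "\<And>j. d2 (Port j) = d1 (Port j)"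
      "card (mono_pairs D d2) \<le> potts (eq_list q) (neq_list q) d1"
      by (rule expand_upper[OF no_Clq_lists(2)[of q] distinct_neq_list no_Clq_lists(1)[of q], of d1 q]) (use d1 in \<open>auto simp: D_def\<close>)
    show "\<exists>d'. (\<forall>s. d' s < q) \<and> (\<forall>a. d' (Ref a) = d (Ref a)) \<and> (\<forall>j. d' (Port j) = d (Port j))
             \<and> card (mono_pairs D d') + of_bool (ports_match d) \<le> 13"
      by (rule exI[of _ d2]) (use d1 d2 in auto)
  qed
qed

lemma outer_map_sym [simp]: "outer (map_sym f s) = outer s"
  by (cases s) auto

text \<open>The reduction computes vertex names by arithmetic, so the inner vertices have to become
  the numbers below some \<sigma>. Costs are transported by the induced bijection \<open>mp\<close>
  between monochromatic pairs.\<close>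

lemma gadget_rename:
  fixes f :: "'a \<Rightarrow> 'b"
  assumes g: "gadget_graph q I D lab" and lower: "gadget_lower q D" and upper: "gadget_upper q D" and inj: "inj_on f I"
  defines "D' \<equiv> (\<lambda>(s,k). (map_sym f s, f k)) ` D"
  shows "gadget_graph q (f ` I) D' (lab \<circ> inv_into I f)" "gadget_lower q D'" "gadget_upper q D'"
proof -
  define g where "g = inv_into I f"
  note G = gadget_graphD[OF g]
  have gf: "g (f k) = k" if "k \<in> I" for k using that inj by (simp add: g_def)
  have I: "k \<in> I" if "(s,k) \<in> D" for s k using G(3) that by auto
  have I': "l \<in> I" if "(Inner l,k) \<in> D" for l k using G(4) that by blast
  have gs: "map_sym g (map_sym f s) = s" if "(s,k) \<in> D" for s k
    using that I' gf by (cases s) auto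
  have D'D: "(map_sym g s, g k) \<in> D \<and> k = f (g k) \<and> s = map_sym f (map_sym g s)" if "(s,k) \<in> D'" for s k
    using that gs gf I by (auto simp: D'_def)
  have mp: "bij_betw (\<lambda>(s,k). (map_sym f s, f k)) (mono_pairs D d1) (mono_pairs D' d2)"
    if e: "\<And>s k. (s,k) \<in> D \<Longrightarrow> d1 s = d2 (map_sym f s) \<and> d1 (Inner k) = d2 (Inner (f k))" for d1 d2
  proof (rule bij_betw_byWitness[of _ "\<lambda>(s,k). (map_sym g s, g k)"])
    show "(\<lambda>(s,k). (map_sym f s, f k)) ` mono_pairs D d1 \<subseteq> mono_pairs D' d2"
      using e by (auto simp: mono_pairs_def D'_def)
    show "(\<lambda>(s,k). (map_sym g s, g k)) ` mono_pairs D' d2 \<subseteq> mono_pairs D d1"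
      using e D'D by (fastforce simp: mono_pairs_def)
    show "\<forall>x\<in>mono_pairs D d1. (\<lambda>(s,k). (map_sym g s, g k)) ((\<lambda>(s,k). (map_sym f s, f k)) x) = x"
      using gs gf I by (auto simp: mono_pairs_def)
    show "\<forall>x\<in>mono_pairs D' d2. (\<lambda>(s,k). (map_sym f s, f k)) ((\<lambda>(s,k). (map_sym g s, g k)) x) = x"
      using D'D by (fastforce simp: mono_pairs_def)
  qed
  show "gadget_graph q (f ` I) D' (lab \<circ> inv_into I f)"
    unfolding g_def[symmetric] gadget_graph_def
  proof (intro conjI)
    show "finite (f ` I)" "finite D'" using G(1,2) by (auto simp: D'_def)
    show "\<forall>s k. (s,k) \<in> D' \<longrightarrow> k \<in> f ` I" using I by (auto simp: D'_def)
    show "\<forall>l k. (Inner l, k) \<in> D' \<longrightarrow> l \<in> f ` I \<and> (lab \<circ> g) l = (lab \<circ> g) k \<and> (Inner k, l) \<notin> D'"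
    proof (intro allI impI)
      fix l k assume a: "(Inner l, k) \<in> D'"
      from D'D[OF a] have b: "(Inner (g l), g k) \<in> D" "l = f (g l)" by auto
      have "(Inner k, l) \<notin> D'" using D'D[of "Inner k" l] b G(6) by auto
      then show "l \<in> f ` I \<and> (lab \<circ> g) l = (lab \<circ> g) k \<and> (Inner k, l) \<notin> D'"
        using G(5)[OF b(1)] I'[OF b(1)] b(2) by auto
    qed
    show "\<forall>a k. (Ref a, k) \<in> D' \<longrightarrow> a < q" using D'D[of "Ref _"] G(7) by auto
    show "\<forall>j k. (Port j, k) \<in> D' \<longrightarrow> j < 6" using D'D[of "Port _"] G(8) by auto
    show "\<forall>s s' k. (s, k) \<in> D' \<longrightarrow> (s', k) \<in> D' \<longrightarrow> outer s \<longrightarrow> outer s' \<longrightarrow> s = s'"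
    proof (intro allI impI)
      fix s s' k assume a: "(s, k) \<in> D'" "(s', k) \<in> D'" "outer s" "outer s'"
      have "outer (map_sym g s)" "outer (map_sym g s')" using a by auto
      then have "map_sym g s = map_sym g s'" using D'D[OF a(1)] D'D[OF a(2)] G(9) by blast
      then show "s = s'" using D'D[OF a(1)] D'D[OF a(2)] by metis
    qed
    show "\<forall>L. card {s. outer s \<and> (\<exists>k. (s, k) \<in> D' \<and> (lab \<circ> g) k = L)} \<le> 6"
    proof
      fix L
      let ?A = "{s. outer s \<and> (\<exists>k. (s, k) \<in> D \<and> lab k = L)}"
      have fin: "finite ?A" by (rule finite_subset[of _ "fst ` D"]) (use G(2) in force)+
      have "{s. outer s \<and> (\<exists>k. (s, k) \<in> D' \<and> (lab \<circ> g) k = L)} \<subseteq> map_sym f ` ?A"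
      proof
        fix s assume "s \<in> {s. outer s \<and> (\<exists>k. (s, k) \<in> D' \<and> (lab \<circ> g) k = L)}"
        then obtain k where k: "outer s" "(s,k) \<in> D'" "lab (g k) = L" by auto
        show "s \<in> map_sym f ` ?A"
          by (rule image_eqI[of _ _ "map_sym g s"]) (use k D'D in auto)
      qed
      then show "card {s. outer s \<and> (\<exists>k. (s, k) \<in> D' \<and> (lab \<circ> g) k = L)} \<le> 6"
        by (rule order_trans[OF surj_card_le[OF fin] G(10)])
    qed
  qed
  show "gadget_lower q D'" unfolding gadget_lower_def
    proof (intro allI impI)
      fix d :: "'b sym \<Rightarrow> nat" assume d: "\<forall>s. d s < q"
      let ?d = "d \<circ> map_sym f"
      have "card (mono_pairs D ?d) = card (mono_pairs D' d)"
        by (rule bij_betw_same_card[OF mp]) auto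
      moreover have "13 + of_bool (\<not> inj_on (\<lambda>a. ?d (Ref a)) {..<q}) \<le> card (mono_pairs D ?d) + of_bool (ports_match ?d)"
        using lower[unfolded gadget_lower_def, THEN spec, of ?d] d by simp
      ultimately show "13 + of_bool (\<not> inj_on (\<lambda>a. d (Ref a)) {..<q}) \<le> card (mono_pairs D' d) + of_bool (ports_match d)"
        by (simp add: ports_match_def)
    qed
  show "gadget_upper q D'" unfolding gadget_upper_def
    proof (intro allI impI)
      fix d :: "'b sym \<Rightarrow> nat" assume d: "\<forall>s. d s < q" "inj_on (\<lambda>a. d (Ref a)) {..<q}"
      let ?d = "d \<circ> map_sym f"
      obtain d1 where d1: "\<forall>s. d1 s < q" "\<forall>a. d1 (Ref a) = d (Ref a)" "\<forall>j. d1 (Port j) = d (Port j)"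
        "card (mono_pairs D d1) + of_bool (ports_match ?d) \<le> 13"
        using upper[unfolded gadget_upper_def, THEN spec, of ?d] d by auto
      let ?d' = "d1 \<circ> map_sym g"
      have "card (mono_pairs D d1) = card (mono_pairs D' ?d')"
        by (rule bij_betw_same_card[OF mp]) (use gs gf I in auto)
      moreover have "ports_match ?d = ports_match d" by (simp add: ports_match_def)
      ultimately show "\<exists>d'. (\<forall>s. d' s < q) \<and> (\<forall>a. d' (Ref a) = d (Ref a)) \<and> (\<forall>j. d' (Port j) = d (Port j))
             \<and> card (mono_pairs D' d') + of_bool (ports_match d) \<le> 13"
        by (intro exI[of _ ?d']) (use d1 in auto)
    qed
qed

lemma gadget_exists:
  assumes "q \<ge> 2"
  obtains \<sigma> :: nat and D lab where "gadget_graph q {..<\<sigma>} D lab" "gadget_lower q D" "gadget_upper q D"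
proof -
  obtain I :: "iv set" and D lab where g: "gadget_graph q I D lab" "gadget_lower q D" "gadget_upper q D"
    using gadget_expand[OF assms] by blast
  obtain f and \<sigma>::nat where f: "bij_betw f I {..<\<sigma>}"
    using gadget_graphD(1)[OF g(1)] by (metis atLeast0LessThan ex_bij_betw_finite_nat)
  from f have i: "inj_on f I" and e: "f ` I = {..<\<sigma>}" by (auto simp: bij_betw_def)
  show ?thesis by (rule that[OF gadget_rename[OF g i, unfolded e]])
qed

section \<open>Graphs assembled from gadgets\<close>

locale hub_gadget =
  fixes q \<sigma> :: nat and T :: "(nat sym \<times> nat) list" and lab :: "nat \<Rightarrow> (nat \<times> nat) option"
  assumes q2: "q \<ge> 2" and distinct_T: "distinct T"
    and graph: "gadget_graph q {..<\<sigma>} (set T) lab"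
    and lower: "gadget_lower q (set T)" and upper: "gadget_upper q (set T)"
begin

text \<open>Layout of the final graph: the hub consists of the numbers below \<open>p\<close>, the
  first \<open>q\<close> of them being the references, and every gadget owns a block of \<sigma>
  consecutive numbers behind the hub.\<close>

definition place :: "nat \<Rightarrow> (nat \<Rightarrow> nat) \<Rightarrow> nat \<Rightarrow> nat sym \<Rightarrow> nat" where
  "place p t g s = (case s of Ref a \<Rightarrow> a | Port j \<Rightarrow> t j | Inner k \<Rightarrow> p + g * \<sigma> + k)"

lemma place_simps [simp]: "place p t g (Ref a) = a" "place p t g (Port j) = t j" "place p t g (Inner k) = p + g * \<sigma> + k"
  by (simp_all add: place_def)

definition gadget_edges :: "nat \<Rightarrow> (nat \<Rightarrow> nat) \<Rightarrow> nat \<Rightarrow> (nat \<times> nat) list" where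
  "gadget_edges p t g = map (\<lambda>(s,k). (place p t g s, place p t g (Inner k))) T"

fun graph_edges :: "nat \<Rightarrow> nat \<Rightarrow> (nat \<Rightarrow> nat) list \<Rightarrow> (nat \<times> nat) list" where
  "graph_edges p g [] = []"
| "graph_edges p g (t # ts) = gadget_edges p t g @ graph_edges p (Suc g) ts"

lemma graph_edges_append: "graph_edges p g (ts @ us) = graph_edges p g ts @ graph_edges p (g + length ts) us"
  by (induction ts arbitrary: g) auto

definition hub_ports :: "nat \<Rightarrow> (nat \<Rightarrow> nat) \<Rightarrow> bool" where
  "hub_ports p t \<longleftrightarrow> q \<le> p \<and> (\<forall>j<6. t j < p)"

lemmas graphD = gadget_graphD[OF graph, simplified]

lemma place_outer: "(s, k) \<in> set T \<Longrightarrow> outer s \<Longrightarrow> hub_ports p t \<Longrightarrow> place p t g s < p"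
  using graphD(7,8) by (cases s) (fastforce simp: hub_ports_def)+

lemma place_cases:
  assumes "(s, k) \<in> set T" "hub_ports p t"
  obtains "outer s" "place p t g s < p" | l where "s = Inner l" "l < \<sigma>" "(Inner l, k) \<in> set T" "l \<noteq> k"
  using place_outer[OF assms(1)] assms graphD(4)[of _ k] graphD(6)[of _ k] by (cases s) auto

lemma gadget_edges_bounds:
  assumes "(u, v) \<in> set (gadget_edges p t g)" "hub_ports p t"
  shows "u < p + Suc g * \<sigma>" "p + g * \<sigma> \<le> v" "v < p + Suc g * \<sigma>" "u \<noteq> v" "u < p \<or> p + g * \<sigma> \<le> u"
proof -
  obtain s k where sk: "(s,k) \<in> set T" "u = place p t g s" "v = p + g * \<sigma> + k"
    using assms(1) by (auto simp: gadget_edges_def)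
  have k: "k < \<sigma>" using graphD(3) sk(1) .
  from sk(1) assms(2) have "u < p + Suc g * \<sigma> \<and> p + g * \<sigma> \<le> v \<and> v < p + Suc g * \<sigma> \<and> u \<noteq> v \<and> (u < p \<or> p + g * \<sigma> \<le> u)"
  proof (cases rule: place_cases[of _ _ _ _ g])
    case 1 then show ?thesis using sk k by auto
  next
    case 2 then show ?thesis using sk k by auto
  qed
  then show "u < p + Suc g * \<sigma>" "p + g * \<sigma> \<le> v" "v < p + Suc g * \<sigma>" "u \<noteq> v" "u < p \<or> p + g * \<sigma> \<le> u" by auto
qed

lemma graph_edges_bounds:
  assumes "(u, v) \<in> set (graph_edges p g ts)" "\<forall>t\<in>set ts. hub_ports p t"
  shows "u < p + (g + length ts) * \<sigma> \<and> p + g * \<sigma> \<le> v \<and> v < p + (g + length ts) * \<sigma> \<and> u \<noteq> v"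
  using assms
proof (induction ts arbitrary: g)
  case (Cons t ts)
  show ?case
  proof (cases "(u, v) \<in> set (gadget_edges p t g)")
    case True
    have le: "p + Suc g * \<sigma> \<le> p + (g + length (t # ts)) * \<sigma>" by (simp add: algebra_simps)
    have "hub_ports p t" using Cons.prems(2) by simp
    note b = gadget_edges_bounds[OF True this]
    show ?thesis using less_le_trans[OF b(1) le] b(2) less_le_trans[OF b(3) le] b(4) by blast
  next
    case False
    then have "u < p + (Suc g + length ts) * \<sigma> \<and> p + Suc g * \<sigma> \<le> v \<and> v < p + (Suc g + length ts) * \<sigma> \<and> u \<noteq> v"
      using Cons.IH[of "Suc g"] Cons.prems False by (simp del: mult_Suc)
    then show ?thesis by auto
  qed
qed simp

text \<open>An edge at the hub determines its inner end, and that has a single outer neighbour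
  symbol; so coinciding ports do no harm. An edge between inner vertices determines its orientation
  by antisymmetry.\<close>

lemma distinct_gadget_edges:
  assumes "hub_ports p t"
  shows "distinct (map (\<lambda>(u,v). {u,v}) (gadget_edges p t g))"
proof -
  have "inj_on (\<lambda>(s,k). {place p t g s, place p t g (Inner k)}) (set T)"
  proof (rule inj_onI, clarify)
    fix s k s' k' assume m: "(s,k) \<in> set T" "(s',k') \<in> set T"
      and e: "{place p t g s, place p t g (Inner k)} = {place p t g s', place p t g (Inner k')}"
    from m(1) assms show "s = s' \<and> k = k'"
    proof (cases rule: place_cases[of _ _ _ _ g])
      case 1
      note c1 = this
      from m(2) assms show ?thesis
      proof (cases rule: place_cases[of _ _ _ _ g])
        case 1
        then have "k = k'" using c1 e by (auto simp: doubleton_eq_iff)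
        then show ?thesis using graphD(9) m c1(1) 1(1) by blast
      next
        case 2 then show ?thesis using c1 e by (auto simp: doubleton_eq_iff)
      qed
    next
      case (2 l)
      note c1 = this
      from m(2) assms show ?thesis
      proof (cases rule: place_cases[of _ _ _ _ g])
        case 1 then show ?thesis using c1 e by (auto simp: doubleton_eq_iff)
      next
        case (2 l') then show ?thesis using c1 e graphD(6) by (auto simp: doubleton_eq_iff)
      qed
    qed
  qed
  then have "distinct (map (\<lambda>(s,k). {place p t g s, place p t g (Inner k)}) T)"
    using distinct_T by (simp add: distinct_map)
  moreover have "map (\<lambda>(u,v). {u,v}) (gadget_edges p t g) = map (\<lambda>(s,k). {place p t g s, place p t g (Inner k)}) T"
    by (auto simp: gadget_edges_def)
  ultimately show ?thesis by simp
qed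

lemma distinct_graph_edges:
  assumes "\<forall>t\<in>set ts. hub_ports p t"
  shows "distinct (map (\<lambda>(u,v). {u,v}) (graph_edges p g ts))"
  using assms
proof (induction ts arbitrary: g)
  case (Cons t ts)
  have "{u,v} \<noteq> {u',v'}" if "(u,v) \<in> set (gadget_edges p t g)" "(u',v') \<in> set (graph_edges p (Suc g) ts)" for u v u' v'
    using gadget_edges_bounds[OF that(1)] graph_edges_bounds[OF that(2)] Cons.prems by (auto simp: doubleton_eq_iff)
  then show ?case using Cons distinct_gadget_edges[of p t g] by auto
qed simp

definition edge_set :: "nat \<Rightarrow> (nat \<Rightarrow> nat) list \<Rightarrow> nat set set" where
  "edge_set p ts = (\<lambda>(u,v). {u,v}) ` set (graph_edges p 0 ts)"

lemma simple_graph_edge_set: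
  assumes "\<forall>t\<in>set ts. hub_ports p t"
  shows "simple_graph {..<p + length ts * \<sigma>} (edge_set p ts)"
  using graph_edges_bounds[OF _ assms, of _ _ 0] by (fastforce simp: simple_graph_def edge_set_def)

lemma graph_edges_mem:
  assumes "e \<in> set (graph_edges p g0 ts)"
  obtains g where "g0 \<le> g" "g < g0 + length ts" "e \<in> set (gadget_edges p (ts!(g-g0)) g)"
proof -
  have "\<exists>g\<ge>g0. g < g0 + length ts \<and> e \<in> set (gadget_edges p (ts!(g-g0)) g)" using assms
  proof (induction ts arbitrary: g0)
    case (Cons t ts)
    show ?case
    proof (cases "e \<in> set (gadget_edges p t g0)")
      case True then show ?thesis by (intro exI[of _ g0]) auto
    next
      case False
      then obtain g where "g \<ge> Suc g0" "g < Suc g0 + length ts" "e \<in> set (gadget_edges p (ts!(g-Suc g0)) g)"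
        using Cons.IH[of "Suc g0"] Cons.prems by auto
      then show ?thesis by (intro exI[of _ g]) (auto simp: nth_Cons' Suc_diff_Suc)
    qed
  qed simp
  then show ?thesis using that by blast
qed

lemma hub_edge_set:
  assumes ts: "\<forall>t\<in>set ts. hub_ports p t"
  shows "hub \<sigma> 6 {..<p + length ts * \<sigma>} (edge_set p ts) {..<p}"
  unfolding hub_def
proof (intro conjI ballI)
  let ?V = "{..<p + length ts * \<sigma>}" and ?E = "edge_set p ts"
  let ?S = "?V - {..<p}"
  show "{..<p} \<subseteq> ?V" by auto
  \<comment> \<open>Gadget number and label are constant along edges outside the hub, so a component
    stays within one label class of one gadget. This bounds its size as well as its neighbourhood in
    the hub.\<close>
  define idx where "idx = (\<lambda>v. (v - p) div \<sigma>)"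
  define pos where "pos = (\<lambda>v. (v - p) mod \<sigma>)"
  have ip: "idx (p + g * \<sigma> + k) = g" "pos (p + g * \<sigma> + k) = k" if "k < \<sigma>" for g k
    using that by (auto simp: idx_def pos_def)
  have E: "\<exists>g s k. g < length ts \<and> (s,k) \<in> set T \<and> {x,y} = {place p (ts!g) g s, p + g * \<sigma> + k} \<and> hub_ports p (ts!g)"
    if "{x, y} \<in> ?E" for x y
  proof -
    obtain e where e: "{x,y} = (\<lambda>(u,v). {u,v}) e" "e \<in> set (graph_edges p 0 ts)"
      using \<open>{x, y} \<in> ?E\<close> unfolding edge_set_def by (rule imageE)
    obtain u v where "e = (u,v)" by force
    with e have uv: "(u,v) \<in> set (graph_edges p 0 ts)" "{x,y} = {u,v}" by auto
    from graph_edges_mem[OF uv(1)] obtain g where "g < length ts" "(u,v) \<in> set (gadget_edges p (ts!g) g)" by auto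
    then show ?thesis using uv(2) ts by (fastforce simp: gadget_edges_def)
  qed
  fix C assume "C \<in> components ?S ?E"
  then obtain v where v: "v \<in> ?S" and C: "C = {(x, y). x \<in> ?S \<and> y \<in> ?S \<and> {x, y} \<in> ?E}\<^sup>* `` {v}"
    by (auto simp: components_def)
  have adj: "idx x = idx y \<and> lab (pos x) = lab (pos y)" if "x \<in> ?S" "y \<in> ?S" "{x, y} \<in> ?E" for x y
  proof -
    from E[OF that(3)] obtain g s k where m: "(s,k) \<in> set T" "{x,y} = {place p (ts!g) g s, p + g * \<sigma> + k}" "hub_ports p (ts!g)"
      by blast
    have k: "k < \<sigma>" using graphD(3) m(1) .
    from m(1,3) show ?thesis
    proof (cases rule: place_cases[of _ _ _ _ g])
      case 1 then show ?thesis using m(2) that by (auto simp: doubleton_eq_iff)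
    next
      case (2 l)
      then show ?thesis using m(2) k ip graphD(5)[OF 2(3)] by (auto simp: doubleton_eq_iff)
    qed
  qed
  have inC: "x \<in> ?S \<and> idx x = idx v \<and> lab (pos x) = lab (pos v)" if "x \<in> C" for x
  proof -
    from that have "(v,x) \<in> {(x, y). x \<in> ?S \<and> y \<in> ?S \<and> {x, y} \<in> ?E}\<^sup>*" by (simp add: C)
    then show ?thesis
    proof (induction rule: rtrancl_induct)
      case base then show ?case using v by simp
    next
      case (step y z) then show ?case using adj[of y z] by auto
    qed
  qed
  have \<sigma>: "\<sigma> > 0" using v by (auto intro: ccontr)
  have "C \<subseteq> (\<lambda>k. p + idx v * \<sigma> + k) ` {..<\<sigma>}"
  proof
    fix x assume "x \<in> C"
    from inC[OF this] have "x = p + idx v * \<sigma> + (x - p) mod \<sigma>" "p \<le> x"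
      by (auto simp: idx_def) (metis add.assoc div_mult_mod_eq le_add_diff_inverse)
    then show "x \<in> (\<lambda>k. p + idx v * \<sigma> + k) ` {..<\<sigma>}" using \<sigma> by auto
  qed
  from surj_card_le[OF _ this] show "card C \<le> \<sigma>" by simp
  let ?N = "{s. outer s \<and> (\<exists>k. (s,k) \<in> set T \<and> lab k = lab (pos v))}"
  have fin: "finite ?N" by (rule finite_subset[of _ "fst ` set T"]) force+
  have "{w \<in> {..<p}. \<exists>v\<in>C. {v, w} \<in> ?E} \<subseteq> place p (ts!idx v) (idx v) ` ?N"
  proof (clarify)
    fix w x assume w: "w < p" "x \<in> C" "{x, w} \<in> ?E"
    from E[OF w(3)] obtain g s k where m: "(s,k) \<in> set T" "{x,w} = {place p (ts!g) g s, p + g * \<sigma> + k}" "hub_ports p (ts!g)"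
      by blast
    have k: "k < \<sigma>" using graphD(3) m(1) .
    have wx: "w = place p (ts!g) g s" "x = p + g * \<sigma> + k" using m(2) w(1) by (auto simp: doubleton_eq_iff)
    have "outer s" using wx(1) w(1) by (cases s) auto
    moreover have "g = idx v" "lab k = lab (pos v)" using inC[OF w(2)] ip[OF k] by (auto simp: wx(2))
    ultimately show "w \<in> place p (ts!idx v) (idx v) ` ?N" using m(1) wx(1) by blast
  qed
  from order_trans[OF surj_card_le[OF fin this] gadget_graphD(10)[OF graph]]
  show "card {w \<in> {..<p}. \<exists>v\<in>C. {v, w} \<in> ?E} \<le> 6" .
qed

section \<open>Counting monochromatic edges\<close>

definition mono_count :: "(nat \<Rightarrow> nat) \<Rightarrow> (nat \<times> nat) list \<Rightarrow> nat" where
  "mono_count c es = length (filter (\<lambda>(u,v). c u = c v) es)"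

lemma mono_count_append: "mono_count c (xs @ ys) = mono_count c xs + mono_count c ys"
  by (simp add: mono_count_def)

lemma mono_count_gadget: "mono_count c (gadget_edges p t g) = card (mono_pairs (set T) (\<lambda>s. c (place p t g s)))"
proof -
  have "mono_count c (gadget_edges p t g) = length (filter (\<lambda>(s,k). c (place p t g s) = c (place p t g (Inner k))) T)"
    unfolding mono_count_def gadget_edges_def by (simp add: filter_map comp_def case_prod_unfold)
  also have "\<dots> = card (set (filter (\<lambda>(s,k). c (place p t g s) = c (place p t g (Inner k))) T))"
    by (rule distinct_card[symmetric]) (simp add: distinct_T)
  finally show ?thesis by (auto simp: mono_pairs_def intro!: arg_cong[of _ _ card])
qed

definition matched :: "(nat \<Rightarrow> nat) \<Rightarrow> (nat \<Rightarrow> nat) \<Rightarrow> bool" where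
  "matched c t \<longleftrightarrow> (\<forall>j<3. c (t j) = c (t (j + 3)))"

text \<open>If references collide, every gadget pays one unit more. This makes up for everything
  that the at most \<open>length ts\<close> matched gadgets can save.\<close>

lemma mono_count_lower:
  assumes "\<And>v. c v < q"
  shows "13 * length ts + (if inj_on c {..<q} then 0 else length ts) \<le> mono_count c (graph_edges p g ts) + length (filter (matched c) ts)"
proof (induction ts arbitrary: g)
  case (Cons t ts)
  have "13 + of_bool (\<not> inj_on c {..<q}) \<le> mono_count c (gadget_edges p t g) + of_bool (matched c t)"
    using lower[unfolded gadget_lower_def, THEN spec, of "\<lambda>s. c (place p t g s)"] assms
    by (simp add: mono_count_gadget ports_match_def matched_def)
  then show ?case using Cons[of "Suc g"] by (auto simp: mono_count_append split: if_splits)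
qed (simp add: mono_count_def)

text \<open>The gadgets are recoloured in turn. Each step changes only the block of its own gadget,
  hence neither the hub colours, on which \<open>matched\<close> depends, nor the gadgets treated
  before.\<close>

lemma mono_count_upper:
  assumes "\<And>v. c v < q" "inj_on c {..<q}" "\<forall>t\<in>set ts. hub_ports p t"
  obtains c' where "\<And>v. c' v < q" "\<And>v. v < p + g * \<sigma> \<Longrightarrow> c' v = c v"
    "mono_count c' (graph_edges p g ts) + length (filter (matched c) ts) \<le> 13 * length ts"
proof -
  have "\<exists>c'. (\<forall>v. c' v < q) \<and> (\<forall>v<p + g * \<sigma>. c' v = c v) \<and> 
    mono_count c' (graph_edges p g ts) + length (filter (matched c) ts) \<le> 13 * length ts"
    using assms
  proof (induction ts arbitrary: g c)
    case Nil
    then show ?case by (intro exI[of _ c]) (auto simp: mono_count_def)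
  next
    case (Cons t ts)
    have hp: "hub_ports p t" using Cons.prems by simp
    obtain d where d: "\<forall>s. d s < q" "\<forall>a. d (Ref a) = c a" "\<forall>j. d (Port j) = c (t j)"
      "card (mono_pairs (set T) d) + of_bool (matched c t) \<le> 13"
      using upper[unfolded gadget_upper_def, THEN spec, of "\<lambda>s. c (place p t g s)"] Cons.prems
      by (auto simp: ports_match_def matched_def)
    define c1 where "c1 = (\<lambda>v. if p + g * \<sigma> \<le> v \<and> v < p + Suc g * \<sigma> then d (Inner (v - (p + g * \<sigma>))) else c v)"
    have c1_eq: "c1 v = c v" if "v < p + g * \<sigma>" for v using that by (simp add: c1_def)
    have "inj_on c1 {..<q}" using Cons.prems(2) hp by (subst inj_on_cong[of _ _ c]) (auto intro!: c1_eq simp: hub_ports_def)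
    moreover have "c1 v < q" for v using d(1) Cons.prems(1) by (simp add: c1_def)
    ultimately obtain c' where c': "\<And>v. c' v < q" "\<And>v. v < p + Suc g * \<sigma> \<Longrightarrow> c' v = c1 v"
      "mono_count c' (graph_edges p (Suc g) ts) + length (filter (matched c1) ts) \<le> 13 * length ts"
      using Cons.IH[of c1 "Suc g"] Cons.prems(3) by auto
    have "c1 (x j) = c (x j)" if "x \<in> set ts" "j < 6" for x j
      using that Cons.prems(3) by (intro c1_eq) (simp add: hub_ports_def trans_less_add1)
    then have "filter (matched c1) ts = filter (matched c) ts"
      by (intro filter_cong refl) (simp add: matched_def)
    moreover have "mono_count c' (gadget_edges p t g) = card (mono_pairs (set T) d)"
    proof -
      have "c' (place p t g s) = d s \<and> c' (place p t g (Inner k)) = d (Inner k)" if m: "(s,k) \<in> set T" for s k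
      proof -
        have k: "k < \<sigma>" using graphD(3) m .
        have i: "c' (p + g * \<sigma> + l) = d (Inner l)" if "l < \<sigma>" for l using that by (subst c'(2)) (auto simp: c1_def)
        from m hp show ?thesis
        proof (cases rule: place_cases[of _ _ _ _ g])
          case 1
          then have "c' (place p t g s) = c (place p t g s)" by (subst c'(2)) (auto simp: c1_eq)
          then show ?thesis using i[OF k] 1(1) d by (cases s) auto
        next
          case (2 l) then show ?thesis using i k by auto
        qed
      qed
      then show ?thesis unfolding mono_count_gadget mono_pairs_def by (intro arg_cong[of _ _ card]) auto
    qed
    ultimately show ?case
      by (intro exI[of _ c']) (use c' d(4) c1_eq in \<open>auto simp: mono_count_append split: if_splits\<close>)
  qed
  then show ?thesis using that by blast
qed

section \<open>Deletion sets and colourings\<close>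

lemma mono_edges_card:
  assumes "\<forall>t\<in>set ts. hub_ports p t"
  shows "card {e \<in> edge_set p ts. \<exists>u v. e = {u,v} \<and> c u = c v \<and> u \<noteq> v} = mono_count c (graph_edges p 0 ts)"
proof -
  let ?L = "filter (\<lambda>(u,v). c u = c v) (graph_edges p 0 ts)"
  have "{e \<in> edge_set p ts. \<exists>u v. e = {u,v} \<and> c u = c v \<and> u \<noteq> v} = (\<lambda>(u,v). {u,v}) ` set ?L"
    using graph_edges_bounds[OF _ assms, of _ _ 0] by (fastforce simp: edge_set_def doubleton_eq_iff)
  also have "\<dots> = set (map (\<lambda>(u,v). {u,v}) ?L)" by simp
  also have "card \<dots> = length ?L"
    using distinct_graph_edges[OF assms, of 0] by (subst distinct_card) (auto simp: distinct_map inj_on_def)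
  finally show ?thesis by (simp add: mono_count_def)
qed

lemma min_edge_deletion_cases:
  assumes "min_edge_deletion q V E X"
  shows "X \<subseteq> E" "colorable q V (E - X)" "\<lbrakk>Y \<subseteq> E; colorable q V (E - Y)\<rbrakk> \<Longrightarrow> card X \<le> card Y"
  using assms by (auto simp: min_edge_deletion_def is_arg_min_linorder)

lemma min_edge_deletion_mono_le:
  assumes ts: "\<forall>t\<in>set ts. hub_ports p t" and X: "min_edge_deletion q {..<p + length ts * \<sigma>} (edge_set p ts) X"
  obtains c where "\<And>v. c v < q" "mono_count c (graph_edges p 0 ts) \<le> card X"
proof -
  let ?E = "edge_set p ts" and ?V = "{..<p + length ts * \<sigma>}"
  have fin: "finite ?E" by (simp add: edge_set_def)
  note X' = min_edge_deletion_cases(1,2)[OF X]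
  obtain c0 where c0: "\<forall>v\<in>?V. c0 v < q" "\<forall>u v. {u, v} \<in> ?E - X \<longrightarrow> c0 u \<noteq> c0 v"
    using X'(2) by (auto simp: colorable_def)
  \<comment> \<open>\<open>colorable\<close> bounds colours on the vertex set only; the default 0
    elsewhere makes the bound by \<open>q\<close> hold everywhere.\<close>
  define c' where "c' = (\<lambda>v. if v \<in> ?V then c0 v else 0)"
  have sub: "{e \<in> ?E. \<exists>u v. e = {u,v} \<and> c' u = c' v \<and> u \<noteq> v} \<subseteq> X"
  proof clarify
    fix u v assume uv: "{u,v} \<in> ?E" "c' u = c' v"
    then have "u \<in> ?V" "v \<in> ?V" using simple_graph_edge_set[OF ts] by (auto simp: simple_graph_def)
    then have "c0 u = c0 v" using uv(2) by (simp add: c'_def)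
    then show "{u,v} \<in> X" using uv(1) c0(2) by blast
  qed
  have "mono_count c' (graph_edges p 0 ts) \<le> card X"
    unfolding mono_edges_card[OF ts, symmetric] by (rule card_mono[OF finite_subset[OF X'(1) fin] sub])
  moreover have "c' v < q" for v using c0(1) q2 by (auto simp: c'_def)
  ultimately show ?thesis using that by blast
qed

lemma min_edge_deletion_le_mono:
  assumes ts: "\<forall>t\<in>set ts. hub_ports p t" and X: "min_edge_deletion q {..<p + length ts * \<sigma>} (edge_set p ts) X"
    and c: "\<And>v. c v < q"
  shows "card X \<le> mono_count c (graph_edges p 0 ts)"
  unfolding mono_edges_card[OF ts, symmetric]
proof (rule min_edge_deletion_cases(3)[OF X])
  let ?E = "edge_set p ts" and ?V = "{..<p + length ts * \<sigma>}"
  show "colorable q ?V (?E - {e \<in> ?E. \<exists>u v. e = {u,v} \<and> c u = c v \<and> u \<noteq> v})"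
    unfolding colorable_def
  proof (intro exI[of _ c] conjI ballI allI impI)
    fix u v assume a: "{u, v} \<in> ?E - {e \<in> ?E. \<exists>u v. e = {u,v} \<and> c u = c v \<and> u \<noteq> v}"
    then have "card {u,v} = 2" using simple_graph_edge_set[OF ts] by (auto simp: simple_graph_def)
    then have "u \<noteq> v" by auto
    then show "c u \<noteq> c v" using a by blast
  qed (use c in auto)
qed auto

end

section \<open>Assignments split into guesses and colours\<close>

text \<open>Used in base \<open>C\<close> for the guesses, in base \<open>q\<close> for triples of
  colours and in base 2 for the bits of a block.\<close>

lemma digits_exist:
  fixes f :: "nat \<Rightarrow> nat"
  assumes "\<And>i. i < B \<Longrightarrow> f i < C"
  shows "\<exists>r<C ^ B. \<forall>i<B. r div C ^ i mod C = f i"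
  using assms
proof (induction B)
  case (Suc B)
  then obtain r where r: "r < C ^ B" "\<forall>i<B. r div C ^ i mod C = f i" by auto
  have fB: "f B < C" using Suc.prems by simp
  let ?r = "r + f B * C ^ B"
  have "?r < C ^ Suc B"
  proof -
    have "?r < C ^ B + f B * C ^ B" using r(1) by simp
    also have "\<dots> = Suc (f B) * C ^ B" by simp
    also have "\<dots> \<le> C * C ^ B" using fB by (intro mult_right_mono) auto
    finally show ?thesis by simp
  qed
  moreover have "?r div C ^ i mod C = f i" if "i < Suc B" for i
  proof (cases "i = B")
    case True then show ?thesis using r(1) fB by (simp add: div_mult_self1)
  next
    case False
    then have i: "i < B" using that by simp
    \<comment> \<open>The added top digit is divisible by C ^ i with a further factor
      \<open>C\<close> left over, so it does not affect digit i.\<close>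
    then have "C ^ B = C ^ i * (C * C ^ (B - Suc i))"
      by (metis Suc_diff_Suc power_Suc power_add add_diff_inverse_nat less_imp_le not_less_iff_gr_or_eq)
    then have e: "?r = r + C ^ i * (C * (C ^ (B - Suc i) * f B))" by (simp add: mult.commute mult.left_commute)
    have Ci: "C ^ i \<noteq> 0" using fB by simp
    have "?r div C ^ i = r div C ^ i + C * (C ^ (B - Suc i) * f B)"
      unfolding e by (subst div_mult_self2[OF Ci]) (rule add.commute)
    then show ?thesis using r(2) i by simp
  qed
  ultimately show ?case by blast
qed auto

text \<open>Short clauses are padded to three literals by repeating the last one. For the empty
  clause the value is meaningless and has to be guarded against.\<close>

definition lit_at :: "nat list \<Rightarrow> nat \<Rightarrow> nat" where
  "lit_at Cl j = Cl ! min j (length Cl - 1)"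

definition clause_true :: "(nat \<Rightarrow> bool) \<Rightarrow> nat list \<Rightarrow> bool" where
  "clause_true \<alpha> Cl \<longleftrightarrow> (\<exists>c\<in>set Cl. \<alpha> (c div 2) \<longleftrightarrow> c mod 2 = 1)"

definition nsat :: "(nat \<Rightarrow> bool) \<Rightarrow> nat list list \<Rightarrow> nat" where
  "nsat \<alpha> Cls = length (filter (clause_true \<alpha>) Cls)"

lemma ex_lit_at:
  assumes "Cl \<noteq> []" "length Cl \<le> 3"
  shows "(\<exists>j<3. P (lit_at Cl j)) \<longleftrightarrow> (\<exists>c\<in>set Cl. P c)"
proof
  assume "\<exists>j<3. P (lit_at Cl j)"
  then obtain j where "P (Cl ! min j (length Cl - 1))" by (auto simp: lit_at_def)
  moreover have "min j (length Cl - 1) < length Cl" using assms(1) by (cases Cl) auto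
  ultimately show "\<exists>c\<in>set Cl. P c" by auto
next
  assume "\<exists>c\<in>set Cl. P c"
  then obtain j where j: "j < length Cl" "P (Cl ! j)" by (auto simp: in_set_conv_nth)
  then show "\<exists>j<3. P (lit_at Cl j)"
    using assms(2) by (intro exI[of _ j]) (auto simp: lit_at_def min_def intro!: arg_cong[of _ _ P])
qed

text \<open>All quotients x div q with x < 2 ^ k are less than \<open>C\<close>.\<close>

locale block_encoding = hub_gadget +
  fixes k C :: nat
  assumes k0: "k > 0" and C_def: "C = 2 ^ k div q + 1"
begin

text \<open>One bit of the block value q * g + a, with the guessed quotient g and the colour
  \<open>a\<close>. The value may reach 2 ^ k or more; excess bits are never looked at, so every
  guess together with every choice of colours still denotes an assignment.\<close>

definition block_bit :: "nat \<Rightarrow> nat \<Rightarrow> nat \<Rightarrow> nat" where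
  "block_bit r a v = (q * (r div C ^ (v div k) mod C) + a) div 2 ^ (v mod k) mod 2"

definition digit :: "nat \<Rightarrow> nat \<Rightarrow> nat" where
  "digit \<tau> j = \<tau> div q ^ j mod q"

text \<open>Every literal has its own digit of \<tau>, even if two literals share a block. A triple
  with different digits for one block may get a gadget too, but it cannot match while the references
  are distinct, because the ports concerned lie on one hub vertex.\<close>

definition sat_tuple :: "nat \<Rightarrow> nat list \<Rightarrow> nat \<Rightarrow> bool" where
  "sat_tuple r Cl \<tau> \<longleftrightarrow> Cl \<noteq> [] \<and> (\<exists>j<3. block_bit r (digit \<tau> j) (lit_at Cl j div 2) = lit_at Cl j mod 2)"

definition port_map :: "nat list \<Rightarrow> nat \<Rightarrow> nat \<Rightarrow> nat" where
  "port_map Cl \<tau> j = (if j < 3 then q + lit_at Cl j div 2 div k else digit \<tau> (j - 3))"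

definition clause_ports :: "nat \<Rightarrow> nat list \<Rightarrow> (nat \<Rightarrow> nat) list" where
  "clause_ports r Cl = map (port_map Cl) (filter (sat_tuple r Cl) [0..<q ^ 3])"

definition all_ports :: "nat \<Rightarrow> nat list list \<Rightarrow> (nat \<Rightarrow> nat) list" where
  "all_ports r Cls = concat (map (clause_ports r) Cls)"

definition assignment :: "nat \<Rightarrow> (nat \<Rightarrow> nat) \<Rightarrow> nat \<Rightarrow> bool" where
  "assignment r dec v \<longleftrightarrow> block_bit r (dec (v div k)) v = 1"

definition good_clause :: "nat \<Rightarrow> nat list \<Rightarrow> bool" where
  "good_clause n Cl \<longleftrightarrow> length Cl \<le> 3 \<and> (\<forall>c\<in>set Cl. c div 2 < n)"

lemma q0: "q > 0" using q2 by simp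

lemma lit_at_mem: "Cl \<noteq> [] \<Longrightarrow> lit_at Cl j \<in> set Cl"
  unfolding lit_at_def by (rule nth_mem) (cases Cl; auto)

lemma hub_ports_port_map:
  assumes "good_clause n Cl" "Cl \<noteq> []"
  shows "hub_ports (q + (n div k + 1)) (port_map Cl \<tau>)"
proof -
  have "lit_at Cl j div 2 div k \<le> n div k" for j
    using assms lit_at_mem[of Cl j] by (intro div_le_mono) (auto simp: good_clause_def)
  then have "q + lit_at Cl j div 2 div k < q + (n div k + 1)" for j by (simp add: less_Suc_eq_le)
  moreover have "digit \<tau> j < q + (n div k + 1)" for j unfolding digit_def by (rule trans_less_add1) (use q0 in simp)
  ultimately show ?thesis by (simp add: hub_ports_def port_map_def)
qed

lemma hub_ports_all:
  assumes "\<forall>Cl\<in>set Cls. good_clause n Cl"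
  shows "\<forall>t\<in>set (all_ports r Cls). hub_ports (q + (n div k + 1)) t"
  using assms hub_ports_port_map by (auto simp: all_ports_def clause_ports_def sat_tuple_def)

lemma tuple_of_digits:
  assumes "\<And>j. a j < q"
  obtains \<tau> where "\<tau> < q ^ 3" "\<And>\<tau>'. \<tau>' < q ^ 3 \<Longrightarrow> (\<forall>j<3. digit \<tau>' j = a j) \<longleftrightarrow> \<tau>' = \<tau>"
proof -
  obtain \<tau> where \<tau>: "\<tau> < q ^ 3" "\<forall>j<3. \<tau> div q ^ j mod q = a j"
    using digits_exist[of 3 a q] assms by auto
  have rep: "x = x div q ^ 0 mod q + q * (x div q ^ 1 mod q) + q * q * (x div q ^ 2 mod q)" if "x < q ^ 3" for x
  proof -
    have "x div q ^ 2 < q" using that q0 by (simp add: div_less_iff_less_mult numeral_3_eq_3 power2_eq_square mult.assoc)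
    then have "x div q ^ 2 mod q = x div q div q" by (simp add: power2_eq_square div_mult2_eq)
    then show ?thesis by (simp add: mult.assoc) (metis distrib_left mod_mult_div_eq add.assoc)
  qed
  show ?thesis
  proof (rule that[OF \<tau>(1)])
    fix \<tau>' assume l: "\<tau>' < q ^ 3"
    show "(\<forall>j<3. digit \<tau>' j = a j) \<longleftrightarrow> \<tau>' = \<tau>"
    proof
      assume "\<forall>j<3. digit \<tau>' j = a j"
      then have "\<forall>j<3. \<tau>' div q ^ j mod q = \<tau> div q ^ j mod q" using \<tau>(2) by (simp add: digit_def)
      then show "\<tau>' = \<tau>" using rep[OF l] rep[OF \<tau>(1)] unfolding all_less_3 by metis
    qed (use \<tau>(2) in \<open>simp add: digit_def\<close>)
  qed
qed

lemma block_bit_eq_iff: "block_bit r a v = c mod 2 \<longleftrightarrow> (block_bit r a v = 1 \<longleftrightarrow> c mod 2 = 1)"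
proof -
  have "x mod 2 = c mod 2 \<longleftrightarrow> (x mod 2 = 1 \<longleftrightarrow> c mod 2 = 1)" for x :: nat
    by (cases "even x"; cases "even c") (simp_all add: even_iff_mod_2_eq_zero)
  then show ?thesis unfolding block_bit_def .
qed

lemma length_filter_unique:
  "\<tau> < N \<Longrightarrow> length (filter (\<lambda>x. P x \<and> x = \<tau>) [0..<N]) = of_bool (P \<tau>)"
proof -
  assume "\<tau> < N"
  then have "{x. P x \<and> x = \<tau>} \<inter> set [0..<N] = (if P \<tau> then {\<tau>} else {})" by auto
  then show ?thesis by (subst distinct_length_filter) auto
qed

text \<open>\<open>dec\<close> names the reference that shares the colour of a block vertex.
  Distinct references give each triple of block colours exactly one name \<tau>, so at most one
  gadget of the clause matches, and it has been built iff its triple satisfies the clause.\<close>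

lemma matched_clause_ports:
  assumes c: "\<And>v. c v < q" "inj_on c {..<q}" and dec: "\<And>i. dec i < q" "\<And>i. c (dec i) = c (q + i)"
    and Cl: "length Cl \<le> 3"
  shows "length (filter (matched c) (clause_ports r Cl)) = of_bool (clause_true (assignment r dec) Cl)"
proof -
  let ?a = "\<lambda>j. dec (lit_at Cl j div 2 div k)"
  obtain \<tau> where \<tau>: "\<tau> < q ^ 3" "\<And>\<tau>'. \<tau>' < q ^ 3 \<Longrightarrow> (\<forall>j<3. digit \<tau>' j = ?a j) \<longleftrightarrow> \<tau>' = \<tau>"
    using tuple_of_digits[of ?a] dec(1) by blast
  have "matched c (port_map Cl \<tau>') \<longleftrightarrow> \<tau>' = \<tau>" if "\<tau>' < q ^ 3" for \<tau>'
  proof -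
    have "digit \<tau>' j < q" for j using q0 by (simp add: digit_def)
    then have "c (q + i) = c (digit \<tau>' j) \<longleftrightarrow> digit \<tau>' j = dec i" for i j
      using c(2) dec unfolding inj_on_def by (metis lessThan_iff)
    then show ?thesis using \<tau>(2)[OF that] by (simp add: matched_def port_map_def)
  qed
  then have "filter (\<lambda>x. sat_tuple r Cl x \<and> matched c (port_map Cl x)) [0..<q^3] = filter (\<lambda>x. sat_tuple r Cl x \<and> x = \<tau>) [0..<q^3]"
    by (intro filter_cong) auto
  then have "length (filter (matched c) (clause_ports r Cl)) = of_bool (sat_tuple r Cl \<tau>)"
    using length_filter_unique[OF \<tau>(1)] by (simp add: clause_ports_def filter_map comp_def)
  also have "sat_tuple r Cl \<tau> \<longleftrightarrow> clause_true (assignment r dec) Cl"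
  proof (cases "Cl = []")
    case False
    have "\<forall>j<3. digit \<tau> j = ?a j" using \<tau> by blast
    then have "sat_tuple r Cl \<tau> \<longleftrightarrow> (\<exists>j<3. block_bit r (dec (lit_at Cl j div 2 div k)) (lit_at Cl j div 2) = lit_at Cl j mod 2)"
      using False unfolding sat_tuple_def by auto
    also have "\<dots> \<longleftrightarrow> (\<exists>c\<in>set Cl. block_bit r (dec (c div 2 div k)) (c div 2) = c mod 2)"
      by (rule ex_lit_at[OF False Cl])
    finally show ?thesis by (simp add: clause_true_def assignment_def block_bit_eq_iff)
  qed (simp add: sat_tuple_def clause_true_def)
  finally show ?thesis .
qed

lemma matched_all_ports:
  assumes "\<And>v. c v < q" "inj_on c {..<q}" "\<And>i. dec i < q" "\<And>i. c (dec i) = c (q + i)"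
    "\<forall>Cl\<in>set Cls. length Cl \<le> 3"
  shows "length (filter (matched c) (all_ports r Cls)) = nsat (assignment r dec) Cls"
  using assms(5)
proof (induction Cls)
  case (Cons Cl Cls)
  then show ?case using matched_clause_ports[OF assms(1-4), of Cl r] by (simp add: all_ports_def nsat_def)
qed (simp add: all_ports_def nsat_def)

text \<open>An optimal colouring with distinct references decodes to an assignment that satisfies
  one clause per unit saved. With colliding references nothing is saved, and any \<alpha> serves.
  Conversely, every \<open>dec\<close> is turned into a colouring that saves one unit per satisfied
  clause.\<close>

lemma deletion_value:
  fixes r n :: nat
  assumes Cls: "\<forall>Cl\<in>set Cls. good_clause n Cl"
  defines "p \<equiv> q + (n div k + 1)" and "ts \<equiv> all_ports r Cls"
  assumes X: "min_edge_deletion q {..<p + length ts * \<sigma>} (edge_set p ts) X"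
  shows deletion_value_upper: "\<exists>\<alpha>. 13 * length ts \<le> card X + nsat \<alpha> Cls"
    and deletion_value_lower: "\<And>dec. (\<And>i. dec i < q) \<Longrightarrow> card X + nsat (assignment r dec) Cls \<le> 13 * length ts"
proof -
  have hp: "\<forall>t\<in>set ts. hub_ports p t" using hub_ports_all[OF Cls] by (simp add: ts_def p_def)
  have len: "\<forall>Cl\<in>set Cls. length Cl \<le> 3" using Cls by (auto simp: good_clause_def)
  obtain c where c: "\<And>v. c v < q" "mono_count c (graph_edges p 0 ts) \<le> card X"
    using min_edge_deletion_mono_le[OF hp X] by blast
  note low = mono_count_lower[of c ts p 0, OF c(1)]
  show "\<exists>\<alpha>. 13 * length ts \<le> card X + nsat \<alpha> Cls"
  proof (cases "inj_on c {..<q}")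
    case True
    \<comment> \<open>\<open>q\<close> distinct references exhaust the colours, so every block
      vertex shares its colour with one of them.\<close>
    then have "c ` {..<q} = {..<q}" using c(1) by (intro endo_inj_surj) auto
    then have "\<exists>a<q. c a = c (q + i)" for i using c(1) by (metis imageE lessThan_iff)
    then obtain dec where dec: "\<And>i. dec i < q" "\<And>i. c (dec i) = c (q + i)" by metis
    have "length (filter (matched c) ts) = nsat (assignment r dec) Cls"
      unfolding ts_def by (rule matched_all_ports[OF c(1) True dec len])
    then show ?thesis using low c(2) True by (intro exI[of _ "assignment r dec"]) simp
  next
    case False
    have "length (filter (matched c) ts) \<le> length ts" by (rule length_filter_le)
    then have "13 * length ts \<le> card X" using low c(2) False unfolding if_not_P[OF False] by linarith
    then show ?thesis by (simp add: trans_le_add1)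
  qed
  fix dec :: "nat \<Rightarrow> nat" assume dec: "\<And>i. dec i < q"
  define c0 where "c0 = (\<lambda>v. if v < q then v else dec (v - q))"
  have c0: "c0 v < q" for v using dec by (simp add: c0_def)
  have inj: "inj_on c0 {..<q}" by (auto simp: inj_on_def c0_def)
  obtain c' where c': "\<And>v. c' v < q" "\<And>v. v < p + 0 * \<sigma> \<Longrightarrow> c' v = c0 v" "mono_count c' (graph_edges p 0 ts) + length (filter (matched c0) ts) \<le> 13 * length ts"
    by (rule mono_count_upper[OF c0 inj hp, of 0]) (rule that)
  have "length (filter (matched c0) ts) = nsat (assignment r dec) Cls"
    unfolding ts_def by (rule matched_all_ports[OF c0 inj dec _ len]) (use dec in \<open>simp add: c0_def\<close>)
  then show "card X + nsat (assignment r dec) Cls \<le> 13 * length ts"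
    using c'(3) min_edge_deletion_le_mono[OF hp X, of c', OF c'(1)] by linarith
qed

text \<open>The guess collects the quotients of the block values by \<open>q\<close>, and
  \<open>dec\<close> the remainders.\<close>

lemma assignment_covered:
  obtains r dec where "r < C ^ (n div k + 1)" "\<And>i. dec i < q" "\<And>v. v < n \<Longrightarrow> assignment r dec v = \<alpha> v"
proof -
  have "\<exists>x<2 ^ k. \<forall>j<k. (x::nat) div 2 ^ j mod 2 = of_bool (\<alpha> (i * k + j))" for i
    by (rule digits_exist) auto
  then obtain x :: "nat \<Rightarrow> nat" where x: "\<And>i. x i < 2 ^ k" "\<And>i j. j < k \<Longrightarrow> x i div 2 ^ j mod 2 = of_bool (\<alpha> (i * k + j))"
    by metis
  have "x i div q < C" for i
    using div_le_mono[OF less_imp_le[OF x(1)[of i]], of q] by (simp add: C_def)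
  then obtain r where r: "r < C ^ (n div k + 1)" "\<forall>i<n div k + 1. r div C ^ i mod C = x i div q"
    using digits_exist[of "n div k + 1" "\<lambda>i. x i div q" C] by auto
  show ?thesis
  proof (rule that[OF r(1)])
    show "x i mod q < q" for i using q0 by simp
    fix v assume "v < n"
    then have "v div k < n div k + 1" using div_le_mono[of v n k] by simp
    then have "block_bit r (x (v div k) mod q) v = x (v div k) div 2 ^ (v mod k) mod 2"
      using r(2) by (simp add: block_bit_def)
    also have "\<dots> = of_bool (\<alpha> v)" using x(2)[of "v mod k" "v div k"] k0 by simp
    finally show "assignment r (\<lambda>i. x i mod q) v = \<alpha> v" by (simp add: assignment_def)
  qed
qed

lemma nsat_cong:
  assumes "\<forall>Cl\<in>set Cls. good_clause n Cl" "\<And>v. v < n \<Longrightarrow> \<alpha> v = \<beta> v"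
  shows "nsat \<alpha> Cls = nsat \<beta> Cls"
proof -
  have "clause_true \<alpha> Cl = clause_true \<beta> Cl" if "Cl \<in> set Cls" for Cl
    using assms that by (auto simp: clause_true_def good_clause_def)
  then show ?thesis unfolding nsat_def by (metis (mono_tags, lifting) filter_cong)
qed

end

text \<open>The clauses violated by an assignment are the cheapest deletion that makes it
  satisfying. Counting list entries agrees with counting clauses because none is repeated.\<close>

lemma min_clause_deletion_eq:
  assumes dist: "distinct (map set Cs)" and F: "set ` set Cs = F"
    and M: "M \<le> nsat \<alpha> (map (map literal_code) Cs)" "\<And>\<beta>. nsat \<beta> (map (map literal_code) Cs) \<le> M"
  shows "min_clause_deletion F = length Cs - M"
proof -
  define tr where "tr = (\<lambda>(\<beta> :: nat \<Rightarrow> bool) C. \<exists>(v, b)\<in>C. \<beta> v = b)"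
  have code: "literal_code l div 2 = fst l" "literal_code l mod 2 = 1 \<longleftrightarrow> snd l" for l
    by (auto simp: literal_code_def)
  have ct: "clause_true \<beta> (map literal_code L) = tr \<beta> (set L)" for \<beta> L
    by (simp add: clause_true_def tr_def code code[unfolded One_nat_def] case_prod_unfold)
  have fin: "finite F" using F by auto
  have cardF: "card F = length Cs" using distinct_card[OF dist] F by simp
  have ns: "nsat \<beta> (map (map literal_code) Cs) = card {C\<in>F. tr \<beta> C}" for \<beta>
  proof -
    have "nsat \<beta> (map (map literal_code) Cs) = length (filter (tr \<beta>) (map set Cs))"
      by (simp add: nsat_def filter_map comp_def ct)
    also have "\<dots> = card (set (filter (tr \<beta>) (map set Cs)))"
      by (rule distinct_card[symmetric]) (use dist in simp)
    also have "set (filter (tr \<beta>) (map set Cs)) = {C\<in>F. tr \<beta> C}" using F by auto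
    finally show ?thesis .
  qed
  have sat: "satisfiable G \<longleftrightarrow> (\<exists>\<beta>. \<forall>C\<in>G. tr \<beta> C)" for G by (simp add: satisfiable_def tr_def)
  show ?thesis unfolding min_clause_deletion_def
  proof (rule Least_equality)
    let ?D = "{C\<in>F. \<not> tr \<alpha> C}"
    have "?D = F - {C\<in>F. tr \<alpha> C}" by auto
    then have "card ?D = length Cs - card {C\<in>F. tr \<alpha> C}" using fin cardF by (simp add: card_Diff_subset)
    also have "card {C\<in>F. tr \<alpha> C} = M" using M ns by (metis le_antisym)
    finally show "\<exists>D\<subseteq>F. card D = length Cs - M \<and> satisfiable (F - D)"
      by (intro exI[of _ ?D]) (auto simp: sat)
  next
    fix y assume "\<exists>D\<subseteq>F. card D = y \<and> satisfiable (F - D)"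
    then obtain D \<beta> where D: "D \<subseteq> F" "card D = y" "\<forall>C\<in>F - D. tr \<beta> C" by (auto simp: sat)
    have "card (F - D) \<le> card {C\<in>F. tr \<beta> C}" using D fin by (intro card_mono) auto
    then have "card F - card D \<le> M" using M(2)[of \<beta>] ns[of \<beta>] D(1) fin by (simp add: card_Diff_subset finite_subset)
    then show "length Cs - M \<le> y" using cardF D(2) by linarith
  qed
qed

section \<open>Timed programs and simulation in shifted memory\<close>

lemma bits_0 [simp]: "bits 0 = 1" by (simp add: bits_def floorlog_def)

lemma bits_pos: "bits n \<ge> 1" by (simp add: bits_def)

lemma bits_mono: "m \<le> n \<Longrightarrow> bits m \<le> bits n"
  by (simp add: bits_def floorlog_mono)

lemma less_two_power_bits: "n < 2 ^ (bits n - 1)"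
proof (cases "n = 0")
  case False
  then show ?thesis using floorlog_bounds[of n 2] by (simp add: bits_def)
qed simp

lemma bits_le: "n < 2 ^ m \<Longrightarrow> bits n \<le> 1 + m"
  by (simp add: bits_def floorlog_leI)

lemma bits_two_power: "bits (2 ^ m) = m + 2"
  by (simp add: bits_def floorlog_power[of 2 1 m, simplified] floorlog_def)

lemma bits_mult: "bits (m * n) \<le> bits m + bits n"
proof -
  have "m * n < 2 ^ (bits m - 1) * 2 ^ (bits n - 1)"
    by (intro mult_strict_mono less_two_power_bits) auto
  then have "m * n < 2 ^ (bits m - 1 + (bits n - 1))" by (simp add: power_add)
  from bits_le[OF this] show ?thesis using bits_pos[of m] by simp
qed

lemma bits_Suc: "bits (Suc n) \<le> bits n + 1"
proof -
  have "Suc n \<le> 2 ^ (bits n - 1)" using less_two_power_bits[of n] by simp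
  also have "\<dots> < 2 ^ bits n" using bits_pos[of n] by (intro power_strict_increasing) auto
  finally show ?thesis using bits_le by simp
qed

lemma bits_power: "bits (n ^ w) \<le> 2 + w * bits n"
proof (induction w)
  case 0 then show ?case using bits_two_power[of 0] by simp
next
  case (Suc w) then show ?case using bits_mult[of n "n ^ w"] by simp
qed

text \<open>Chosen such that values are at most V ^ weight as long as all cells read hold at most V.
  Constants count with their value instead of their length; they belong to the program text and do
  not depend on the input.\<close>

fun weight :: "expr \<Rightarrow> nat" where
  "weight (Num k) = k + 1"
| "weight (Cell a e) = weight e + 1"
| "weight (Add e f) = weight e + weight f + 1"
| "weight (Sub e f) = weight e + weight f + 1"
| "weight (Mul e f) = weight e + weight f + 1"
| "weight (Quot e f) = weight e + weight f + 1"

fun reads_le :: "nat \<Rightarrow> store \<Rightarrow> expr \<Rightarrow> bool" where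
  "reads_le V s (Num k) = True"
| "reads_le V s (Cell a e) = (reads_le V s e \<and> s a (eval s e) \<le> V)"
| "reads_le V s (Add e f) = (reads_le V s e \<and> reads_le V s f)"
| "reads_le V s (Sub e f) = (reads_le V s e \<and> reads_le V s f)"
| "reads_le V s (Mul e f) = (reads_le V s e \<and> reads_le V s f)"
| "reads_le V s (Quot e f) = (reads_le V s e \<and> reads_le V s f)"

lemma eval_le_power:
  assumes "V \<ge> 2" "reads_le V s e"
  shows "eval s e \<le> V ^ weight e"
  using assms(2)
proof (induction e)
  case (Num k)
  have "k \<le> 2 ^ k" by (simp add: less_imp_le)
  also have "\<dots> \<le> V ^ k" using assms(1) by (rule power_mono) simp
  also have "\<dots> \<le> V ^ (k + 1)" using assms(1) by (intro power_increasing) auto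
  finally show ?case by simp
next
  case (Cell a e)
  have "V ^ 1 \<le> V ^ weight (Cell a e)" using assms(1) by (intro power_increasing) auto
  moreover have "eval s (Cell a e) \<le> V ^ 1" using Cell.prems by simp
  ultimately show ?case by (rule order_trans[rotated])
next
  case (Add e f)
  have "1 \<le> V ^ weight e" "1 \<le> V ^ weight f" using assms(1) by simp_all
  then have "V ^ weight e + V ^ weight f \<le> 2 * (V ^ weight e * V ^ weight f)"
    by (metis add_mono mult_2 mult.right_neutral mult.left_neutral mult_le_mono order_refl)
  also have "\<dots> \<le> V * (V ^ weight e * V ^ weight f)" using assms(1) by (rule mult_le_mono1)
  finally show ?case using Add by (simp add: power_add)
next
  case (Sub e f)
  have "V ^ weight e \<le> V ^ weight (Sub e f)" using assms(1) by (intro power_increasing) auto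
  then show ?case using Sub by simp
next
  case (Mul e f)
  have "eval s e * eval s f \<le> V ^ weight e * V ^ weight f" using Mul by (intro mult_le_mono) auto
  also have "\<dots> \<le> V ^ weight (Mul e f)" using assms(1) by (simp add: power_add)
  finally show ?case by simp
next
  case (Quot e f)
  have "eval s e div eval s f \<le> eval s e" by (rule div_le_dividend)
  also have "\<dots> \<le> V ^ weight e" using Quot by simp
  also have "\<dots> \<le> V ^ weight (Quot e f)" using assms(1) by (intro power_increasing) auto
  finally show ?case by simp
qed

definition ecost :: "expr \<Rightarrow> nat" where
  "ecost e = weight e * (2 + weight e)"

text \<open>There are at most \<open>weight e\<close> nodes, and each value is at most V ^
  \<open>weight e\<close>, hence of length at most 2 + \<open>weight e\<close> *
  \<open>bits V\<close>. The point is that \<open>ecost e\<close> does not depend on the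
  store.\<close>

lemma cost_le:
  assumes "V \<ge> 2" "reads_le V s e"
  shows "cost s e \<le> ecost e * bits V"
proof -
  define L where "L = bits V"
  have b: "bits (eval s e) \<le> 2 + weight e * L" if "reads_le V s e" for e
    using bits_mono[OF eval_le_power[OF assms(1) that]] bits_power[of V "weight e"] by (simp add: L_def)
  have two: "x + y + z \<le> (a + c + 1) * (2 + (a + c + 1) * L)"
    if "x \<le> a * (2 + a * L)" "y \<le> c * (2 + c * L)" "z \<le> 2 + (a + c + 1) * L" for a c x y z
  proof -
    have "a * (2 + a * L) + c * (2 + c * L) + (2 + (a + c + 1) * L) \<le> (a + c + 1) * (2 + (a + c + 1) * L)"
      by (simp add: algebra_simps)
    then show ?thesis using that by linarith
  qed
  have one: "a * (2 + a * L) + (2 + (a + 1) * L) \<le> (a + 1) * (2 + (a + 1) * L)" for a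
    by (simp add: algebra_simps)
  have "cost s e \<le> weight e * (2 + weight e * L)" using assms(2)
  proof (induction e)
    case (Num k) then show ?case using b[of "Num k"] by simp
  next
    case (Cell a e)
    have "cost s (Cell a e) \<le> weight e * (2 + weight e * L) + (2 + (weight e + 1) * L)"
      using Cell b[of "Cell a e"] by simp
    also note one
    finally show ?case by simp
  next
    case (Add e f)
    show ?case unfolding cost.simps weight.simps by (rule two) (use Add b[of "Add e f"] in simp_all)
  next
    case (Sub e f)
    show ?case unfolding cost.simps weight.simps by (rule two) (use Sub b[of "Sub e f"] in simp_all)
  next
    case (Mul e f)
    show ?case unfolding cost.simps weight.simps by (rule two) (use Mul b[of "Mul e f"] in simp_all)
  next
    case (Quot e f)
    show ?case unfolding cost.simps weight.simps by (rule two) (use Quot b[of "Quot e f"] in simp_all)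
  qed
  also have "\<dots> \<le> weight e * ((2 + weight e) * L)"
    using bits_pos[of V] by (intro mult_le_mono2) (simp add: L_def algebra_simps)
  finally show ?thesis unfolding ecost_def L_def by (simp only: mult.assoc)
qed

section \<open>Timed Hoare triples for total correctness\<close>

definition triple :: "(store \<Rightarrow> bool) \<Rightarrow> prog \<Rightarrow> (store \<Rightarrow> bool) \<Rightarrow> nat \<Rightarrow> bool" where
  "triple A P B T \<longleftrightarrow> (\<forall>s. A s \<longrightarrow> (\<exists>t s'. exec P s t s' \<and> B s' \<and> t \<le> T))"

lemma triple_conseq:
  "triple A P B T \<Longrightarrow> (\<And>s. A' s \<Longrightarrow> A s) \<Longrightarrow> (\<And>s. B s \<Longrightarrow> B' s) \<Longrightarrow> T \<le> T' \<Longrightarrow> triple A' P B' T'"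
  unfolding triple_def by (meson order_trans)

lemma triple_Skip: "(\<And>s. A s \<Longrightarrow> B s) \<Longrightarrow> triple A Skip B 1"
  unfolding triple_def using exec.Skip by blast

lemma triple_Seq: "triple A P B T \<Longrightarrow> triple B P' D T' \<Longrightarrow> triple A (Seq P P') D (T + T')"
  unfolding triple_def by (meson exec.Seq add_mono)

definition acost :: "expr \<Rightarrow> expr \<Rightarrow> nat" where
  "acost i e = 1 + ecost i + ecost e"

lemma triple_Assign:
  assumes "V \<ge> 2" "\<And>s. A s \<Longrightarrow> reads_le V s i \<and> reads_le V s e"
    "\<And>s. A s \<Longrightarrow> B (s(a := (s a)(eval s i := eval s e)))"
  shows "triple A (Assign a i e) B (acost i e * bits V)"
  unfolding triple_def
proof (intro allI impI)
  fix s assume A: "A s"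
  have "1 + cost s i + cost s e \<le> acost i e * bits V"
    using cost_le[OF assms(1), of s i] cost_le[OF assms(1), of s e] assms(2)[OF A] bits_pos[of V]
    by (simp add: acost_def algebra_simps)
  then show "\<exists>t s'. exec (Assign a i e) s t s' \<and> B s' \<and> t \<le> acost i e * bits V"
    using exec.Assign assms(3)[OF A] by blast
qed

lemma triple_Cond:
  assumes "V \<ge> 2" "\<And>s. A s \<Longrightarrow> reads_le V s b"
    "triple (\<lambda>s. A s \<and> eval s b \<noteq> 0) P B T" "triple (\<lambda>s. A s \<and> eval s b = 0) P' B T'"
  shows "triple A (Cond b P P') B ((1 + ecost b) * bits V + T + T')"
  unfolding triple_def
proof (intro allI impI)
  fix s assume A: "A s"
  have c: "1 + cost s b \<le> (1 + ecost b) * bits V"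
    using cost_le[OF assms(1), of s b] assms(2)[OF A] bits_pos[of V] by simp
  show "\<exists>t s'. exec (Cond b P P') s t s' \<and> B s' \<and> t \<le> (1 + ecost b) * bits V + T + T'"
  proof (cases "eval s b = 0")
    case True
    then obtain t s' where e: "exec P' s t s'" "B s'" "t \<le> T'" using assms(4) A unfolding triple_def by blast
    show ?thesis
    proof (intro exI conjI)
      show "exec (Cond b P P') s (1 + cost s b + t) s'" using exec.CondFalse[OF True e(1)] .
    qed (use c e in auto)
  next
    case False
    then obtain t s' where e: "exec P s t s'" "B s'" "t \<le> T" using assms(3) A unfolding triple_def by blast
    show ?thesis
    proof (intro exI conjI)
      show "exec (Cond b P P') s (1 + cost s b + t) s'" using exec.CondTrue[OF False e(1)] .
    qed (use c e in auto)
  qed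
qed

text \<open>Indexing the invariant by the number of finished rounds yields termination and the exact
  number of rounds at once; the induction is on the rounds left.\<close>

lemma triple_While:
  assumes "V \<ge> 2" "\<And>i s. i \<le> m \<Longrightarrow> I i s \<Longrightarrow> reads_le V s b \<and> (eval s b \<noteq> 0 \<longleftrightarrow> i < m)"
    and body: "\<And>i. i < m \<Longrightarrow> triple (I i) P (I (Suc i)) T"
  shows "triple (I 0) (While b P) (I m) (m * (T + (1 + ecost b) * bits V) + (1 + ecost b) * bits V)"
proof -
  let ?c = "(1 + ecost b) * bits V"
  have c: "1 + cost s b \<le> ?c" if "i \<le> m" "I i s" for i s
    using cost_le[OF assms(1), of s b] assms(2)[OF that] bits_pos[of V] by simp
  have "triple (I (m - d)) (While b P) (I m) (d * (T + ?c) + ?c)" if "d \<le> m" for d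
    using that
  proof (induction d)
    case 0
    show ?case unfolding triple_def
    proof (intro allI impI)
      fix s assume I: "I (m - 0) s"
      then have "eval s b = 0" using assms(2)[of m s] by simp
      from exec.WhileFalse[OF this, of P]
      show "\<exists>t s'. exec (While b P) s t s' \<and> I m s' \<and> t \<le> 0 * (T + ?c) + ?c"
        using I c[of m s] by auto
    qed
  next
    case (Suc d)
    show ?case unfolding triple_def
    proof (intro allI impI)
      fix s assume I: "I (m - Suc d) s"
      have lt: "m - Suc d < m" "Suc (m - Suc d) = m - d" using Suc.prems by auto
      have nz: "eval s b \<noteq> 0" using assms(2)[of "m - Suc d" s] lt I by simp
      obtain t s' where e: "exec P s t s'" "I (m - d) s'" "t \<le> T"
        using body[OF lt(1)] I unfolding triple_def lt(2) by blast
      obtain t' s'' where e': "exec (While b P) s' t' s''" "I m s''" "t' \<le> d * (T + ?c) + ?c"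
        using Suc e(2) unfolding triple_def by (meson Suc_leD)
      have "1 + cost s b + t + t' \<le> Suc d * (T + ?c) + ?c"
        using c[of "m - Suc d" s] I e(3) e'(3) by simp
      then show "\<exists>t s'. exec (While b P) s t s' \<and> I m s' \<and> t \<le> Suc d * (T + ?c) + ?c"
        using exec.WhileTrue[OF nz e(1) e'(1)] e'(2) by blast
    qed
  qed
  from this[of m] show ?thesis by simp
qed

fun seqs :: "prog list \<Rightarrow> prog" where
  "seqs [] = Skip" | "seqs (P # Ps) = Seq P (seqs Ps)"

lemma triple_seqs:
  assumes "\<And>i. i < length Ps \<Longrightarrow> triple (I i) (Ps ! i) (I (Suc i)) T"
  shows "triple (I 0) (seqs Ps) (I (length Ps)) (length Ps * T + 1)"
  using assms
proof (induction Ps arbitrary: I)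
  case Nil then show ?case by (auto intro: triple_conseq[OF triple_Skip[of "I 0" "I 0"]])
next
  case (Cons P Ps)
  have "triple (I 0) P (I 1) T" using Cons.prems[of 0] by simp
  moreover have "triple (I 1) (seqs Ps) (I (Suc (length Ps))) (length Ps * T + 1)"
    unfolding One_nat_def by (rule Cons.IH[of "\<lambda>i. I (Suc i)", unfolded One_nat_def]) (use Cons.prems in fastforce)
  ultimately have "triple (I 0) (Seq P (seqs Ps)) (I (Suc (length Ps))) (T + (length Ps * T + 1))"
    by (rule triple_Seq)
  then show ?case by simp
qed

section \<open>Interleaved memories of many runs\<close>

definition scalar :: "nat \<Rightarrow> expr" where "scalar a = Cell a (Num 0)"

lemma eval_scalar [simp]: "eval s (scalar a) = s a 0" by (simp add: scalar_def)
lemma reads_le_scalar [simp]: "reads_le V s (scalar a) \<longleftrightarrow> s a 0 \<le> V" by (simp add: scalar_def)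

text \<open>Run \<open>r\<close> of \<open>N\<close> keeps cell \<open>i\<close> of bank \<open>a\<close> at address \<open>i * N + r\<close> of bank \<open>a + c\<^sub>0\<close>: every run finds
  zeroed memory, and addresses grow by \<open>O(log N)\<close> bits only. Scalars 1 and 2 hold \<open>N\<close> and \<open>r\<close>.\<close>

definition run_index :: "expr \<Rightarrow> expr" where
  "run_index e = Add (Mul e (scalar 1)) (scalar 2)"

fun shift_expr :: "nat \<Rightarrow> expr \<Rightarrow> expr" where
  "shift_expr c0 (Num k) = Num k"
| "shift_expr c0 (Cell a e) = Cell (c0 + a) (run_index (shift_expr c0 e))"
| "shift_expr c0 (Add e f) = Add (shift_expr c0 e) (shift_expr c0 f)"
| "shift_expr c0 (Sub e f) = Sub (shift_expr c0 e) (shift_expr c0 f)"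
| "shift_expr c0 (Mul e f) = Mul (shift_expr c0 e) (shift_expr c0 f)"
| "shift_expr c0 (Quot e f) = Quot (shift_expr c0 e) (shift_expr c0 f)"

fun shift_prog :: "nat \<Rightarrow> prog \<Rightarrow> prog" where
  "shift_prog c0 Skip = Skip"
| "shift_prog c0 (Assign a i e) = Assign (c0 + a) (run_index (shift_expr c0 i)) (shift_expr c0 e)"
| "shift_prog c0 (Seq P P') = Seq (shift_prog c0 P) (shift_prog c0 P')"
| "shift_prog c0 (Cond b P P') = Cond (shift_expr c0 b) (shift_prog c0 P) (shift_prog c0 P')"
| "shift_prog c0 (While b P) = While (shift_expr c0 b) (shift_prog c0 P)"

text \<open>\<open>2 < c0\<close> protects scalars 1 and 2, on which every shifted address depends,
  from the hosted program.\<close>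

definition hosts :: "nat \<Rightarrow> nat \<Rightarrow> nat \<Rightarrow> store \<Rightarrow> store \<Rightarrow> bool" where
  "hosts c0 N r S s \<longleftrightarrow> 2 < c0 \<and> r < N \<and> S 1 0 = N \<and> S 2 0 = r \<and> (\<forall>a j. S (c0 + a) (j * N + r) = s a j)"

definition same_outside :: "nat \<Rightarrow> nat \<Rightarrow> nat \<Rightarrow> store \<Rightarrow> store \<Rightarrow> bool" where
  "same_outside c0 N r S S' \<longleftrightarrow> (\<forall>a i. a < c0 \<or> i mod N \<noteq> r \<longrightarrow> S' a i = S a i)"

lemma same_outside_trans: "same_outside c0 N r S S' \<Longrightarrow> same_outside c0 N r S' S'' \<Longrightarrow> same_outside c0 N r S S''"
  by (simp add: same_outside_def)

text \<open>By \<open>cost_run_index\<close>, forming the address i * N + r costs at most 2 * bits i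
  + 4 * bits N + 3 on top of i; the rest is slack for the values themselves.\<close>

definition slowdown :: "nat \<Rightarrow> nat" where "slowdown N = 4 * bits N + 10"

lemma run_index_unique: "r < N \<Longrightarrow> r' < N \<Longrightarrow> i * N + r = j * N + r' \<longleftrightarrow> i = j \<and> r = (r'::nat)"
  by (metis div_mult_self3 div_less add.right_neutral add_left_cancel gr_implies_not0)

lemma cost_run_index:
  assumes "S 1 0 = N" "S 2 0 = r" "r < N"
  shows "cost S (run_index e) \<le> cost S e + 2 * bits (eval S e) + 4 * bits N + 3"
proof -
  let ?x = "eval S e"
  have "?x * N + r \<le> Suc ?x * N" using assms(3) by simp
  then have "bits (?x * N + r) \<le> bits (Suc ?x) + bits N" using bits_mono bits_mult order_trans by blast
  then have "bits (?x * N + r) \<le> bits ?x + 1 + bits N" using bits_Suc[of ?x] by linarith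
  moreover have "bits r \<le> bits N" using assms(3) by (simp add: bits_mono)
  moreover have "bits (?x * N) \<le> bits ?x + bits N" by (rule bits_mult)
  ultimately show ?thesis using assms by (simp add: run_index_def scalar_def)
qed

text \<open>The summand \<open>2 * bits (eval s e)\<close> prepays the use of the value as an
  address, which \<open>cost_run_index\<close> charges when \<open>e\<close> is the index of a cell.
  This carries the induction through nested cells.\<close>

lemma shift_expr_eval:
  assumes "hosts c0 N r S s"
  shows "eval S (shift_expr c0 e) = eval s e"
    "cost S (shift_expr c0 e) + 2 * bits (eval s e) \<le> slowdown N * cost s e"
proof -
  have h: "S 1 0 = N" "S 2 0 = r" "r < N" "\<And>a j. S (c0 + a) (j * N + r) = s a j"
    using assms by (auto simp: hosts_def)
  have ev: "eval S (shift_expr c0 e) = eval s e" for e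
    by (induction e) (use h in \<open>auto simp: run_index_def\<close>)
  then show "eval S (shift_expr c0 e) = eval s e" .
  define K where "K = slowdown N"
  have K: "4 * bits N + 10 \<le> K" by (simp add: K_def slowdown_def)
  have K1: "x + y + bits z + 2 * bits z \<le> K * (a + b + bits z)" if "x \<le> K * a" "y \<le> K * b" for x y z a b
  proof -
    have "3 * bits z \<le> K * bits z" using K by (intro mult_le_mono1) simp
    then have "x + y + 3 * bits z \<le> K * a + K * b + K * bits z" using that by linarith
    then show ?thesis by (simp add: distrib_left)
  qed
  show "cost S (shift_expr c0 e) + 2 * bits (eval s e) \<le> slowdown N * cost s e"
    unfolding K_def[symmetric]
  proof (induction e)
    case (Num k)
    have "3 * bits k \<le> K * bits k" using K by (intro mult_le_mono1) simp
    then show ?case by simp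
  next
    case (Cell a e)
    let ?v = "s a (eval s e)"
    have "cost S (run_index (shift_expr c0 e)) \<le> K * cost s e + 4 * bits N + 3"
      using cost_run_index[of S N r "shift_expr c0 e", OF h(1-3)] Cell unfolding ev[of e] by linarith
    moreover have "eval S (run_index (shift_expr c0 e)) = eval s e * N + r" using h by (simp add: run_index_def ev)
    ultimately have "cost S (shift_expr c0 (Cell a e)) + 2 * bits ?v \<le> K * cost s e + 4 * bits N + 3 + 3 * bits ?v"
      using h(4) by simp
    also have "\<dots> \<le> K * cost s e + K * bits ?v"
    proof -
      have "4 * bits N + 3 + 3 * bits ?v \<le> (4 * bits N + 3) * bits ?v + 3 * bits ?v" using bits_pos[of ?v] by simp
      also have "\<dots> = (4 * bits N + 6) * bits ?v" by (simp add: algebra_simps)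
      also have "\<dots> \<le> K * bits ?v" using K by (intro mult_le_mono1) simp
      finally show ?thesis by simp
    qed
    finally show ?case by (simp add: distrib_left)
  next
    case (Add e f) then show ?case using K1[of "cost S (shift_expr c0 e)" "cost s e" "cost S (shift_expr c0 f)" "cost s f"] ev by simp
  next
    case (Sub e f) then show ?case using K1[of "cost S (shift_expr c0 e)" "cost s e" "cost S (shift_expr c0 f)" "cost s f"] ev by simp
  next
    case (Mul e f) then show ?case using K1[of "cost S (shift_expr c0 e)" "cost s e" "cost S (shift_expr c0 f)" "cost s f"] ev by simp
  next
    case (Quot e f) then show ?case using K1[of "cost S (shift_expr c0 e)" "cost s e" "cost S (shift_expr c0 f)" "cost s f"] ev by simp
  qed
qed

lemma shift_expr_cost:
  assumes "hosts c0 N r S s"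
  shows "1 + cost S (shift_expr c0 e) \<le> slowdown N * (1 + cost s e)"
  using shift_expr_eval(2)[OF assms, of e] by (simp add: slowdown_def)

lemma shift_prog_exec:
  assumes "exec P s t s'" "hosts c0 N r S s"
  shows "\<exists>S' t'. exec (shift_prog c0 P) S t' S' \<and> hosts c0 N r S' s' \<and> same_outside c0 N r S S' \<and> t' \<le> slowdown N * t"
  using assms
proof (induction arbitrary: S rule: exec.induct)
  case (Skip s)
  then show ?case using exec.Skip by (intro exI[of _ S] exI[of _ 1]) (auto simp: same_outside_def slowdown_def)
next
  case (Assign a i e s)
  note h = Assign[unfolded hosts_def]
  let ?j = "eval s i * N + r"
  let ?S = "S(c0 + a := (S (c0 + a))(?j := eval s e))"
  have ev: "eval S (run_index (shift_expr c0 i)) = ?j" "eval S (shift_expr c0 e) = eval s e"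
    using h shift_expr_eval(1)[OF Assign] by (auto simp: run_index_def)
  have ci: "cost S (run_index (shift_expr c0 i)) \<le> slowdown N * cost s i + 4 * bits N + 3"
    using cost_run_index[of S N r "shift_expr c0 i"] h shift_expr_eval[OF Assign, of i] by simp
  have ce: "cost S (shift_expr c0 e) \<le> slowdown N * cost s e" using shift_expr_eval(2)[OF Assign, of e] by simp
  show ?case
  proof (intro exI conjI)
    show "exec (shift_prog c0 (Assign a i e)) S (1 + cost S (run_index (shift_expr c0 i)) + cost S (shift_expr c0 e)) ?S"
      using exec.Assign[of "c0 + a" "run_index (shift_expr c0 i)" "shift_expr c0 e" S] by (simp add: ev)
    show "hosts c0 N r ?S (s(a := (s a)(eval s i := eval s e)))"
      using h run_index_unique[of r N r] by (auto simp: hosts_def)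
    show "same_outside c0 N r S ?S" using h by (auto simp: same_outside_def)
    show "1 + cost S (run_index (shift_expr c0 i)) + cost S (shift_expr c0 e) \<le> slowdown N * (1 + cost s i + cost s e)"
      using ci ce by (simp add: distrib_left slowdown_def)
  qed
next
  case (Seq P s t s' P' t' s'')
  obtain S1 t1 where 1: "exec (shift_prog c0 P) S t1 S1" "hosts c0 N r S1 s'" "same_outside c0 N r S S1" "t1 \<le> slowdown N * t"
    using Seq by blast
  obtain S2 t2 where 2: "exec (shift_prog c0 P') S1 t2 S2" "hosts c0 N r S2 s''" "same_outside c0 N r S1 S2" "t2 \<le> slowdown N * t'"
    using Seq 1(2) by blast
  show ?case
  proof (intro exI conjI)
    show "exec (shift_prog c0 (Seq P P')) S (t1 + t2) S2" using exec.Seq[OF 1(1) 2(1)] by simp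
  qed (use 1 2 same_outside_trans in \<open>auto simp: distrib_left\<close>)
next
  case (CondTrue s b P t s' P')
  obtain S1 t1 where 1: "exec (shift_prog c0 P) S t1 S1" "hosts c0 N r S1 s'" "same_outside c0 N r S S1" "t1 \<le> slowdown N * t"
    using CondTrue by blast
  have b: "eval S (shift_expr c0 b) \<noteq> 0" using CondTrue shift_expr_eval(1) by simp
  show ?case
  proof (intro exI conjI)
    show "exec (shift_prog c0 (Cond b P P')) S (1 + cost S (shift_expr c0 b) + t1) S1" using exec.CondTrue[OF b 1(1)] by simp
    show "1 + cost S (shift_expr c0 b) + t1 \<le> slowdown N * (1 + cost s b + t)"
      using shift_expr_cost[OF CondTrue.prems, of b] 1(4) by (simp add: distrib_left)
  qed (use 1 in auto)
next
  case (CondFalse s b P' t s' P)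
  obtain S1 t1 where 1: "exec (shift_prog c0 P') S t1 S1" "hosts c0 N r S1 s'" "same_outside c0 N r S S1" "t1 \<le> slowdown N * t"
    using CondFalse by blast
  have b: "eval S (shift_expr c0 b) = 0" using CondFalse shift_expr_eval(1) by simp
  show ?case
  proof (intro exI conjI)
    show "exec (shift_prog c0 (Cond b P P')) S (1 + cost S (shift_expr c0 b) + t1) S1" using exec.CondFalse[OF b 1(1)] by simp
    show "1 + cost S (shift_expr c0 b) + t1 \<le> slowdown N * (1 + cost s b + t)"
      using shift_expr_cost[OF CondFalse.prems, of b] 1(4) by (simp add: distrib_left)
  qed (use 1 in auto)
next
  case (WhileFalse s b P)
  have b: "eval S (shift_expr c0 b) = 0" using WhileFalse shift_expr_eval(1) by simp
  show ?case
  proof (intro exI conjI)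
    show "exec (shift_prog c0 (While b P)) S (1 + cost S (shift_expr c0 b)) S" using exec.WhileFalse[OF b] by simp
    show "1 + cost S (shift_expr c0 b) \<le> slowdown N * (1 + cost s b)"
      using shift_expr_cost[OF WhileFalse.prems, of b] .
  qed (use WhileFalse in \<open>auto simp: same_outside_def\<close>)
next
  case (WhileTrue s b P t s' t' s'')
  obtain S1 t1 where 1: "exec (shift_prog c0 P) S t1 S1" "hosts c0 N r S1 s'" "same_outside c0 N r S S1" "t1 \<le> slowdown N * t"
    using WhileTrue by blast
  obtain S2 t2 where 2: "exec (shift_prog c0 (While b P)) S1 t2 S2" "hosts c0 N r S2 s''" "same_outside c0 N r S1 S2" "t2 \<le> slowdown N * t'"
    using WhileTrue 1(2) by blast
  have b: "eval S (shift_expr c0 b) \<noteq> 0" using WhileTrue shift_expr_eval(1) by simp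
  show ?case
  proof (intro exI conjI)
    show "exec (shift_prog c0 (While b P)) S (1 + cost S (shift_expr c0 b) + t1 + t2) S2"
      using exec.WhileTrue[OF b 1(1)] 2(1) by simp
    show "1 + cost S (shift_expr c0 b) + t1 + t2 \<le> slowdown N * (1 + cost s b + t + t')"
      using shift_expr_cost[OF WhileTrue.prems, of b] 1(4) 2(4) by (simp add: distrib_left)
    show "same_outside c0 N r S S2" using 1(3) 2(3) by (rule same_outside_trans)
  qed (use 1 2 in auto)
qed

section \<open>The reduction program\<close>

text \<open>The banks below 13 obey a uniform bound on their contents; those of the hosted program
  do not.\<close>

fun own :: "expr \<Rightarrow> bool" where
  "own (Num k) = True"
| "own (Cell a e) = (a < 13 \<and> own e)"
| "own (Add e f) = (own e \<and> own f)"
| "own (Sub e f) = (own e \<and> own f)"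
| "own (Mul e f) = (own e \<and> own f)"
| "own (Quot e f) = (own e \<and> own f)"

lemma own_reads_le:
  assumes "own e" "\<And>a i. a < 13 \<Longrightarrow> s a i \<le> V"
  shows "reads_le V s e"
  using assms(1) by (induction e) (auto intro: assms(2))

lemma own_scalar [simp]: "own (scalar a) \<longleftrightarrow> a < 13" by (simp add: scalar_def)

lemma own_run_index [simp]: "own (run_index e) = own e" by (simp add: run_index_def)

definition mod_expr :: "expr \<Rightarrow> expr \<Rightarrow> expr" where
  "mod_expr e f = Sub e (Mul (Quot e f) f)"

text \<open>Subtraction truncates at 0, so the sum of the two differences is |e - f|.\<close>

definition eq_expr :: "expr \<Rightarrow> expr \<Rightarrow> expr" where
  "eq_expr e f = Sub (Num 1) (Add (Sub e f) (Sub f e))"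

lemma eval_mod_expr [simp]: "eval s (mod_expr e f) = eval s e mod eval s f"
  by (simp add: mod_expr_def minus_div_mult_eq_mod)

lemma eval_eq_expr [simp]: "eval s (eq_expr e f) = of_bool (eval s e = eval s f)"
  by (simp add: eq_expr_def)

lemma own_mod_eq [simp]: "own (mod_expr e f) \<longleftrightarrow> own e \<and> own f" "own (eq_expr e f) \<longleftrightarrow> own e \<and> own f"
  by (auto simp: mod_expr_def eq_expr_def)

text \<open>Banks of the reduction: 0 input, 1 number of runs, 2 current run, 3 best value, 4 gadgets built,
  5 clause counter, 6 clause pointer, 7 entries pushed, 8 loop counter, 9 powers of \<open>C\<close>, 10 powers of 2,
  11 number of blocks, 12 hub size; the banks from 13 on host the given solver.\<close>

definition clause_len :: expr where "clause_len = Cell 0 (scalar 6)"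

text \<open>With truncated subtraction, j - (j - (len - 1)) is the minimum of j and len - 1, as in
  \<open>lit_at\<close>. The offset 1 skips the length entry of the clause.\<close>

definition lit_expr :: "nat \<Rightarrow> expr" where
  "lit_expr j = Cell 0 (Add (Add (scalar 6) (Num 1)) (Sub (Num j) (Sub (Num j) (Sub clause_len (Num 1)))))"

definition incr :: "nat \<Rightarrow> prog" where
  "incr a = Assign a (Num 0) (Add (scalar a) (Num 1))"

definition c_incr :: "nat \<Rightarrow> nat" where
  "c_incr a = acost (Num 0) (Add (scalar a) (Num 1))"

definition poke :: "expr \<Rightarrow> expr \<Rightarrow> prog" where
  "poke i e = Assign 13 (run_index i) e"

text \<open>Entries start at cell 3: cells 0, 1 and 2 are kept for the list length and the numbers
  of vertices and edges, which are known only at the end and are written by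
  \<open>header\<close>.\<close>

definition push :: "expr \<Rightarrow> prog" where
  "push e = Seq (poke (Add (Num 3) (scalar 7)) e) (incr 7)"

definition c_push :: "expr \<Rightarrow> nat" where
  "c_push e = acost (run_index (Add (Num 3) (scalar 7))) e + c_incr 7"

definition flat :: "(nat \<times> nat) list \<Rightarrow> nat list" where
  "flat es = concat (map (\<lambda>(u, v). [u, v]) es)"

lemma length_flat: "length (flat es) = 2 * length es"
  by (induction es) (auto simp: flat_def)

definition scal :: "nat \<Rightarrow> nat \<Rightarrow> nat \<Rightarrow> nat \<Rightarrow> nat \<Rightarrow> nat \<Rightarrow> nat \<Rightarrow> nat \<Rightarrow> nat" where
  "scal r best g ci cp len i a = (if a = 2 then r else if a = 3 then best else if a = 4 then g else
     if a = 5 then ci else if a = 6 then cp else if a = 7 then len else if a = 8 then i else 0)"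

lemma scal_simps [simp]:
  "scal r best g ci cp len i 2 = r" "scal r best g ci cp len i 3 = best" "scal r best g ci cp len i 4 = g"
  "scal r best g ci cp len i 5 = ci" "scal r best g ci cp len i 6 = cp" "scal r best g ci cp len i 7 = len"
  "scal r best g ci cp len i 8 = i"
  "(scal r best g ci cp len i)(3 := y) = scal r y g ci cp len i"
  "(scal r best g ci cp len i)(4 := y) = scal r best y ci cp len i"
  "(scal r best g ci cp len i)(5 := y) = scal r best g y cp len i"
  "(scal r best g ci cp len i)(6 := y) = scal r best g ci y len i"
  "(scal r best g ci cp len i)(7 := y) = scal r best g ci cp y i"
  "(scal r best g ci cp len i)(8 := y) = scal r best g ci cp len y"
  by (auto simp: scal_def fun_eq_iff)

definition arr :: "nat list \<Rightarrow> nat \<Rightarrow> nat" where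
  "arr zs i = (if 3 \<le> i \<and> i - 3 < length zs then zs ! (i - 3) else 0)"

lemma arr_Nil: "arr [] = (\<lambda>_. 0)" by (simp add: arr_def fun_eq_iff)

lemma arr_snoc: "(arr zs)(3 + length zs := y) = arr (zs @ [y])"
  by (auto simp: arr_def fun_eq_iff nth_append)

definition enc :: "nat list list \<Rightarrow> nat list" where
  "enc Cls = concat (map (\<lambda>Cl. length Cl # Cl) Cls)"

lemma enc_append: "enc (xs @ ys) = enc xs @ enc ys" by (simp add: enc_def)

context block_encoding
begin

definition blk_expr :: "nat \<Rightarrow> expr" where
  "blk_expr j = Quot (Quot (lit_expr j) (Num 2)) (Num k)"

definition bit_expr :: "nat \<Rightarrow> nat \<Rightarrow> expr" where
  "bit_expr j a = mod_expr (Quot (Add (Mul (Num q) (mod_expr (Quot (scalar 2) (Cell 9 (blk_expr j))) (Num C))) (Num a))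
     (Cell 10 (mod_expr (Quot (lit_expr j) (Num 2)) (Num k)))) (Num 2)"

definition true_expr :: "nat \<Rightarrow> nat \<Rightarrow> expr" where
  "true_expr \<tau> j = eq_expr (bit_expr j (digit \<tau> j)) (mod_expr (lit_expr j) (Num 2))"

text \<open>The factor \<open>clause_len\<close> vanishes for the empty clause, for which the
  literals read are meaningless.\<close>

definition sat_expr :: "nat \<Rightarrow> expr" where
  "sat_expr \<tau> = Mul clause_len (Add (Add (true_expr \<tau> 0) (true_expr \<tau> 1)) (true_expr \<tau> 2))"

definition sym_expr :: "nat \<Rightarrow> nat sym \<Rightarrow> expr" where
  "sym_expr \<tau> s = (case s of Ref a \<Rightarrow> Num a
     | Port j \<Rightarrow> if j < 3 then Add (Num q) (blk_expr j) else Num (digit \<tau> (j - 3))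
     | Inner l \<Rightarrow> Add (Add (scalar 12) (Mul (scalar 4) (Num \<sigma>))) (Num l))"

text \<open>\<open>T\<close> is fixed in advance, so the gadget is unrolled into the program text;
  \<open>do_clause\<close> does the same with the q ^ 3 triples.\<close>

definition emit_exprs :: "nat \<Rightarrow> expr list" where
  "emit_exprs \<tau> = concat (map (\<lambda>(s, l). [sym_expr \<tau> s, sym_expr \<tau> (Inner l)]) T)"

definition emit :: "nat \<Rightarrow> prog" where
  "emit \<tau> = Seq (seqs (map push (emit_exprs \<tau>))) (incr 4)"

text \<open>\<open>trip_seqs\<close> wants one bound for all steps; the sum of all single costs is
  crude but independent of the input.\<close>

definition c_emit :: "nat \<Rightarrow> nat" where
  "c_emit \<tau> = length (emit_exprs \<tau>) * sum_list (map c_push (emit_exprs \<tau>)) + 1 + c_incr 4"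

definition try_tuple :: "nat \<Rightarrow> prog" where
  "try_tuple \<tau> = Cond (sat_expr \<tau>) (emit \<tau>) Skip"

definition c_try :: "nat \<Rightarrow> nat" where
  "c_try \<tau> = 1 + ecost (sat_expr \<tau>) + c_emit \<tau> + 1"

definition next_clause :: expr where "next_clause = Add (Add (scalar 6) clause_len) (Num 1)"

definition do_clause :: prog where
  "do_clause = Seq (seqs (map try_tuple [0..<q ^ 3])) (Seq (Assign 6 (Num 0) next_clause) (incr 5))"

definition c_clause :: nat where
  "c_clause = q ^ 3 * sum_list (map c_try [0..<q ^ 3]) + 1 + (acost (Num 0) next_clause + c_incr 5)"

lemma own_exprs [simp]: "own clause_len" "own (lit_expr j)" "own (blk_expr j)" "own (bit_expr j a)" "own (true_expr \<tau> j)"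
  "own (sat_expr \<tau>)" "own (sym_expr \<tau> s)" "own next_clause"
  by (simp_all add: clause_len_def lit_expr_def blk_expr_def bit_expr_def true_expr_def sat_expr_def sym_expr_def
      next_clause_def split: sym.splits)

end

text \<open>\<open>V\<close> bounds everything the reduction itself stores or reads, so each of its
  steps costs O(\<open>bits V\<close>). \<open>26 * GM\<close> covers twice the size of an optimal
  deletion set, at most 13 per gadget, and \<open>2 * length T * GM + p + 3\<close> the number of
  entries of an instance.\<close>

locale reduction = block_encoding +
  fixes n :: nat and Cls :: "nat list list" and V B N p GM :: nat and xs :: "nat list"
  assumes good: "\<forall>Cl\<in>set Cls. good_clause n Cl"
    and B_def: "B = n div k + 1" and N_def: "N = C ^ B" and p_def: "p = q + B" and GM_def: "GM = length Cls * q ^ 3"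
    and xs_def: "xs = n # length Cls # enc Cls"
    and V_bounds: "2 \<le> V" "length xs \<le> V" "\<And>x. x \<in> set xs \<Longrightarrow> x \<le> V" "N \<le> V" "2 ^ k \<le> V" "p \<le> V"
      "26 * GM \<le> V" "2 * length T * GM + p + 3 \<le> V" "length xs + 2 \<le> V"
begin

section \<open>Invariants of the reduction program\<close>

definition trip :: "(store \<Rightarrow> bool) \<Rightarrow> prog \<Rightarrow> (store \<Rightarrow> bool) \<Rightarrow> nat \<Rightarrow> bool" where
  "trip A P D t = triple A P D (t * bits V)"

lemma trip_conseq:
  "trip A P D t \<Longrightarrow> (\<And>s. A' s \<Longrightarrow> A s) \<Longrightarrow> (\<And>s. D s \<Longrightarrow> D' s) \<Longrightarrow> t \<le> t' \<Longrightarrow> trip A' P D' t'"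
  unfolding trip_def by (erule triple_conseq) auto

lemma trip_Seq: "trip A P D t \<Longrightarrow> trip D P' E t' \<Longrightarrow> trip A (Seq P P') E (t + t')"
  unfolding trip_def by (simp add: distrib_right triple_Seq)

lemma trip_Skip: "(\<And>s. A s \<Longrightarrow> D s) \<Longrightarrow> trip A Skip D 1"
  unfolding trip_def using bits_pos[of V] by (intro triple_conseq[OF triple_Skip[of A D]]) auto

lemma trip_seqs:
  assumes "\<And>i. i < length Ps \<Longrightarrow> trip (I i) (Ps ! i) (I (Suc i)) t"
  shows "trip (I 0) (seqs Ps) (I (length Ps)) (length Ps * t + 1)"
  unfolding trip_def
  by (rule triple_conseq[OF triple_seqs[of Ps I "t * bits V"]])
    (use assms bits_pos[of V] in \<open>auto simp: trip_def algebra_simps\<close>)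

text \<open>The residue classes of addresses from \<open>r\<close> on are still zero: the memory of
  the runs to come.\<close>

definition fresh :: "nat \<Rightarrow> store \<Rightarrow> bool" where
  "fresh r s \<longleftrightarrow> (\<forall>a i r'. 13 \<le> a \<longrightarrow> r \<le> r' \<longrightarrow> r' < N \<longrightarrow> s a (i * N + r') = 0)"

definition static :: "store \<Rightarrow> bool" where
  "static s \<longleftrightarrow> s 0 = input_store xs 0 \<and> s 1 0 = N \<and> (\<forall>i\<le>B. s 9 i = C ^ i) \<and> (\<forall>j<k. s 10 j = 2 ^ j)
     \<and> s 11 0 = B \<and> s 12 0 = p \<and> (\<forall>a i. a < 13 \<longrightarrow> s a i \<le> V)"

text \<open>\<open>f\<close> is the content of bank 0 as the hosted program of the current run will
  see it.\<close>

definition St :: "(nat \<Rightarrow> nat) \<Rightarrow> (nat \<Rightarrow> nat) \<Rightarrow> store \<Rightarrow> bool" where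
  "St sc f s \<longleftrightarrow> static s \<and> (\<forall>a\<in>{2..8}. s a 0 = sc a) \<and> sc 2 < N \<and> (\<forall>i. s 13 (i * N + sc 2) = f i)
     \<and> (\<forall>a i. 13 < a \<longrightarrow> s a (i * N + sc 2) = 0) \<and> fresh (Suc (sc 2)) s"

lemma St_reads: "St sc f s \<Longrightarrow> own e \<Longrightarrow> reads_le V s e"
  by (rule own_reads_le) (auto simp: St_def static_def)

lemma St_scal:
  assumes "St (scal r best g ci cp len i) f s"
  shows "s 2 0 = r" "s 3 0 = best" "s 4 0 = g" "s 5 0 = ci" "s 6 0 = cp" "s 7 0 = len" "s 8 0 = i" "s 12 0 = p" "s (Suc 0) 0 = N"
    "s 0 = input_store xs 0" "r < N"
  using assms by (auto simp: St_def static_def)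

text \<open>Scalar 2 is excluded because it selects the run whose memory \<open>f\<close>
  describes.\<close>

lemma trip_set_scalar:
  assumes "a \<in> {3..8}" "own e" "y \<le> V" "\<And>s. St sc f s \<Longrightarrow> eval s e = y"
  shows "trip (St sc f) (Assign a (Num 0) e) (St (sc(a := y)) f) (acost (Num 0) e)"
  unfolding trip_def
proof (rule triple_Assign)
  fix s assume S: "St sc f s"
  show "reads_le V s (Num 0) \<and> reads_le V s e" using St_reads[OF S assms(2)] by simp
  show "St (sc(a := y)) f (s(a := (s a)(eval s (Num 0) := eval s e)))"
    using S assms(1,3) by (auto simp: St_def static_def fresh_def assms(4)[OF S])
qed (use V_bounds in auto)

lemma trip_poke:
  assumes "own i" "own e" "\<And>s. St sc f s \<Longrightarrow> eval s i = x \<and> eval s e = y"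
  shows "trip (St sc f) (poke i e) (St sc (f(x := y))) (acost (run_index i) e)"
  unfolding trip_def poke_def
proof (rule triple_Assign)
  fix s assume S: "St sc f s"
  show "reads_le V s (run_index i) \<and> reads_le V s e" using St_reads[OF S] assms(1,2) by simp
  have ev: "eval s (run_index i) = x * N + sc 2" "eval s e = y"
    using S assms(3)[OF S] by (auto simp: run_index_def St_def static_def)
  have r: "sc 2 < N" using S by (simp add: St_def)
  show "St sc (f(x := y)) (s(13 := (s 13)(eval s (run_index i) := eval s e)))"
    unfolding St_def
  proof (intro conjI allI impI ballI)
    show "static (s(13 := (s 13)(eval s (run_index i) := eval s e)))" using S by (auto simp: St_def static_def)
    show "(s(13 := (s 13)(eval s (run_index i) := eval s e))) a 0 = sc a" if "a \<in> {2..8}" for a :: nat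
      using S that by (auto simp: St_def)
    show "(s(13 := (s 13)(eval s (run_index i) := eval s e))) 13 (j * N + sc 2) = (f(x := y)) j" for j
      using S run_index_unique[OF r r, of j x] by (auto simp: St_def ev)
    show "(s(13 := (s 13)(eval s (run_index i) := eval s e))) a (j * N + sc 2) = 0" if "(13::nat) < a" for a j
      using S that by (auto simp: St_def)
    show "fresh (Suc (sc 2)) (s(13 := (s 13)(eval s (run_index i) := eval s e)))"
      unfolding fresh_def
    proof (intro allI impI)
      fix a j r' :: nat assume a: "13 \<le> a" "Suc (sc 2) \<le> r'" "r' < N"
      then have "j * N + r' \<noteq> x * N + sc 2" using run_index_unique[OF a(3) r, of j x] by simp
      then show "(s(13 := (s 13)(eval s (run_index i) := eval s e))) a (j * N + r') = 0"
        using S a by (auto simp: St_def fresh_def ev)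
    qed
  qed (rule r)
qed (use V_bounds in auto)

lemma trip_push:
  assumes "own e" "len < V" "\<And>s. St (scal r best g ci cp len i) f s \<Longrightarrow> eval s e = y"
  shows "trip (St (scal r best g ci cp len i) f) (push e) (St (scal r best g ci cp (Suc len) i) (f(3 + len := y))) (c_push e)"
  unfolding push_def c_push_def
proof (rule trip_Seq)
  show "trip (St (scal r best g ci cp len i) f) (poke (Add (Num 3) (scalar 7)) e)
     (St (scal r best g ci cp len i) (f(3 + len := y))) (acost (run_index (Add (Num 3) (scalar 7))) e)"
    by (rule trip_poke) (use assms in \<open>auto simp: St_scal\<close>)
  show "trip (St (scal r best g ci cp len i) (f(3 + len := y))) (incr 7) (St (scal r best g ci cp (Suc len) i) (f(3 + len := y))) (c_incr 7)"
    unfolding incr_def c_incr_def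
    using trip_set_scalar[of 7 "Add (scalar 7) (Num 1)" "Suc len" "scal r best g ci cp len i" "f(3 + len := y)"] assms(2)
    by (simp add: St_scal)
qed

definition Push :: "nat \<Rightarrow> nat \<Rightarrow> nat \<Rightarrow> nat \<Rightarrow> nat \<Rightarrow> nat \<Rightarrow> nat list \<Rightarrow> store \<Rightarrow> bool" where
  "Push r best g ci cp i zs = St (scal r best g ci cp (length zs) i) (arr zs)"

lemma trip_push_arr:
  assumes "own e" "length zs < V" "\<And>s. Push r best g ci cp i zs s \<Longrightarrow> eval s e = y"
  shows "trip (Push r best g ci cp i zs) (push e) (Push r best g ci cp i (zs @ [y])) (c_push e)"
  using trip_push[of e "length zs" r best g ci cp i "arr zs" y] assms by (simp add: Push_def arr_snoc)

lemma Push_scal: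
  assumes "Push r best g ci cp i zs s"
  shows "s 2 0 = r" "s 3 0 = best" "s 4 0 = g" "s 5 0 = ci" "s 6 0 = cp" "s 7 0 = length zs" "s 8 0 = i" "s 12 0 = p" "s (Suc 0) 0 = N"
    "s 0 = input_store xs 0" "r < N"
  using St_scal[OF assms[unfolded Push_def]] by simp_all

lemma Push_tables:
  assumes "Push r best g ci cp i zs s"
  shows "j \<le> B \<Longrightarrow> s 9 j = C ^ j" "j < k \<Longrightarrow> s 10 j = 2 ^ j"
  using assms by (auto simp: Push_def St_def static_def)

lemma trip_push_list:
  assumes "\<And>e. e \<in> set es \<Longrightarrow> own e" "length zs + length es \<le> V"
    "\<And>s zs j. Push r best g ci cp i zs s \<Longrightarrow> j < length es \<Longrightarrow> eval s (es ! j) = ys ! j" "length ys = length es"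
  shows "trip (Push r best g ci cp i zs) (seqs (map push es)) (Push r best g ci cp i (zs @ ys)) (length es * sum_list (map c_push es) + 1)"
proof -
  let ?I = "\<lambda>j. Push r best g ci cp i (zs @ take j ys)"
  have "trip (?I 0) (seqs (map push es)) (?I (length (map push es))) (length (map push es) * sum_list (map c_push es) + 1)"
  proof (rule trip_seqs)
    fix j assume "j < length (map push es)"
    then have j: "j < length es" by simp
    have t: "trip (?I j) (push (es ! j)) (Push r best g ci cp i ((zs @ take j ys) @ [ys ! j])) (c_push (es ! j))"
      by (rule trip_push_arr) (use assms j in auto)
    have le: "c_push (es ! j) \<le> sum_list (map c_push es)"
      using j by (intro member_le_sum_list) auto
    have "trip (?I j) (push (es ! j)) (Push r best g ci cp i ((zs @ take j ys) @ [ys ! j])) (sum_list (map c_push es))"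
      by (rule trip_conseq[OF t]) (use le in auto)
    then show "trip (?I j) (map push es ! j) (?I (Suc j)) (sum_list (map c_push es))"
      using j assms(4) by (simp add: take_Suc_conv_app_nth)
  qed
  then show ?thesis using assms(4) by simp
qed

text \<open>The clauses start in cell 3, behind the list length, \<open>n\<close> and the number of
  clauses.\<close>

definition cpos :: "nat \<Rightarrow> nat" where "cpos ci = 3 + length (enc (take ci Cls))"

lemma input_0 [simp]: "input_store xs 0 (Suc 0) = n" "input_store xs 0 2 = length Cls"
  by (auto simp: input_store_def xs_def numeral_eq_Suc)

lemma input_enc: "l < length (enc Cls) \<Longrightarrow> input_store xs 0 (3 + l) = enc Cls ! l"
  by (auto simp: input_store_def xs_def numeral_eq_Suc)

lemma enc_split:
  assumes "ci < length Cls"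
  shows "enc Cls = enc (take ci Cls) @ (length (Cls ! ci) # Cls ! ci) @ enc (drop (Suc ci) Cls)"
proof -
  have "Cls = take ci Cls @ [Cls ! ci] @ drop (Suc ci) Cls" using assms by (simp add: id_take_nth_drop)
  then have "enc Cls = enc (take ci Cls @ [Cls ! ci] @ drop (Suc ci) Cls)" by simp
  also have "\<dots> = enc (take ci Cls) @ enc [Cls ! ci] @ enc (drop (Suc ci) Cls)" by (simp only: enc_append)
  finally show ?thesis by (simp add: enc_def)
qed

lemma clause_cells:
  assumes "ci < length Cls"
  shows "input_store xs 0 (cpos ci) = length (Cls ! ci)"
    "j < length (Cls ! ci) \<Longrightarrow> input_store xs 0 (cpos ci + 1 + j) = Cls ! ci ! j"
proof -
  note e = enc_split[OF assms]
  have len: "length (enc Cls) = length (enc (take ci Cls)) + 1 + length (Cls ! ci) + length (enc (drop (Suc ci) Cls))"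
    by (subst e) simp
  have "enc Cls ! length (enc (take ci Cls)) = length (Cls ! ci)" by (subst e) simp
  then show "input_store xs 0 (cpos ci) = length (Cls ! ci)"
    using input_enc[of "length (enc (take ci Cls))"] len by (simp add: cpos_def)
  assume j: "j < length (Cls ! ci)"
  have "enc Cls ! (length (enc (take ci Cls)) + Suc j) = Cls ! ci ! j"
    by (subst e) (use j in \<open>simp add: nth_append\<close>)
  then show "input_store xs 0 (cpos ci + 1 + j) = Cls ! ci ! j"
    using input_enc[of "length (enc (take ci Cls)) + Suc j"] len j by (simp add: cpos_def add.assoc)
qed

end

section \<open>Building the instance for one guess\<close>

context block_encoding
begin

definition more_clauses :: expr where "more_clauses = Sub (Cell 0 (Num 2)) (scalar 5)"

definition more_hub :: expr where "more_hub = Sub (scalar 12) (scalar 8)"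

definition reset :: prog where
  "reset = Seq (Assign 4 (Num 0) (Num 0)) (Seq (Assign 5 (Num 0) (Num 0)) (Seq (Assign 6 (Num 0) (Num 3)) (Seq (Assign 7 (Num 0) (Num 0)) (Assign 8 (Num 0) (Num 0)))))"

definition c_reset :: nat where
  "c_reset = acost (Num 0) (Num 0) + (acost (Num 0) (Num 0) + (acost (Num 0) (Num 3) + (acost (Num 0) (Num 0) + acost (Num 0) (Num 0))))"

definition list_hub :: prog where
  "list_hub = Seq (push (scalar 12)) (Seq (Assign 8 (Num 0) (Num 0)) (While more_hub (Seq (push (scalar 8)) (incr 8))))"

definition count_vertices :: expr where "count_vertices = Add (scalar 12) (Mul (scalar 4) (Num \<sigma>))"

definition count_edges :: expr where "count_edges = Mul (Num (length T)) (scalar 4)"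

definition header :: prog where
  "header = Seq (poke (Num 1) count_vertices) (Seq (poke (Num 2) count_edges) (poke (Num 0) (Add (Num 2) (scalar 7))))"

definition c_header :: nat where
  "c_header = acost (run_index (Num 1)) count_vertices + (acost (run_index (Num 2)) count_edges
     + acost (run_index (Num 0)) (Add (Num 2) (scalar 7)))"

definition build :: prog where
  "build = Seq reset (Seq (While more_clauses do_clause) (Seq list_hub header))"

definition c_hub :: "nat \<Rightarrow> nat" where
  "c_hub p = c_push (scalar 12) + (acost (Num 0) (Num 0) + (p * (c_push (scalar 8) + c_incr 8 + (1 + ecost more_hub)) + (1 + ecost more_hub)))"

definition c_build :: "nat \<Rightarrow> nat \<Rightarrow> nat" where
  "c_build m p = c_reset + ((m * (c_clause + (1 + ecost more_clauses)) + (1 + ecost more_clauses)) + (c_hub p + c_header))"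

lemma length_all_ports_le: "length (all_ports r Cls) \<le> length Cls * q ^ 3"
proof (induction Cls)
  case (Cons Cl Cls)
  have "length (clause_ports r Cl) \<le> q ^ 3"
    unfolding clause_ports_def using length_filter_le[of _ "[0..<q^3]"] by simp
  then show ?case using Cons by (simp add: all_ports_def add_mono)
qed (simp add: all_ports_def)

lemma length_graph_edges: "length (graph_edges p g ts) = length T * length ts"
  by (induction ts arbitrary: g) (auto simp: gadget_edges_def)

end

lemma flat_append: "flat (xs @ ys) = flat xs @ flat ys" by (simp add: flat_def)

context reduction
begin

lemma trip_Cond:
  assumes "\<And>s. A s \<Longrightarrow> reads_le V s b" "trip (\<lambda>s. A s \<and> eval s b \<noteq> 0) P D t" "trip (\<lambda>s. A s \<and> eval s b = 0) P' D t'"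
  shows "trip A (Cond b P P') D (1 + ecost b + t + t')"
proof -
  have "triple A (Cond b P P') D ((1 + ecost b) * bits V + t * bits V + t' * bits V)"
    by (rule triple_Cond[OF V_bounds(1)]) (use assms in \<open>auto simp: trip_def\<close>)
  then show ?thesis unfolding trip_def by (simp only: distrib_right)
qed

lemma trip_While:
  assumes "\<And>i s. i \<le> m \<Longrightarrow> I i s \<Longrightarrow> reads_le V s b \<and> (eval s b \<noteq> 0 \<longleftrightarrow> i < m)"
    "\<And>i. i < m \<Longrightarrow> trip (I i) P (I (Suc i)) t"
  shows "trip (I 0) (While b P) (I m) (m * (t + (1 + ecost b)) + (1 + ecost b))"
proof -
  have "triple (I 0) (While b P) (I m) (m * (t * bits V + (1 + ecost b) * bits V) + (1 + ecost b) * bits V)"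
    by (rule triple_While[OF V_bounds(1)]) (use assms in \<open>auto simp: trip_def\<close>)
  then show ?thesis unfolding trip_def by (simp only: distrib_right mult.assoc)
qed

lemma trip_False: "(\<And>s. \<not> A s) \<Longrightarrow> trip A P D t"
  by (simp add: trip_def triple_def)

lemma Push_reads: "Push r best g ci cp i zs s \<Longrightarrow> own e \<Longrightarrow> reads_le V s e"
  unfolding Push_def by (rule St_reads)

definition Bld :: "nat \<Rightarrow> nat \<Rightarrow> nat \<Rightarrow> nat \<Rightarrow> nat \<Rightarrow> (nat \<Rightarrow> nat) list \<Rightarrow> store \<Rightarrow> bool" where
  "Bld r best ci cp i ts = Push r best (length ts) ci cp i (flat (graph_edges p 0 ts))"

context
  fixes ci :: nat and Cl :: "nat list"
  assumes ci: "ci < length Cls" and Cl: "Cl = Cls ! ci"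
begin

lemma good_Cl: "length Cl \<le> 3" "c \<in> set Cl \<Longrightarrow> c div 2 < n"
  using good ci Cl by (auto simp: good_clause_def)

lemma clause_len_eval: "Push r best g ci (cpos ci) i zs s \<Longrightarrow> eval s clause_len = length Cl"
  using clause_cells(1)[OF ci] by (simp add: clause_len_def Push_scal Cl)

lemma lit_eval:
  assumes "Push r best g ci (cpos ci) i zs s" "Cl \<noteq> []"
  shows "eval s (lit_expr j) = lit_at Cl j"
proof -
  have "j - (j - (length Cl - 1)) = min j (length Cl - 1)" by auto
  then have "eval s (lit_expr j) = input_store xs 0 (cpos ci + 1 + min j (length Cl - 1))"
    using clause_len_eval[OF assms(1)] by (simp add: lit_expr_def Push_scal[OF assms(1)])
  moreover have "min j (length Cl - 1) < length Cl" using assms(2) by (cases Cl) auto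
  ultimately show ?thesis using clause_cells(2)[OF ci] by (simp add: lit_at_def Cl)
qed

lemma blk_eval:
  assumes "Push r best g ci (cpos ci) i zs s" "Cl \<noteq> []"
  shows "eval s (blk_expr j) = lit_at Cl j div 2 div k"
  using lit_eval[OF assms] by (simp add: blk_expr_def)

lemma bit_eval:
  assumes "Push r best g ci (cpos ci) i zs s" "Cl \<noteq> []"
  shows "eval s (bit_expr j a) = block_bit r a (lit_at Cl j div 2)"
proof -
  have "lit_at Cl j div 2 < n" using good_Cl(2) lit_at_mem[OF assms(2)] by blast
  then have "lit_at Cl j div 2 div k \<le> B" using div_le_mono[of "lit_at Cl j div 2" n k] by (simp add: B_def)
  moreover have "lit_at Cl j div 2 mod k < k" using k0 by simp
  ultimately show ?thesis
    using Push_tables[OF assms(1)] lit_eval[OF assms] blk_eval[OF assms]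
    by (simp add: bit_expr_def block_bit_def Push_scal[OF assms(1)])
qed

lemma sat_eval:
  assumes "Push r best g ci (cpos ci) i zs s"
  shows "eval s (sat_expr \<tau>) \<noteq> 0 \<longleftrightarrow> sat_tuple r Cl \<tau>"
proof (cases "Cl = []")
  case True then show ?thesis using clause_len_eval[OF assms] by (simp add: sat_expr_def sat_tuple_def)
next
  case False
  have "eval s (true_expr \<tau> j) = of_bool (block_bit r (digit \<tau> j) (lit_at Cl j div 2) = lit_at Cl j mod 2)" for j
    using bit_eval[OF assms False] lit_eval[OF assms False] by (simp add: true_expr_def)
  moreover have "(\<exists>j<3. Q j) \<longleftrightarrow> Q 0 \<or> Q 1 \<or> Q (2::nat)" for Q
    by (auto simp: numeral_eq_Suc less_Suc_eq)
  ultimately show ?thesis using clause_len_eval[OF assms] False by (simp add: sat_expr_def sat_tuple_def)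
qed

lemma sym_eval:
  assumes "Push r best g ci (cpos ci) i zs s" "Cl \<noteq> []"
  shows "eval s (sym_expr \<tau> sy) = place p (port_map Cl \<tau>) g sy"
  using blk_eval[OF assms] by (cases sy) (auto simp: sym_expr_def port_map_def Push_scal[OF assms(1)])

lemma trip_emit:
  assumes "length ts < GM" "Cl \<noteq> []"
  shows "trip (Bld r best ci (cpos ci) i ts) (emit \<tau>) (Bld r best ci (cpos ci) i (ts @ [port_map Cl \<tau>])) (c_emit \<tau>)"
  unfolding emit_def c_emit_def
proof (rule trip_Seq)
  let ?t = "port_map Cl \<tau>" and ?g = "length ts"
  let ?zs = "flat (graph_edges p 0 ts)" and ?ys = "flat (gadget_edges p (port_map Cl \<tau>) (length ts))"
  have ev: "map (eval s) (emit_exprs \<tau>) = ?ys" if "Push r best ?g ci (cpos ci) i zs s" for s zs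
    using sym_eval[OF that assms(2), of \<tau>]
    by (simp add: emit_exprs_def flat_def gadget_edges_def map_concat comp_def case_prod_unfold del: place_simps)
  have len: "length (emit_exprs \<tau>) = 2 * length T"
    unfolding emit_exprs_def by (induction T) auto
  have leny: "length ?ys = length (emit_exprs \<tau>)" by (simp add: length_flat len gadget_edges_def)
  have "2 * length T * Suc (length ts) \<le> 2 * length T * GM" using assms(1) by (intro mult_le_mono2) simp
  then have "length ?zs + length (emit_exprs \<tau>) \<le> 2 * length T * GM"
    by (simp add: length_flat len length_graph_edges)
  then have bound: "length ?zs + length (emit_exprs \<tau>) \<le> V" using V_bounds(8) by linarith
  show "trip (Bld r best ci (cpos ci) i ts) (seqs (map push (emit_exprs \<tau>))) (Push r best ?g ci (cpos ci) i (?zs @ ?ys))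
    (length (emit_exprs \<tau>) * sum_list (map c_push (emit_exprs \<tau>)) + 1)"
    unfolding Bld_def
  proof (rule trip_push_list)
    show "own e" if "e \<in> set (emit_exprs \<tau>)" for e using that by (auto simp: emit_exprs_def)
    show "length ?zs + length (emit_exprs \<tau>) \<le> V" by (rule bound)
    show "eval s (emit_exprs \<tau> ! j) = ?ys ! j" if "Push r best ?g ci (cpos ci) i zs s" "j < length (emit_exprs \<tau>)" for s zs j
      using ev[OF that(1)] that(2) by (metis nth_map)
  qed (rule leny)
  have e: "flat (graph_edges p 0 (ts @ [?t])) = ?zs @ ?ys" by (simp add: graph_edges_append flat_append)
  have "Suc ?g \<le> V" using assms(1) V_bounds(7) by linarith
  then show "trip (Push r best ?g ci (cpos ci) i (?zs @ ?ys)) (incr 4) (Bld r best ci (cpos ci) i (ts @ [?t])) (c_incr 4)"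
    unfolding Bld_def Push_def e incr_def c_incr_def
    using trip_set_scalar[of 4 "Add (scalar 4) (Num 1)" "Suc ?g"
        "scal r best ?g ci (cpos ci) (length (?zs @ ?ys)) i" "arr (?zs @ ?ys)"]
    by (simp add: St_scal)
qed

lemma trip_try:
  assumes "length ts < GM"
  shows "trip (Bld r best ci (cpos ci) i ts) (try_tuple \<tau>)
    (Bld r best ci (cpos ci) i (ts @ (if sat_tuple r Cl \<tau> then [port_map Cl \<tau>] else []))) (c_try \<tau>)"
  unfolding try_tuple_def c_try_def
proof (rule trip_Cond)
  show "reads_le V s (sat_expr \<tau>)" if "Bld r best ci (cpos ci) i ts s" for s
    using Push_reads that unfolding Bld_def by simp
  have ev: "eval s (sat_expr \<tau>) \<noteq> 0 \<longleftrightarrow> sat_tuple r Cl \<tau>" if "Bld r best ci (cpos ci) i ts s" for s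
    using sat_eval that unfolding Bld_def by blast
  let ?D = "Bld r best ci (cpos ci) i (ts @ (if sat_tuple r Cl \<tau> then [port_map Cl \<tau>] else []))"
  show "trip (\<lambda>s. Bld r best ci (cpos ci) i ts s \<and> eval s (sat_expr \<tau>) \<noteq> 0) (emit \<tau>) ?D (c_emit \<tau>)"
  proof (cases "sat_tuple r Cl \<tau>")
    case True
    then have "Cl \<noteq> []" by (simp add: sat_tuple_def)
    from trip_emit[OF assms this] show ?thesis by (rule trip_conseq) (use True in auto)
  next
    case False then show ?thesis by (intro trip_False) (use ev in blast)
  qed
  show "trip (\<lambda>s. Bld r best ci (cpos ci) i ts s \<and> eval s (sat_expr \<tau>) = 0) Skip ?D 1"
  proof (rule trip_Skip)
    fix s assume a: "Bld r best ci (cpos ci) i ts s \<and> eval s (sat_expr \<tau>) = 0"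
    then have "\<not> sat_tuple r Cl \<tau>" using ev by blast
    then show "?D s" using a by simp
  qed
qed

lemma trip_clause:
  assumes ts: "ts = all_ports r (take ci Cls)"
  shows "trip (Bld r best ci (cpos ci) i ts) do_clause
    (Bld r best (Suc ci) (cpos (Suc ci)) i (all_ports r (take (Suc ci) Cls))) c_clause"
  unfolding do_clause_def c_clause_def
proof (rule trip_Seq[OF _ trip_Seq])
  let ?I = "\<lambda>j. Bld r best ci (cpos ci) i (ts @ map (port_map Cl) (filter (sat_tuple r Cl) [0..<j]))"
  have ts_len: "length ts \<le> ci * q ^ 3" using length_all_ports_le[of r "take ci Cls"] ci by (simp add: ts)
  have "trip (?I 0) (seqs (map try_tuple [0..<q^3])) (?I (length (map try_tuple [0..<q^3])))
    (length (map try_tuple [0..<q^3]) * sum_list (map c_try [0..<q^3]) + 1)"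
  proof (rule trip_seqs)
    fix j assume "j < length (map try_tuple [0..<q^3])"
    then have j: "j < q ^ 3" by simp
    let ?ts = "ts @ map (port_map Cl) (filter (sat_tuple r Cl) [0..<j])"
    have "length (filter (sat_tuple r Cl) [0..<j]) \<le> j" using length_filter_le[of _ "[0..<j]"] by simp
    then have "length ?ts < ci * q ^ 3 + q ^ 3" using ts_len j by simp
    also have "\<dots> = Suc ci * q ^ 3" by simp
    also have "\<dots> \<le> GM" unfolding GM_def using ci by (intro mult_le_mono1) simp
    finally have lt: "length ?ts < GM" .
    have le: "c_try j \<le> sum_list (map c_try [0..<q^3])" using j by (intro member_le_sum_list) auto
    show "trip (?I j) (map try_tuple [0..<q^3] ! j) (?I (Suc j)) (sum_list (map c_try [0..<q^3]))"
    proof -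
      have "trip (?I j) (try_tuple j) (?I (Suc j)) (c_try j)"
        using trip_try[OF lt, of r best i j] by (cases "sat_tuple r Cl j") simp_all
      from trip_conseq[OF this _ _ le] j show ?thesis by simp
    qed
  qed
  then show "trip (Bld r best ci (cpos ci) i ts) (seqs (map try_tuple [0..<q^3])) (?I (q^3))
    (q ^ 3 * sum_list (map c_try [0..<q ^ 3]) + 1)" by simp
  let ?ts = "ts @ map (port_map Cl) (filter (sat_tuple r Cl) [0..<q^3])"
  have take: "take (Suc ci) Cls = take ci Cls @ [Cl]" using ci Cl by (simp add: take_Suc_conv_app_nth)
  have e: "?ts = all_ports r (take (Suc ci) Cls)" unfolding take by (simp add: ts all_ports_def clause_ports_def)
  have cp: "cpos (Suc ci) = cpos ci + length Cl + 1" unfolding cpos_def take by (simp add: enc_append) (simp add: enc_def)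
  have "length (enc (take (Suc ci) Cls)) \<le> length (enc Cls)"
    by (metis append_take_drop_id enc_append le_add1 length_append)
  then have cpV: "cpos (Suc ci) \<le> V" using V_bounds(9) by (simp add: cpos_def xs_def)
  let ?P = "\<lambda>ci cp. Bld r best ci cp i ?ts"
  have "trip (St (scal r best (length ?ts) ci (cpos ci) l i) f) (Assign 6 (Num 0) next_clause)
      (St ((scal r best (length ?ts) ci (cpos ci) l i)(6 := cpos (Suc ci))) f) (acost (Num 0) next_clause)"
    if "l = length zs" "f = arr zs" for l f zs
  proof (rule trip_set_scalar)
    fix s assume "St (scal r best (length ?ts) ci (cpos ci) l i) f s"
    then have "Push r best (length ?ts) ci (cpos ci) i zs s" using that by (simp add: Push_def)
    from clause_len_eval[OF this] Push_scal(5)[OF this] show "eval s next_clause = cpos (Suc ci)"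
      by (simp add: next_clause_def cp)
  qed (use cpV in auto)
  from this[OF refl refl] show "trip (?I (q^3)) (Assign 6 (Num 0) next_clause) (?P ci (cpos (Suc ci))) (acost (Num 0) next_clause)"
    unfolding Bld_def Push_def by simp
  have "length Cls \<in> set xs" by (simp add: xs_def)
  then have ciV: "Suc ci \<le> V" using V_bounds(3)[of "length Cls"] ci by simp
  have "trip (St (scal r best (length ?ts) ci (cpos (Suc ci)) l i) f) (incr 5)
      (St ((scal r best (length ?ts) ci (cpos (Suc ci)) l i)(5 := Suc ci)) f) (c_incr 5)" for l f
    unfolding incr_def c_incr_def by (rule trip_set_scalar) (use ciV in \<open>auto simp: St_scal\<close>)
  then show "trip (?P ci (cpos (Suc ci))) (incr 5) (Bld r best (Suc ci) (cpos (Suc ci)) i (all_ports r (take (Suc ci) Cls))) (c_incr 5)"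
    unfolding Bld_def Push_def e[symmetric] by simp
qed

end

end

section \<open>The loop over all guesses\<close>

context block_encoding
begin

text \<open>With truncated subtraction, best + (v - best) is the maximum of best and v.
  \<open>Cell 13 (scalar 2)\<close> is cell 0 of the hosted bank 0, as 0 * N + r = r; it holds the
  length of the output, twice the number of deleted edges.\<close>

definition update_expr :: expr where
  "update_expr = Add (scalar 3) (Sub (Sub (Mul (Num 13) (scalar 4)) (Quot (Cell 13 (scalar 2)) (Num 2))) (scalar 3))"

definition body :: "prog \<Rightarrow> prog" where
  "body P = Seq build (Seq (shift_prog 13 P) (Seq (Assign 3 (Num 0) update_expr) (incr 2)))"

definition more_runs :: expr where "more_runs = Sub (scalar 1) (scalar 2)"

definition power_table :: prog where
  "power_table = seqs (map (\<lambda>j. Assign 10 (Num j) (Num (2 ^ j))) [0..<k])"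

definition c_power_table :: nat where
  "c_power_table = k * sum_list (map (\<lambda>j. acost (Num j) (Num (2 ^ j))) [0..<k]) + 1"

definition blocks_expr :: expr where "blocks_expr = Add (Quot (Cell 0 (Num 1)) (Num k)) (Num 1)"

definition more_blocks :: expr where "more_blocks = Sub (scalar 11) (scalar 8)"

definition next_power :: expr where "next_power = Mul (Cell 9 (scalar 8)) (Num C)"

definition init :: prog where
  "init = Seq power_table (Seq (Assign 11 (Num 0) blocks_expr) (Seq (Assign 9 (Num 0) (Num 1))
     (Seq (While more_blocks (Seq (Assign 9 (Add (scalar 8) (Num 1)) next_power) (incr 8)))
     (Seq (Assign 1 (Num 0) (Cell 9 (scalar 11))) (Assign 12 (Num 0) (Add (Num q) (scalar 11)))))))"

definition c_init :: "nat \<Rightarrow> nat" where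
  "c_init B = c_power_table + (acost (Num 0) blocks_expr + (acost (Num 0) (Num 1)
     + ((B * ((acost (Add (scalar 8) (Num 1)) next_power + c_incr 8) + (1 + ecost more_blocks)) + (1 + ecost more_blocks))
     + (acost (Num 0) (Cell 9 (scalar 11)) + acost (Num 0) (Add (Num q) (scalar 11))))))"

definition output_expr :: expr where "output_expr = Sub (Cell 0 (Num 2)) (scalar 3)"

definition solver :: "prog \<Rightarrow> prog" where
  "solver P = Seq init (Seq (While more_runs (body P)) (Seq (Assign 0 (Num 1) output_expr) (Assign 0 (Num 0) (Num 1))))"

end

context reduction
begin

definition instance_list :: "nat \<Rightarrow> nat list" where
  "instance_list r = [p + length (all_ports r Cls) * \<sigma>, length T * length (all_ports r Cls)]
     @ flat (graph_edges p 0 (all_ports r Cls)) @ [p] @ [0..<p]"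

definition Ready :: "nat \<Rightarrow> nat \<Rightarrow> store \<Rightarrow> bool" where
  "Ready r best s \<longleftrightarrow> static s \<and> s 2 0 = r \<and> s 3 0 = best \<and> fresh r s"

lemma St_cong: "(\<And>a. a \<in> {2..8} \<Longrightarrow> sc a = sc' a) \<Longrightarrow> St sc f s \<Longrightarrow> St sc' f s"
  by (simp add: St_def)

text \<open>\<open>Ready\<close> leaves scalars 4 to 8 open, so the triple is proved for arbitrary
  initial scalars \<open>sc\<close> and applied to those of the given store.\<close>

lemma trip_reset:
  assumes "r < N"
  shows "trip (Ready r best) reset (Bld r best 0 (cpos 0) 0 []) c_reset"
proof -
  have t: "trip (St sc (\<lambda>_. 0)) reset (St (sc(4 := 0, 5 := 0, 6 := 3, 7 := 0, 8 := 0)) (\<lambda>_. 0)) c_reset" for sc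
  proof -
    have z: "trip (St sc f) (Assign a (Num 0) (Num c)) (St (sc(a := c)) f) (acost (Num 0) (Num c))"
      if "a \<in> {3..8}" "c \<le> 3" for sc f a c
      by (rule trip_set_scalar) (use that V_bounds(8) in auto)
    show ?thesis unfolding reset_def c_reset_def by (intro trip_Seq[OF z]) (rule z | simp)+
  qed
  have ready: "St (\<lambda>a. s a 0) (\<lambda>_. 0) s" if "Ready r best s" for s
    using that assms unfolding Ready_def St_def fresh_def by auto
  have fin: "Bld r best 0 (cpos 0) 0 [] s'"
    if "St ((\<lambda>a. s a 0)(4 := 0, 5 := 0, 6 := 3, 7 := 0, 8 := 0)) (\<lambda>_. 0) s'" "Ready r best s" for s s'
    unfolding Bld_def Push_def
    using that by (auto simp: flat_def arr_Nil cpos_def enc_def Ready_def elim!: St_cong[rotated] simp: scal_def)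
  show ?thesis unfolding trip_def triple_def
  proof (intro allI impI)
    fix s assume R: "Ready r best s"
    from t[unfolded trip_def triple_def, rule_format, OF ready[OF R]] fin[OF _ R]
    show "\<exists>t s'. exec reset s t s' \<and> Bld r best 0 (cpos 0) 0 [] s' \<and> t \<le> c_reset * bits V" by blast
  qed
qed

lemma trip_clauses:
  "trip (Bld r best 0 (cpos 0) 0 []) (While more_clauses do_clause)
     (Bld r best (length Cls) (cpos (length Cls)) 0 (all_ports r Cls))
     (length Cls * (c_clause + (1 + ecost more_clauses)) + (1 + ecost more_clauses))"
proof -
  let ?I = "\<lambda>ci. Bld r best ci (cpos ci) 0 (all_ports r (take ci Cls))"
  have "trip (?I 0) (While more_clauses do_clause) (?I (length Cls))
     (length Cls * (c_clause + (1 + ecost more_clauses)) + (1 + ecost more_clauses))"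
  proof (rule trip_While)
    show "trip (?I i) do_clause (?I (Suc i)) c_clause" if "i < length Cls" for i
      by (rule trip_clause[OF that refl refl])
    show "reads_le V s more_clauses \<and> (eval s more_clauses \<noteq> 0 \<longleftrightarrow> i < length Cls)" if "?I i s" for i s
    proof
      show "reads_le V s more_clauses" by (rule Push_reads[OF that[unfolded Bld_def]]) (simp add: more_clauses_def)
      show "eval s more_clauses \<noteq> 0 \<longleftrightarrow> i < length Cls"
        using Push_scal[OF that[unfolded Bld_def]] by (simp add: more_clauses_def not_le)
    qed
  qed
  then show ?thesis by (simp add: all_ports_def)
qed

lemma length_all_ports: "length (all_ports r Cls) \<le> GM"
  by (simp add: GM_def length_all_ports_le)

lemma trip_list_hub:
  assumes "length ts \<le> GM"
  shows "trip (Bld r best ci cp 0 ts) list_hub (Push r best (length ts) ci cp p (flat (graph_edges p 0 ts) @ [p] @ [0..<p])) (c_hub p)"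
  unfolding list_hub_def c_hub_def Bld_def
proof (intro trip_Seq)
  let ?zs = "flat (graph_edges p 0 ts)"
  have "2 * length T * length ts \<le> 2 * length T * GM" using assms by (rule mult_le_mono2)
  moreover have "length ?zs = 2 * length T * length ts" by (simp add: length_flat length_graph_edges)
  ultimately have len: "length ?zs + p + 3 \<le> V" using V_bounds(8) by linarith
  show "trip (Push r best (length ts) ci cp 0 ?zs) (push (scalar 12)) (Push r best (length ts) ci cp 0 (?zs @ [p])) (c_push (scalar 12))"
    by (rule trip_push_arr) (use len in \<open>auto simp: Push_scal\<close>)
  have "trip (St (scal r best g ci cp l 0) f) (Assign 8 (Num 0) (Num 0)) (St ((scal r best g ci cp l 0)(8 := 0)) f) (acost (Num 0) (Num 0))" for g l f
    by (rule trip_set_scalar) auto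
  then show "trip (Push r best (length ts) ci cp 0 (?zs @ [p])) (Assign 8 (Num 0) (Num 0)) (Push r best (length ts) ci cp 0 (?zs @ [p])) (acost (Num 0) (Num 0))"
    unfolding Push_def by simp
  let ?I = "\<lambda>i. Push r best (length ts) ci cp i (?zs @ [p] @ [0..<i])"
  have "trip (?I 0) (While more_hub (Seq (push (scalar 8)) (incr 8))) (?I p)
    (p * (c_push (scalar 8) + c_incr 8 + (1 + ecost more_hub)) + (1 + ecost more_hub))"
  proof (rule trip_While)
    show "reads_le V s more_hub \<and> (eval s more_hub \<noteq> 0 \<longleftrightarrow> i < p)" if "?I i s" for i s
    proof
      show "reads_le V s more_hub" by (rule Push_reads[OF that]) (simp add: more_hub_def)
      show "eval s more_hub \<noteq> 0 \<longleftrightarrow> i < p" using Push_scal[OF that] by (simp add: more_hub_def not_le)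
    qed
    fix i assume i: "i < p"
    show "trip (?I i) (Seq (push (scalar 8)) (incr 8)) (?I (Suc i)) (c_push (scalar 8) + c_incr 8)"
    proof (rule trip_Seq)
      show "trip (?I i) (push (scalar 8)) (Push r best (length ts) ci cp i ((?zs @ [p] @ [0..<i]) @ [i])) (c_push (scalar 8))"
        by (rule trip_push_arr) (use len i in \<open>auto simp: Push_scal\<close>)
      have "trip (St (scal r best g ci cp l i) f) (incr 8) (St ((scal r best g ci cp l i)(8 := Suc i)) f) (c_incr 8)" for g l f
        unfolding incr_def c_incr_def by (rule trip_set_scalar) (use i V_bounds(6) in \<open>auto simp: St_scal\<close>)
      then show "trip (Push r best (length ts) ci cp i ((?zs @ [p] @ [0..<i]) @ [i])) (incr 8) (?I (Suc i)) (c_incr 8)"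
        unfolding Push_def by simp
    qed
  qed
  then show "trip (Push r best (length ts) ci cp 0 (?zs @ [p])) (While more_hub (Seq (push (scalar 8)) (incr 8)))
    (Push r best (length ts) ci cp p (?zs @ [p] @ [0..<p]))
    (p * (c_push (scalar 8) + c_incr 8 + (1 + ecost more_hub)) + (1 + ecost more_hub))" by simp
qed

lemma arr_input_store:
  "(arr zs)(1 := x, 2 := y, 0 := 2 + length zs) = input_store (x # y # zs) 0"
proof
  fix i :: nat
  have "i = 0 \<or> i = 1 \<or> i = 2 \<or> (\<exists>j. i = 3 + j)" by presburger
  then consider "i = 0" | "i = 1" | "i = 2" | j where "i = 3 + j" by blast
  then show "((arr zs)(1 := x, 2 := y, 0 := 2 + length zs)) i = input_store (x # y # zs) 0 i"
    by cases (auto simp: arr_def input_store_def numeral_eq_Suc)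
qed

definition Built :: "nat \<Rightarrow> nat \<Rightarrow> store \<Rightarrow> bool" where
  "Built r best = St (scal r best (length (all_ports r Cls)) (length Cls) (cpos (length Cls)) (length (instance_list r) - 2) p)
     (input_store (instance_list r) 0)"

lemma trip_build:
  assumes "r < N"
  shows "trip (Ready r best) build (Built r best) (c_build (length Cls) p)"
  unfolding build_def c_build_def
proof (intro trip_Seq)
  let ?ts = "all_ports r Cls"
  let ?zs = "flat (graph_edges p 0 ?ts) @ [p] @ [0..<p]"
  show "trip (Ready r best) reset (Bld r best 0 (cpos 0) 0 []) c_reset" by (rule trip_reset[OF assms])
  show "trip (Bld r best 0 (cpos 0) 0 []) (While more_clauses do_clause)
     (Bld r best (length Cls) (cpos (length Cls)) 0 ?ts) (length Cls * (c_clause + (1 + ecost more_clauses)) + (1 + ecost more_clauses))"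
    by (rule trip_clauses)
  show "trip (Bld r best (length Cls) (cpos (length Cls)) 0 ?ts) list_hub
     (Push r best (length ?ts) (length Cls) (cpos (length Cls)) p ?zs) (c_hub p)"
    by (rule trip_list_hub[OF length_all_ports])
  let ?sc = "scal r best (length ?ts) (length Cls) (cpos (length Cls)) (length ?zs) p"
  have "trip (St ?sc f) header (St ?sc (f(1 := p + length ?ts * \<sigma>, 2 := length T * length ?ts, 0 := 2 + length ?zs))) c_header" for f
    unfolding header_def c_header_def
  proof (intro trip_Seq)
    show "trip (St ?sc f) (poke (Num 1) count_vertices) (St ?sc (f(1 := p + length ?ts * \<sigma>))) (acost (run_index (Num 1)) count_vertices)"
      by (rule trip_poke) (auto simp: St_scal count_vertices_def)
    show "trip (St ?sc (f(1 := p + length ?ts * \<sigma>))) (poke (Num 2) count_edges)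
      (St ?sc (f(1 := p + length ?ts * \<sigma>, 2 := length T * length ?ts))) (acost (run_index (Num 2)) count_edges)"
      by (rule trip_poke) (auto simp: St_scal count_edges_def)
    show "trip (St ?sc (f(1 := p + length ?ts * \<sigma>, 2 := length T * length ?ts))) (poke (Num 0) (Add (Num 2) (scalar 7)))
      (St ?sc (f(1 := p + length ?ts * \<sigma>, 2 := length T * length ?ts, 0 := 2 + length ?zs))) (acost (run_index (Num 0)) (Add (Num 2) (scalar 7)))"
      by (rule trip_poke) (auto simp: St_scal)
  qed
  from this[of "arr ?zs"] show "trip (Push r best (length ?ts) (length Cls) (cpos (length Cls)) p ?zs) header (Built r best) c_header"
    unfolding Push_def Built_def arr_input_store by (simp add: instance_list_def)
qed

definition Ran :: "nat \<Rightarrow> nat \<Rightarrow> nat \<Rightarrow> store \<Rightarrow> bool" where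
  "Ran r best y s \<longleftrightarrow> static s \<and> s 2 0 = r \<and> s 3 0 = best \<and> s 4 0 = length (all_ports r Cls) \<and> fresh (Suc r) s \<and> s 13 r = y"

text \<open>A frame argument: the run touches only its own residue class in the banks from 13 on, so
  the tables survive and the memory of later runs stays zero.\<close>

lemma triple_run:
  assumes "exec P (input_store (instance_list r)) t s1" "s1 0 0 = y" "t \<le> TP"
  shows "triple (Built r best) (shift_prog 13 P) (Ran r best y) (slowdown N * TP)"
  unfolding triple_def
proof (intro allI impI)
  fix S assume S: "Built r best S"
  note S' = S[unfolded Built_def St_def scal_simps]
  have r: "r < N" using S' by simp
  have "hosts 13 N r S (input_store (instance_list r))"
    unfolding hosts_def
  proof (intro conjI allI)
    fix a j show "S (13 + a) (j * N + r) = input_store (instance_list r) a j"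
      using S' by (cases "a = 0") (auto simp: input_store_def)
  qed (use S' in \<open>auto simp: static_def\<close>)
  from shift_prog_exec[OF assms(1) this] obtain S1 t1 where
    e: "exec (shift_prog 13 P) S t1 S1" "hosts 13 N r S1 s1" "same_outside 13 N r S S1" "t1 \<le> slowdown N * t" by blast
  have so: "S1 a i = S a i" if "a < 13 \<or> i mod N \<noteq> r" for a i using e(3) that unfolding same_outside_def by blast
  have "Ran r best y S1"
    unfolding Ran_def
  proof (intro conjI)
    have "S1 a = S a" if "a < 13" for a using so that by blast
    then show "static S1" using S' unfolding static_def by simp
    show "S1 2 0 = r" "S1 3 0 = best" "S1 4 0 = length (all_ports r Cls)"
      using St_scal[OF S[unfolded Built_def]] so by auto
    show "S1 13 r = y" using e(2) assms(2) unfolding hosts_def by (metis add.right_neutral add_0 mult_0)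
    show "fresh (Suc r) S1"
      unfolding fresh_def
    proof (intro allI impI)
      fix a i r' :: nat assume a: "13 \<le> a" "Suc r \<le> r'" "r' < N"
      then have "(i * N + r') mod N \<noteq> r" by simp
      then show "S1 a (i * N + r') = 0" using so S' a by (simp add: fresh_def)
    qed
  qed
  moreover have "t1 \<le> slowdown N * TP" using e(4) mult_le_mono2[OF assms(3)] by (rule order_trans)
  ultimately show "\<exists>t s'. exec (shift_prog 13 P) S t s' \<and> Ran r best y s' \<and> t \<le> slowdown N * TP" using e(1) by blast
qed

lemma trip_update:
  assumes "y \<le> V" "r < N"
  shows "trip (Ran r best y) (Seq (Assign 3 (Num 0) update_expr) (incr 2))
     (Ready (Suc r) (max best (13 * length (all_ports r Cls) - y div 2))) (acost (Num 0) update_expr + c_incr 2)"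
proof (rule trip_Seq)
  let ?best = "max best (13 * length (all_ports r Cls) - y div 2)"
  show "trip (Ran r best y) (Assign 3 (Num 0) update_expr) (Ran r ?best y) (acost (Num 0) update_expr)"
    unfolding trip_def
  proof (rule triple_Assign)
    fix s assume R: "Ran r best y s"
    then have "s a i \<le> V" if "a < 13" for a i using that by (auto simp: Ran_def static_def)
    \<comment> \<open>Bank 13 has no general bound; \<open>reads_le\<close> asks only about the one
      cell that is read.\<close>
    moreover have "s 13 (s 2 0) \<le> V" using R assms(1) by (simp add: Ran_def)
    ultimately show "reads_le V s (Num 0) \<and> reads_le V s update_expr" by (simp add: update_expr_def)
    have "best \<le> V" using R by (auto simp: Ran_def static_def)
    moreover have "13 * length (all_ports r Cls) \<le> V" using length_all_ports[of r] V_bounds(7) by linarith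
    ultimately have "?best \<le> V" by simp
    moreover have "eval s update_expr = ?best" 
      using R unfolding Ran_def update_expr_def by (simp only: eval.simps eval_scalar)
    ultimately show "Ran r ?best y (s(3 := (s 3)(eval s (Num 0) := eval s update_expr)))"
      using R by (auto simp: Ran_def static_def fresh_def)
  qed (use V_bounds in auto)
  show "trip (Ran r ?best y) (incr 2) (Ready (Suc r) ?best) (c_incr 2)"
    unfolding trip_def incr_def c_incr_def
  proof (rule triple_Assign)
    fix s assume R: "Ran r ?best y s"
    then show "reads_le V s (Num 0) \<and> reads_le V s (Add (scalar 2) (Num 1))"
      by (auto simp: Ran_def static_def)
    have "Suc r \<le> V" using assms(2) V_bounds(4) by simp
    then show "Ready (Suc r) ?best (s(2 := (s 2)(eval s (Num 0) := eval s (Add (scalar 2) (Num 1)))))"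
      using R by (auto simp: Ran_def Ready_def static_def fresh_def)
  qed (use V_bounds in auto)
qed

definition solved :: "prog \<Rightarrow> nat \<Rightarrow> nat \<Rightarrow> bool" where
  "solved P TP r \<longleftrightarrow> (\<exists>t s X. exec P (input_store (instance_list r)) t s \<and> s 0 0 = 2 * card X \<and> t \<le> TP \<and>
     min_edge_deletion q {..<p + length (all_ports r Cls) * \<sigma>} (edge_set p (all_ports r Cls)) X)"

text \<open>\<open>best\<close> never exceeds what some assignment achieves and is not beaten by any
  assignment of the guesses already tried. After all \<open>N\<close> guesses it is the maximum, by
  \<open>assignment_covered\<close>.\<close>

definition best_of :: "nat \<Rightarrow> nat \<Rightarrow> bool" where
  "best_of r best \<longleftrightarrow> (\<exists>\<alpha>. best \<le> nsat \<alpha> Cls) \<and> (\<forall>r'<r. \<forall>dec. (\<forall>i. dec i < q) \<longrightarrow> nsat (assignment r' dec) Cls \<le> best)"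

definition Loop :: "nat \<Rightarrow> store \<Rightarrow> bool" where
  "Loop r s \<longleftrightarrow> (\<exists>best. Ready r best s \<and> best_of r best)"

definition c_body :: nat where
  "c_body = c_build (length Cls) p + (acost (Num 0) update_expr + c_incr 2)"

lemma triple_body:
  assumes "solved P TP r" "r < N"
  shows "triple (Loop r) (body P) (Loop (Suc r)) (c_body * bits V + slowdown N * TP)"
proof -
  obtain t s X where P: "exec P (input_store (instance_list r)) t s" "s 0 0 = 2 * card X" "t \<le> TP"
    and X: "min_edge_deletion q {..<p + length (all_ports r Cls) * \<sigma>} (edge_set p (all_ports r Cls)) X"
    using assms(1) unfolding solved_def by blast
  have peq: "p = q + (n div k + 1)" by (simp add: p_def B_def)
  note up = deletion_value_upper[OF good, of r X, folded peq, OF X]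
  note lo = deletion_value_lower[OF good, of r X, folded peq, OF X]
  let ?G = "length (all_ports r Cls)"
  have "card X \<le> 13 * ?G" using lo[of "\<lambda>_. 0"] q0 by simp
  then have y: "2 * card X \<le> V" using length_all_ports[of r] V_bounds(7) by linarith
  have step: "triple (Ready r best) (body P) (Ready (Suc r) (max best (13 * ?G - card X))) (c_body * bits V + slowdown N * TP)" for best
  proof -
    have "triple (Ready r best) (body P) (Ready (Suc r) (max best (13 * ?G - (2 * card X) div 2)))
      (c_build (length Cls) p * bits V + (slowdown N * TP + (acost (Num 0) update_expr + c_incr 2) * bits V))"
      unfolding body_def
      by (rule triple_Seq[OF trip_build[OF assms(2), unfolded trip_def]
            triple_Seq[OF triple_run[OF P] trip_update[OF y assms(2), unfolded trip_def]]])
    then show ?thesis by (rule triple_conseq) (auto simp: c_body_def algebra_simps)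
  qed
  have best: "best_of (Suc r) (max best (13 * ?G - card X))" if "best_of r best" for best
    unfolding best_of_def
  proof (intro conjI allI impI)
    obtain \<alpha> where "13 * ?G - card X \<le> nsat \<alpha> Cls" using up by (auto simp: le_diff_conv add.commute)
    then show "\<exists>\<alpha>. max best (13 * ?G - card X) \<le> nsat \<alpha> Cls"
      using that unfolding best_of_def by (metis max_def)
    fix r' and dec :: "nat \<Rightarrow> nat" assume r': "r' < Suc r" and dec: "\<forall>i. dec i < q"
    show "nsat (assignment r' dec) Cls \<le> max best (13 * ?G - card X)"
    proof (cases "r' = r")
      case True
      have "card X + nsat (assignment r dec) Cls \<le> 13 * ?G" using lo dec by blast
      then show ?thesis using True by simp
    next
      case False
      then show ?thesis using that r' dec unfolding best_of_def by (simp add: le_max_iff_disj)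
    qed
  qed
  show ?thesis unfolding triple_def
  proof (intro allI impI)
    fix s assume "Loop r s"
    then obtain best' where b: "Ready r best' s" "best_of r best'" by (auto simp: Loop_def)
    from step[of best'] b(1) obtain t s' where "exec (body P) s t s'" "Ready (Suc r) (max best' (13 * ?G - card X)) s'"
      "t \<le> c_body * bits V + slowdown N * TP" unfolding triple_def by blast
    then show "\<exists>t s'. exec (body P) s t s' \<and> Loop (Suc r) s' \<and> t \<le> c_body * bits V + slowdown N * TP"
      using best[OF b(2)] unfolding Loop_def by blast
  qed
qed

lemma triple_loop:
  assumes "\<And>r. r < N \<Longrightarrow> solved P TP r"
  shows "triple (Loop 0) (While more_runs (body P)) (Loop N)
     (N * (c_body * bits V + slowdown N * TP + (1 + ecost more_runs) * bits V) + (1 + ecost more_runs) * bits V)"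
proof (rule triple_While)
  show "reads_le V s more_runs \<and> (eval s more_runs \<noteq> 0 \<longleftrightarrow> r < N)" if "Loop r s" for r s
    using that by (auto simp: Loop_def Ready_def static_def more_runs_def)
qed (use V_bounds triple_body assms in auto)

definition base :: "store \<Rightarrow> bool" where
  "base s \<longleftrightarrow> s 0 = input_store xs 0 \<and> (\<forall>a i. 13 \<le> a \<longrightarrow> s a i = 0) \<and> (\<forall>a i. a < 13 \<longrightarrow> s a i \<le> V) \<and> s 2 0 = 0 \<and> s 3 0 = 0"

lemma trip_base_Assign:
  assumes "a \<in> {1,8,9,10,11,12}" "own i" "own e"
    "\<And>s. base s \<Longrightarrow> A s \<Longrightarrow> eval s e \<le> V \<and> D (s(a := (s a)(eval s i := eval s e)))"
  shows "trip (\<lambda>s. base s \<and> A s) (Assign a i e) (\<lambda>s. base s \<and> D s) (acost i e)"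
  unfolding trip_def
proof (rule triple_Assign)
  fix s assume s: "base s \<and> A s"
  show "reads_le V s i \<and> reads_le V s e" using s assms(2,3) by (auto simp: base_def intro: own_reads_le)
  show "base (s(a := (s a)(eval s i := eval s e))) \<and> D (s(a := (s a)(eval s i := eval s e)))"
    using s assms(1) assms(4)[of s] by (auto simp: base_def)
qed (use V_bounds in auto)

lemma C_pos: "C \<ge> 1" by (simp add: C_def)

lemma C_power_le: "i \<le> B \<Longrightarrow> C ^ i \<le> V"
  using V_bounds(4) power_increasing[OF _ C_pos, of i B] by (simp add: N_def)

lemma trip_init: "trip (\<lambda>s. base s \<and> s 8 0 = 0) init (Ready 0 0) (c_init B)"
proof -
  let ?T = "\<lambda>j s. s 8 0 = 0 \<and> (\<forall>i<j. s 10 i = 2 ^ i)"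
  have 1: "trip (\<lambda>s. base s \<and> ?T 0 s) power_table (\<lambda>s. base s \<and> ?T k s) c_power_table"
  proof -
    let ?Ps = "map (\<lambda>j. Assign 10 (Num j) (Num (2 ^ j))) [0..<k]"
    let ?t = "sum_list (map (\<lambda>j. acost (Num j) (Num (2 ^ j))) [0..<k])"
    have "trip (\<lambda>s. base s \<and> ?T 0 s) (seqs ?Ps) (\<lambda>s. base s \<and> ?T (length ?Ps) s) (length ?Ps * ?t + 1)"
    proof (rule trip_seqs)
      fix j assume "j < length ?Ps"
      then have j: "j < k" by simp
      have "(2::nat) ^ j \<le> 2 ^ k" using j by (intro power_increasing) auto
      then have jV: "2 ^ j \<le> V" using V_bounds(5) by (rule order_trans)
      have t: "trip (\<lambda>s. base s \<and> ?T j s) (Assign 10 (Num j) (Num (2 ^ j))) (\<lambda>s. base s \<and> ?T (Suc j) s) (acost (Num j) (Num (2 ^ j)))"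
        by (rule trip_base_Assign) (use jV in \<open>auto simp: less_Suc_eq\<close>)
      have "acost (Num j) (Num (2 ^ j)) \<le> ?t" using j by (intro member_le_sum_list) auto
      from trip_conseq[OF t _ _ this] j
      show "trip (\<lambda>s. base s \<and> ?T j s) (?Ps ! j) (\<lambda>s. base s \<and> ?T (Suc j) s) ?t" by simp
    qed
    then show ?thesis by (simp add: power_table_def c_power_table_def)
  qed
  let ?A = "\<lambda>s. ?T k s \<and> s 11 0 = B"
  let ?I = "\<lambda>i s. (\<forall>i<k. s 10 i = 2 ^ i) \<and> s 11 0 = B \<and> s 8 0 = i \<and> (\<forall>j\<le>i. s 9 j = C ^ j)"
  have BV: "B \<le> V" using V_bounds(6) by (simp add: p_def)
  have 2: "trip (\<lambda>s. base s \<and> ?T k s) (Assign 11 (Num 0) blocks_expr) (\<lambda>s. base s \<and> ?A s) (acost (Num 0) blocks_expr)"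
    by (rule trip_base_Assign) (use BV in \<open>auto simp: blocks_expr_def B_def base_def\<close>)
  have 3: "trip (\<lambda>s. base s \<and> ?A s) (Assign 9 (Num 0) (Num 1)) (\<lambda>s. base s \<and> ?I 0 s) (acost (Num 0) (Num 1))"
    by (rule trip_base_Assign) (use V_bounds(1) in auto)
  have 4: "trip (\<lambda>s. base s \<and> ?I 0 s) (While more_blocks (Seq (Assign 9 (Add (scalar 8) (Num 1)) next_power) (incr 8)))
    (\<lambda>s. base s \<and> ?I B s) (B * ((acost (Add (scalar 8) (Num 1)) next_power + c_incr 8) + (1 + ecost more_blocks)) + (1 + ecost more_blocks))"
  proof (rule trip_While)
    show "reads_le V s more_blocks \<and> (eval s more_blocks \<noteq> 0 \<longleftrightarrow> i < B)" if "base s \<and> ?I i s" for i s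
      using that by (auto simp: more_blocks_def base_def)
    fix i assume i: "i < B"
    show "trip (\<lambda>s. base s \<and> ?I i s) (Seq (Assign 9 (Add (scalar 8) (Num 1)) next_power) (incr 8)) (\<lambda>s. base s \<and> ?I (Suc i) s)
      (acost (Add (scalar 8) (Num 1)) next_power + c_incr 8)"
    proof (rule trip_Seq)
      let ?M = "\<lambda>s. (\<forall>i<k. s 10 i = 2 ^ i) \<and> s 11 0 = B \<and> s 8 0 = i \<and> (\<forall>j\<le>Suc i. s 9 j = C ^ j)"
      show "trip (\<lambda>s. base s \<and> ?I i s) (Assign 9 (Add (scalar 8) (Num 1)) next_power) (\<lambda>s. base s \<and> ?M s) (acost (Add (scalar 8) (Num 1)) next_power)"
        by (rule trip_base_Assign) (use C_power_le[of "Suc i"] i in \<open>auto simp: next_power_def le_Suc_eq mult.commute\<close>)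
      show "trip (\<lambda>s. base s \<and> ?M s) (incr 8) (\<lambda>s. base s \<and> ?I (Suc i) s) (c_incr 8)"
        unfolding incr_def c_incr_def by (rule trip_base_Assign) (use i BV in auto)
    qed
  qed
  have 5: "trip (\<lambda>s. base s \<and> ?I B s) (Assign 1 (Num 0) (Cell 9 (scalar 11))) (\<lambda>s. base s \<and> ?I B s \<and> s 1 0 = N) (acost (Num 0) (Cell 9 (scalar 11)))"
    by (rule trip_base_Assign) (use V_bounds(4) in \<open>auto simp: N_def\<close>)
  have 6: "trip (\<lambda>s. base s \<and> ?I B s \<and> s 1 0 = N) (Assign 12 (Num 0) (Add (Num q) (scalar 11)))
     (\<lambda>s. base s \<and> ?I B s \<and> s 1 0 = N \<and> s 12 0 = p) (acost (Num 0) (Add (Num q) (scalar 11)))"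
    by (rule trip_base_Assign) (use V_bounds(6) in \<open>auto simp: p_def\<close>)
  have "trip (\<lambda>s. base s \<and> ?T 0 s) init (\<lambda>s. base s \<and> ?I B s \<and> s 1 0 = N \<and> s 12 0 = p) (c_init B)"
    unfolding init_def c_init_def by (rule trip_Seq[OF 1 trip_Seq[OF 2 trip_Seq[OF 3 trip_Seq[OF 4 trip_Seq[OF 5 6]]]]])
  then show ?thesis
    by (rule trip_conseq) (auto simp: Ready_def static_def base_def fresh_def)
qed

lemma base_input: "base (input_store xs)"
proof -
  have "input_store xs 0 i \<le> V" for i
    using V_bounds(2) V_bounds(3)[OF nth_mem, of "i - 1"] by (cases i) (auto simp: input_store_def)
  moreover have "input_store xs a i = 0" if "a \<noteq> 0" for a i using that by (simp add: input_store_def)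
  ultimately show ?thesis unfolding base_def by (metis le0 not_numeral_le_zero zero_neq_numeral)
qed

lemma Loop_N:
  assumes "best_of N best"
  shows "nsat \<alpha> Cls \<le> best"
proof -
  obtain r dec where "r < N" "\<And>i. dec i < q" "\<And>v. v < n \<Longrightarrow> assignment r dec v = \<alpha> v"
    using assignment_covered[of n \<alpha>] unfolding N_def B_def by blast
  then show ?thesis using assms nsat_cong[OF good, of "assignment r dec" \<alpha>] unfolding best_of_def by metis
qed

definition c_output :: nat where
  "c_output = acost (Num 1) output_expr + acost (Num 0) (Num 1)"

lemma solver_correct:
  assumes "\<And>r. r < N \<Longrightarrow> solved P TP r"
  obtains t s best \<alpha> where "exec (solver P) (input_store xs) t s" "output_list s = [length Cls - best]"
    "best \<le> nsat \<alpha> Cls" "\<And>\<beta>. nsat \<beta> Cls \<le> best"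
    "t \<le> (c_init B + (1 + ecost more_runs) + c_output) * bits V + N * (slowdown N * TP + (c_body + (1 + ecost more_runs)) * bits V)"
proof -
  let ?O = "\<lambda>s. \<exists>best. best_of N best \<and> output_list s = [length Cls - best]"
  let ?M = "\<lambda>s. \<exists>best. best_of N best \<and> s 0 1 = length Cls - best"
  have o: "trip (Loop N) (Seq (Assign 0 (Num 1) output_expr) (Assign 0 (Num 0) (Num 1))) ?O c_output"
    unfolding c_output_def
  proof (rule trip_Seq)
    show "trip (Loop N) (Assign 0 (Num 1) output_expr) ?M (acost (Num 1) output_expr)"
      unfolding trip_def
    proof (rule triple_Assign)
      fix s assume "Loop N s"
      then obtain best where b: "static s" "s 3 0 = best" "best_of N best" by (auto simp: Loop_def Ready_def)
      then have "reads_le V s output_expr" by (intro own_reads_le) (auto simp: output_expr_def static_def)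
      then show "reads_le V s (Num 1) \<and> reads_le V s output_expr" by simp
      show "?M (s(0 := (s 0)(eval s (Num 1) := eval s output_expr)))"
        by (rule exI[of _ best]) (use b in \<open>auto simp: output_expr_def static_def\<close>)
    qed (use V_bounds in auto)
    show "trip ?M (Assign 0 (Num 0) (Num 1)) ?O (acost (Num 0) (Num 1))"
      unfolding trip_def by (rule triple_Assign) (use V_bounds in \<open>auto simp: output_list_def\<close>)
  qed
  have "Ready 0 0 s \<Longrightarrow> Loop 0 s" for s by (auto simp: Loop_def best_of_def)
  then have i: "trip (\<lambda>s. base s \<and> s 8 0 = 0) init (Loop 0) (c_init B)"
    by (intro trip_conseq[OF trip_init]) auto
  have "triple (\<lambda>s. base s \<and> s 8 0 = 0) (solver P) ?O (c_init B * bits V +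
    ((N * (c_body * bits V + slowdown N * TP + (1 + ecost more_runs) * bits V) + (1 + ecost more_runs) * bits V) + c_output * bits V))"
    unfolding solver_def by (rule triple_Seq[OF i[unfolded trip_def] triple_Seq[OF triple_loop[OF assms] o[unfolded trip_def]]])
  moreover have "input_store xs 8 0 = 0" by (simp add: input_store_def)
  ultimately obtain t s best where "exec (solver P) (input_store xs) t s" "best_of N best" "output_list s = [length Cls - best]"
    "t \<le> c_init B * bits V + ((N * (c_body * bits V + slowdown N * TP + (1 + ecost more_runs) * bits V) + (1 + ecost more_runs) * bits V) + c_output * bits V)"
    using base_input unfolding triple_def by blast
  moreover obtain \<alpha> where "best \<le> nsat \<alpha> Cls" using \<open>best_of N best\<close> by (auto simp: best_of_def)
  moreover have "c_init B * bits V + ((N * (c_body * bits V + slowdown N * TP + (1 + ecost more_runs) * bits V) + (1 + ecost more_runs) * bits V) + c_output * bits V)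
    = (c_init B + (1 + ecost more_runs) + c_output) * bits V + N * (slowdown N * TP + (c_body + (1 + ecost more_runs)) * bits V)"
    by (simp add: algebra_simps)
  ultimately show ?thesis using that Loop_N by metis
qed

end

section \<open>Running time\<close>

definition poly_bounded :: "(nat \<Rightarrow> nat) \<Rightarrow> bool" where
  "poly_bounded f \<longleftrightarrow> (\<exists>c. \<forall>n. f n \<le> (n + 2) ^ c)"

lemma poly_bounded_const: "poly_bounded (\<lambda>_. a)"
  unfolding poly_bounded_def
proof (intro exI allI)
  fix n
  have "a \<le> 2 ^ a" by (simp add: less_imp_le)
  also have "\<dots> \<le> (n + 2) ^ a" by (intro power_mono) auto
  finally show "a \<le> (n + 2) ^ a" .
qed

lemma poly_bounded_id: "poly_bounded (\<lambda>n. n)"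
  unfolding poly_bounded_def by (intro exI[of _ 1]) simp

lemma poly_bounded_add:
  assumes "poly_bounded f" "poly_bounded g"
  shows "poly_bounded (\<lambda>n. f n + g n)"
proof -
  obtain c d where c: "\<And>n. f n \<le> (n + 2) ^ c" and d: "\<And>n. g n \<le> (n + 2) ^ d"
    using assms unfolding poly_bounded_def by blast
  have "f n + g n \<le> (n + 2) ^ Suc (max c d)" for n
  proof -
    have "(n + 2) ^ c \<le> (n + 2) ^ max c d" "(n + 2) ^ d \<le> (n + 2) ^ max c d" by (auto intro: power_increasing)
    then have "f n + g n \<le> 2 * (n + 2) ^ max c d" using c[of n] d[of n] by linarith
    also have "\<dots> \<le> (n + 2) * (n + 2) ^ max c d" by (intro mult_le_mono1) simp
    finally show ?thesis by simp
  qed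
  then show ?thesis unfolding poly_bounded_def by blast
qed

lemma poly_bounded_mult:
  assumes "poly_bounded f" "poly_bounded g"
  shows "poly_bounded (\<lambda>n. f n * g n)"
proof -
  obtain c d where c: "\<And>n. f n \<le> (n + 2) ^ c" and d: "\<And>n. g n \<le> (n + 2) ^ d"
    using assms unfolding poly_bounded_def by blast
  have "f n * g n \<le> (n + 2) ^ (c + d)" for n
    using mult_le_mono[OF c[of n] d[of n]] by (simp add: power_add)
  then show ?thesis unfolding poly_bounded_def by blast
qed

lemma poly_bounded_power: "poly_bounded f \<Longrightarrow> poly_bounded (\<lambda>n. f n ^ d)"
  by (induction d) (auto intro: poly_bounded_const poly_bounded_mult)

lemma poly_bounded_mono: "poly_bounded g \<Longrightarrow> (\<And>n. f n \<le> g n) \<Longrightarrow> poly_bounded f"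
  unfolding poly_bounded_def using order_trans by blast

lemma poly_bounded_div: "poly_bounded f \<Longrightarrow> poly_bounded (\<lambda>n. f n div d)"
  by (erule poly_bounded_mono) (rule div_le_dividend)

lemmas poly_bounded_intros = poly_bounded_const poly_bounded_id poly_bounded_add poly_bounded_mult
  poly_bounded_power poly_bounded_div

text \<open>Counts the lists of at most three of the \<open>2 * n\<close> literals.\<close>

definition clause_bound :: "nat \<Rightarrow> nat" where
  "clause_bound n = 1 + 2 * n + (2 * n) ^ 2 + (2 * n) ^ 3"

lemma card_cnf3:
  assumes "cnf3 n F" "finite F"
  shows "card F \<le> clause_bound n"
proof -
  let ?S = "{..<n} \<times> (UNIV :: bool set)"
  let ?L = "{l. set l \<subseteq> ?S \<and> length l \<le> 3}"
  have fin: "finite ?L" by (rule finite_lists_length_le) simp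
  have "F \<subseteq> set ` ?L"
  proof
    fix D assume "D \<in> F"
    then have D: "D \<subseteq> ?S" "card D \<le> 3" using assms(1) by (auto simp: cnf3_def)
    then have "finite D" by (auto intro: finite_subset)
    then obtain l where "set l = D" "length l = card D" by (metis finite_distinct_list distinct_card)
    then show "D \<in> set ` ?L" using D by auto
  qed
  then have "card F \<le> card ?L" by (rule surj_card_le[OF fin])
  also have "\<dots> = (\<Sum>i\<le>3. card ?S ^ i)" by (rule card_lists_length_le) simp
  also have "\<dots> = clause_bound n" by (simp add: clause_bound_def numeral_eq_Suc mult.commute)
  finally show ?thesis .
qed

lemma length_enc: "\<forall>Cl\<in>set Cls. length Cl \<le> 3 \<Longrightarrow> length (enc Cls) \<le> 4 * length Cls"
  by (induction Cls) (auto simp: enc_def)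

lemma encodes_edges_length:
  assumes "encodes_edges X ys"
  shows "length ys = 2 * card X"
proof -
  obtain es where es: "distinct (map (\<lambda>(u, v). {u, v}) es)" "set (map (\<lambda>(u, v). {u, v}) es) = X" "ys = flat es"
    using assms by (auto simp: encodes_edges_def flat_def)
  have "card X = length es" using distinct_card[OF es(1)] es(2) by simp
  then show ?thesis by (simp add: es(3) length_flat)
qed

lemma computes_within_mono: "computes_within P xs Q T \<Longrightarrow> T \<le> T' \<Longrightarrow> computes_within P xs Q T'"
  unfolding computes_within_def using order_trans by blast

lemma length_output_list: "length (output_list s) = s 0 0"
  by (simp add: output_list_def)

section \<open>Assembling the time bound\<close>

context block_encoding
begin

definition gadget_bound :: "nat \<Rightarrow> nat" where "gadget_bound n = clause_bound n * q ^ 3"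

definition hub_size :: "nat \<Rightarrow> nat" where "hub_size n = q + (n div k + 1)"

text \<open>The binary logarithm of \<open>V\<close>. Quantities polynomial in n are covered by x
  \<le> 2 ^ x, while \<open>k\<close> stands for 2 ^ k and \<open>C * (n div k + 1)\<close> for the
  number of runs, as C ^ B \<le> 2 ^ (C * B). Thus \<open>V\<close> is exponential, but
  \<open>bits V\<close> is polynomial.\<close>

definition word_bound :: "nat \<Rightarrow> nat" where
  "word_bound n = 10 + 5 * clause_bound n + 2 * n + C * (n div k + 1) + k + hub_size n + 26 * gadget_bound n
     + 2 * length T * gadget_bound n"

definition vertex_bound :: "nat \<Rightarrow> nat" where
  "vertex_bound n = hub_size n + gadget_bound n * \<sigma>"

definition time_factor :: "nat \<Rightarrow> nat \<Rightarrow> nat" where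
  "time_factor c n =
     (c_init (n div k + 1) + (1 + ecost more_runs) + (acost (Num 1) output_expr + acost (Num 0) (Num 1))) * (word_bound n + 2)
     + ((4 * (word_bound n + 2) + 10) * (vertex_bound n + 2) ^ c
     + (c_build (clause_bound n) (hub_size n) + (acost (Num 0) update_expr + c_incr 2) + (1 + ecost more_runs)) * (word_bound n + 2))"

lemma poly_bounded_time_factor: "poly_bounded (time_factor c)"
proof -
  have 1: "poly_bounded clause_bound" unfolding clause_bound_def by (intro poly_bounded_intros)
  have 2: "poly_bounded gadget_bound" unfolding gadget_bound_def by (intro poly_bounded_intros 1)
  have 3: "poly_bounded hub_size" unfolding hub_size_def by (intro poly_bounded_intros)
  have 4: "poly_bounded word_bound" unfolding word_bound_def by (intro poly_bounded_intros 1 2 3)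
  have 5: "poly_bounded vertex_bound" unfolding vertex_bound_def by (intro poly_bounded_intros 2 3)
  have 6: "poly_bounded (\<lambda>n. c_init (n div k + 1))" unfolding c_init_def by (intro poly_bounded_intros)
  have 7: "poly_bounded (\<lambda>n. c_build (clause_bound n) (hub_size n))"
    unfolding c_build_def c_hub_def by (intro poly_bounded_intros 1 3)
  show ?thesis unfolding time_factor_def by (intro poly_bounded_intros 4 5 6 7)
qed

text \<open>The exponential factors are the number of runs and the power of b spent on each: C ^ B *
  b ^ (q + B) = (C * b) ^ B * b ^ q. Everything else goes into \<open>time_factor\<close>.\<close>

lemma reduction_time:
  fixes b :: real
  assumes b: "1 \<le> b"
    and P: "\<And>n E Q p xs. simple_graph {..<n} E \<Longrightarrow> hub \<sigma> 6 {..<n} E Q \<Longrightarrow> card Q = p \<Longrightarrow> encodes_instance n E Q xs \<Longrightarrow>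
        computes_within P xs (\<lambda>ys. \<exists>X. min_edge_deletion q {..<n} E X \<and> encodes_edges X ys) (b ^ p * (real n + 2) ^ c)"
    and F: "cnf3 n F" "encodes_cnf n F xs"
  shows "computes_within (solver P) xs (\<lambda>ys. ys = [min_clause_deletion F])
     ((C * b) ^ (n div k + 1) * b ^ q * real (time_factor c n))"
proof -
  obtain Cs where Cs: "\<forall>L\<in>set Cs. distinct L" "distinct (map set Cs)" "set ` set Cs = F"
    "xs = [n, length Cs] @ concat (map (\<lambda>L. length L # map literal_code L) Cs)"
    using F(2) by (auto simp: encodes_cnf_def)
  define Cls where "Cls = map (map literal_code) Cs"
  have len: "length Cls = length Cs" by (simp add: Cls_def)
  have xs: "xs = n # length Cls # enc Cls" by (simp add: Cs(4) Cls_def enc_def comp_def)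
  have cl: "length L \<le> 3 \<and> set L \<subseteq> {..<n} \<times> UNIV" if "L \<in> set Cs" for L
    using that F(1) Cs(1,3) distinct_card[of L] unfolding cnf3_def by fastforce
  have good: "\<forall>Cl\<in>set Cls. good_clause n Cl"
  proof
    fix Cl assume "Cl \<in> set Cls"
    then obtain L where L: "L \<in> set Cs" "Cl = map literal_code L" by (auto simp: Cls_def)
    show "good_clause n Cl" using cl[OF L(1)] by (auto simp: L(2) good_clause_def literal_code_def)
  qed
  have "finite F" using Cs(3) by auto
  then have m: "length Cls \<le> clause_bound n"
    using card_cnf3[OF F(1)] distinct_card[OF Cs(2)] Cs(3) len by simp
  define B where "B = n div k + 1"
  define p where "p = q + B"
  define N where "N = C ^ B"
  define GM where "GM = length Cls * q ^ 3"
  define w where "w = word_bound n"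
  define V :: nat where "V = 2 ^ w"
  have GM: "GM \<le> gadget_bound n" unfolding GM_def gadget_bound_def using m by (rule mult_le_mono1)
  have TGM: "2 * length T * GM \<le> 2 * length T * gadget_bound n" using GM by (rule mult_le_mono2)
  have p_eq: "p = hub_size n" by (simp add: p_def B_def hub_size_def)
  have w: "w = 10 + 5 * clause_bound n + 2 * n + C * B + k + p + 26 * gadget_bound n + 2 * length T * gadget_bound n"
    by (simp add: w_def word_bound_def B_def p_eq)
  have wV: "x \<le> V" if "x \<le> w" for x
    using that less_exp[of w] unfolding V_def by linarith
  have pw: "2 ^ x \<le> V" if "x \<le> w" for x unfolding V_def using that by (intro power_increasing) auto
  have len_enc: "length (enc Cls) \<le> 4 * clause_bound n"
    using length_enc[of Cls] good m unfolding good_clause_def by (meson mult_le_mono2 order_trans)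
  have lx: "length xs = 2 + length (enc Cls)" by (simp add: xs)
  interpret reduction q \<sigma> T lab k C n Cls V B N p GM xs
  proof
    show "\<forall>Cl\<in>set Cls. good_clause n Cl" by (rule good)
    show "2 \<le> V" "length xs \<le> V" "length xs + 2 \<le> V" "p \<le> V" "26 * GM \<le> V" "2 * length T * GM + p + 3 \<le> V"
      by (rule wV; use w lx len_enc GM TGM in linarith)+
    have "x \<le> w" if "x \<in> set xs" for x
    proof -
      from that consider "x = n" | "x = length Cls" | Cl where "Cl \<in> set Cls" "x = length Cl \<or> x \<in> set Cl"
        by (auto simp: xs enc_def)
      then show ?thesis
      proof cases
        case 3
        then have "x \<le> 3 \<or> x div 2 < n" using good by (auto simp: good_clause_def)
        then have "x \<le> 3 + 2 * n" by linarith
        then show ?thesis using w by linarith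
      qed (use w m in linarith)+
    qed
    then show "\<And>x. x \<in> set xs \<Longrightarrow> x \<le> V" using wV by blast
    have "N \<le> (2 ^ C) ^ B" unfolding N_def by (intro power_mono) (auto simp: less_imp_le)
    also have "\<dots> = 2 ^ (C * B)" by (simp add: power_mult)
    also have "\<dots> \<le> V" by (rule pw) (use w in linarith)
    finally show "N \<le> V" .
    show "2 ^ k \<le> V" by (rule pw) (use w in linarith)
  qed (simp_all add: B_def N_def p_def GM_def xs)
  \<comment> \<open>Running times are natural numbers, so the real bound may be rounded
    down.\<close>
  define TP where "TP = nat \<lfloor>b ^ p * (real (vertex_bound n) + 2) ^ c\<rfloor>"
  have TP: "real TP \<le> b ^ p * (real (vertex_bound n) + 2) ^ c" using b unfolding TP_def by simp
  have "solved P TP r" for r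
  proof -
    let ?ts = "all_ports r Cls"
    let ?n = "p + length ?ts * \<sigma>"
    have hp: "\<forall>t\<in>set ?ts. hub_ports p t" using hub_ports_all[OF good] by (simp add: p_def B_def)
    have d: "distinct (map (\<lambda>(u,v). {u,v}) (graph_edges p 0 ?ts))" by (rule distinct_graph_edges[OF hp])
    have ee: "encodes_edges (edge_set p ?ts) (flat (graph_edges p 0 ?ts))"
      unfolding encodes_edges_def by (intro exI[of _ "graph_edges p 0 ?ts"]) (use d in \<open>simp add: edge_set_def flat_def\<close>)
    have ce: "card (edge_set p ?ts) = length T * length ?ts"
      using encodes_edges_length[OF ee] by (simp add: length_flat length_graph_edges)
    have "encodes_instance ?n (edge_set p ?ts) {..<p} (instance_list r)"
      unfolding encodes_instance_def
      by (intro exI[of _ "flat (graph_edges p 0 ?ts)"] exI[of _ "[0..<p]"]) (use ee ce in \<open>auto simp: instance_list_def\<close>)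
    from P[OF simple_graph_edge_set[OF hp] hub_edge_set[OF hp] _ this, of p]
    obtain s t X where r: "exec P (input_store (instance_list r)) t s" "min_edge_deletion q {..<?n} (edge_set p ?ts) X"
      "encodes_edges X (output_list s)" "real t \<le> b ^ p * (real ?n + 2) ^ c"
      unfolding computes_within_def by auto
    have "?n \<le> vertex_bound n"
      unfolding vertex_bound_def p_eq using order_trans[OF length_all_ports GM] by (intro add_mono mult_le_mono1) auto
    then have "real ?n \<le> real (vertex_bound n)" by (rule of_nat_mono)
    then have "(real ?n + 2) ^ c \<le> (real (vertex_bound n) + 2) ^ c"
      by (intro power_mono add_right_mono) (assumption, simp)
    then have "b ^ p * (real ?n + 2) ^ c \<le> b ^ p * (real (vertex_bound n) + 2) ^ c" using b by (intro mult_left_mono) auto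
    then have "t \<le> TP" using r(4) unfolding TP_def by (simp add: le_nat_floor)
    moreover have "s 0 0 = 2 * card X" using encodes_edges_length[OF r(3)] by (simp add: length_output_list)
    ultimately show ?thesis unfolding solved_def using r(1,2) by blast
  qed
  then obtain t s best \<alpha> where res: "exec (solver P) (input_store xs) t s" "output_list s = [length Cls - best]"
    "best \<le> nsat \<alpha> Cls" "\<And>\<beta>. nsat \<beta> Cls \<le> best"
    "t \<le> (c_init B + (1 + ecost more_runs) + c_output) * bits V + N * (slowdown N * TP + (c_body + (1 + ecost more_runs)) * bits V)"
    using solver_correct[of P TP] by metis
  have "output_list s = [min_clause_deletion F]"
    using min_clause_deletion_eq[OF Cs(2,3), of best \<alpha>] res(2-4) len unfolding Cls_def by simp
  moreover have "real t \<le> (C * b) ^ (n div k + 1) * b ^ q * real (time_factor c n)"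
  proof -
    define X1 where "X1 = (c_init B + (1 + ecost more_runs) + c_output) * (w + 2)"
    define X2 where "X2 = (4 * (w + 2) + 10) * (vertex_bound n + 2) ^ c"
    define X3 where "X3 = (c_build (clause_bound n) p + (acost (Num 0) update_expr + c_incr 2) + (1 + ecost more_runs)) * (w + 2)"
    have tf: "time_factor c n = X1 + (X2 + X3)"
      by (simp add: time_factor_def X1_def X2_def X3_def B_def p_eq w_def c_output_def)
    have bV: "bits V = w + 2" by (simp add: V_def bits_two_power)
    have sl: "slowdown N \<le> 4 * (w + 2) + 10"
      unfolding slowdown_def using bits_mono[OF V_bounds(4)] bV by simp
    have "c_build (length Cls) p \<le> c_build (clause_bound n) p"
      unfolding c_build_def using m by (intro add_mono mult_le_mono1) auto
    then have "(c_body + (1 + ecost more_runs)) * bits V \<le> X3"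
      unfolding c_body_def X3_def bV by (intro mult_le_mono1) simp
    then have "t \<le> X1 + N * (slowdown N * TP + X3)"
      using res(5) unfolding X1_def bV by (meson add_left_mono mult_le_mono2 order_trans)
    then have t: "real t \<le> real X1 + real N * (real (slowdown N) * real TP + real X3)"
      by (metis of_nat_add of_nat_mono of_nat_mult)
    have bp: "1 \<le> b ^ p" "1 \<le> b ^ B" "1 \<le> b ^ q" using b by (simp_all add: one_le_power)
    have N1: "1 \<le> real N" using C_pos by (simp add: N_def)
    have "real (slowdown N) * real TP \<le> real (4 * (w + 2) + 10) * (b ^ p * (real (vertex_bound n) + 2) ^ c)"
      using sl TP b by (intro mult_mono) auto
    also have "\<dots> = b ^ p * real X2" by (simp add: X2_def add.commute)
    finally have "real (slowdown N) * real TP + real X3 \<le> b ^ p * real X2 + b ^ p * real X3"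
      using mult_right_mono[OF bp(1), of "real X3"] by simp
    then have "real N * (real (slowdown N) * real TP + real X3) \<le> real N * (b ^ p * (real X2 + real X3))"
      by (intro mult_left_mono) (simp_all add: distrib_left)
    moreover have "real X1 \<le> real N * (b ^ p * real X1)"
    proof -
      have "1 * real X1 \<le> (real N * b ^ p) * real X1"
        using mult_mono[OF N1 bp(1)] N1 by (intro mult_right_mono) auto
      then show ?thesis by (simp add: mult.assoc)
    qed
    ultimately have "real t \<le> real N * (b ^ p * real (X1 + (X2 + X3)))"
      using t by (simp add: distrib_left)
    also have "\<dots> = (C * b) ^ B * b ^ q * real (X1 + (X2 + X3))"
      by (simp add: N_def p_def power_add power_mult_distrib mult.assoc mult.left_commute)
    finally show ?thesis by (simp add: tf B_def)
  qed
  ultimately show ?thesis unfolding computes_within_def using res(1) by blast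
qed

lemma max3sat_from_edge_deletion:
  fixes b :: real
  assumes b: "1 \<le> b" "C * b < 2 ^ k"
    and P: "\<And>n E Q p xs. simple_graph {..<n} E \<Longrightarrow> hub \<sigma> 6 {..<n} E Q \<Longrightarrow> card Q = p \<Longrightarrow> encodes_instance n E Q xs \<Longrightarrow>
        computes_within P xs (\<lambda>ys. \<exists>X. min_edge_deletion q {..<n} E X \<and> encodes_edges X ys) (b ^ p * (real n + 2) ^ c)"
  shows "\<exists>\<gamma><2. max3sat_solvable_in_base \<gamma>"
proof -
  define W where "W = C * b"
  have W1: "1 \<le> W" using b(1) mult_mono[of 1 "real C" 1 b] by (simp add: W_def C_def)
  \<comment> \<open>One block of \<open>k\<close> variables contributes the factor \<open>W\<close>,
    hence a single variable its k-th root.\<close>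
  define \<gamma> where "\<gamma> = root k W"
  have g: "\<gamma> ^ k = W" "1 \<le> \<gamma>" "\<gamma> < 2"
  proof -
    show "\<gamma> ^ k = W" unfolding \<gamma>_def using k0 W1 by (intro real_root_pow_pos2) auto
    show "1 \<le> \<gamma>" unfolding \<gamma>_def using k0 W1 by simp
    have "\<gamma> < root k (2 ^ k)" unfolding \<gamma>_def using k0 b(2) by (simp add: W_def)
    then show "\<gamma> < 2" using k0 by (simp add: real_root_power_cancel)
  qed
  \<comment> \<open>The factor \<open>W\<close> of the one block beyond n div k and the factor b ^ q
    of the references do not depend on n.\<close>
  define A where "A = nat \<lceil>W * b ^ q\<rceil>"
  have A: "W * b ^ q \<le> real A" unfolding A_def by linarith
  have "poly_bounded (\<lambda>n. A * time_factor c n)"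
    by (intro poly_bounded_mult poly_bounded_const poly_bounded_time_factor)
  then obtain d where d: "\<And>n. A * time_factor c n \<le> (n + 2) ^ d" unfolding poly_bounded_def by blast
  have "computes_within (solver P) xs (\<lambda>ys. ys = [min_clause_deletion F]) (\<gamma> ^ n * (real n + 2) ^ d)"
    if "cnf3 n F" "encodes_cnf n F xs" for n F xs
  proof -
    have "W ^ (n div k + 1) * b ^ q * real (time_factor c n) = \<gamma> ^ (k * (n div k)) * ((W * b ^ q) * real (time_factor c n))"
      by (simp add: g(1)[symmetric] power_mult mult.assoc mult.left_commute)
    also have "\<dots> \<le> \<gamma> ^ n * (real A * real (time_factor c n))"
      using g(2) A W1 b(1) by (intro mult_mono power_increasing mult_right_mono) auto
    also have "\<dots> \<le> \<gamma> ^ n * (real n + 2) ^ d"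
    proof -
      have "real (A * time_factor c n) \<le> real ((n + 2) ^ d)" using d[of n] by (rule of_nat_mono)
      then show ?thesis using g(2) by (intro mult_left_mono) (auto simp: add.commute)
    qed
    finally have le: "(C * b) ^ (n div k + 1) * b ^ q * real (time_factor c n) \<le> \<gamma> ^ n * (real n + 2) ^ d"
      by (simp only: W_def)
    have "computes_within (solver P) xs (\<lambda>ys. ys = [min_clause_deletion F])
      ((C * b) ^ (n div k + 1) * b ^ q * real (time_factor c n))"
      by (rule reduction_time[OF b(1) _ that]) (rule P)
    then show ?thesis using le by (rule computes_within_mono)
  qed
  then have "max3sat_solvable_in_base \<gamma>" unfolding max3sat_solvable_in_base_def by blast
  then show ?thesis using g(3) by blast
qed

end

theorem theorem1p8:
  "\<forall>q\<ge>2. \<exists>\<sigma>. \<forall>\<epsilon>>0.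
     M3SH \<longrightarrow> \<not> edge_deletion_solvable_in_base q \<sigma> 6 (real q - \<epsilon>)"
proof (intro allI impI)
  fix q :: nat assume q: "2 \<le> q"
  obtain \<sigma> :: nat and D lab where g: "gadget_graph q {..<\<sigma>} D lab" "gadget_lower q D" "gadget_upper q D"
    using gadget_exists[OF q] .
  obtain T where T: "set T = D" "distinct T" using finite_distinct_list[OF gadget_graphD(2)[OF g(1)]] by blast
  show "\<exists>\<sigma>. \<forall>\<epsilon>>0. M3SH \<longrightarrow> \<not> edge_deletion_solvable_in_base q \<sigma> 6 (real q - \<epsilon>)"
  \<comment> \<open>\<sigma> comes from the gadget, hence from \<open>q\<close> alone; the block
    length is chosen only after \<epsilon>.\<close>
  proof (rule exI[of _ \<sigma>], intro allI impI notI)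
    fix \<epsilon> :: real assume e: "\<epsilon> > 0" "M3SH" and "edge_deletion_solvable_in_base q \<sigma> 6 (real q - \<epsilon>)"
    then obtain P c where P: "\<And>n E Q p xs. simple_graph {..<n} E \<Longrightarrow> hub \<sigma> 6 {..<n} E Q \<Longrightarrow> card Q = p \<Longrightarrow> encodes_instance n E Q xs \<Longrightarrow>
        computes_within P xs (\<lambda>ys. \<exists>X. min_edge_deletion q {..<n} E X \<and> encodes_edges X ys) ((real q - \<epsilon>) ^ p * (real n + 2) ^ c)"
      unfolding edge_deletion_solvable_in_base_def by blast
    \<comment> \<open>For \<epsilon> > q the base is negative. The one-vertex instance with a hub of
      size 1 rules this out, as a running time is never negative; monotonicity of powers relies on
      this below.\<close>
    have nonneg: "0 \<le> real q - \<epsilon>"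
    proof -
      have "encodes_instance 1 {} {0} [1, 0, 1, 0]"
        unfolding encodes_instance_def encodes_edges_def by (intro exI[of _ "[]"] exI[of _ "[0]"]) auto
      moreover have "hub \<sigma> 6 {..<1::nat} {} {0}" by (auto simp: hub_def components_def)
      moreover have "simple_graph {..<1::nat} {}" by (simp add: simple_graph_def)
      ultimately obtain t where "real t \<le> (real q - \<epsilon>) * (real 1 + 2) ^ c"
        using P[of 1 "{}" "{0}" 1 "[1,0,1,0]"] unfolding computes_within_def by auto
      then have "0 \<le> (real q - \<epsilon>) * 3 ^ c" by (simp add: order_trans[OF of_nat_0_le_iff])
      then show ?thesis by (simp add: zero_le_mult_iff power_le_zero_eq)
    qed
    \<comment> \<open>Raising the base to at least 1 keeps it below \<open>q\<close> and makes its
      powers at least 1.\<close>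
    define b where "b = max (real q - \<epsilon>) 1"
    have b: "1 \<le> b" "b < real q" "real q - \<epsilon> \<le> b" using e(1) q by (auto simp: b_def)
    \<comment> \<open>This is what C * b < 2 ^ k asks for when \<open>C\<close> is replaced by its
      bound 2 ^ k / q + 1. Passing to \<open>Suc k0\<close> makes the block length positive.\<close>
    obtain k0 where "b * q / (q - b) < 2 ^ k0" using real_arch_pow[of 2] by auto
    then have "b * q / (q - b) < 2 ^ Suc k0" by (rule less_le_trans) simp
    then have bk: "b * q < 2 ^ Suc k0 * (q - b)" using b(2) by (simp add: divide_less_eq)
    define k where "k = Suc k0"
    define C where "C = 2 ^ k div q + 1"
    interpret block_encoding q \<sigma> T lab k C
      by unfold_locales (use q g T in \<open>simp_all add: k_def C_def\<close>)
    have "real C * b < 2 ^ k"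
    proof -
      have "real (2 ^ k div q) \<le> 2 ^ k / q" using of_nat_div_le_of_nat[of "2 ^ k" q, where 'a = real] by simp
      then have "real C \<le> 2 ^ k / q + 1" by (simp add: C_def)
      then have "real C * b \<le> (2 ^ k / q + 1) * b" using b(1) by (intro mult_right_mono) auto
      also have "\<dots> < 2 ^ k" using bk q by (simp add: k_def field_simps)
      finally show ?thesis .
    qed
    then have "\<exists>\<gamma><2. max3sat_solvable_in_base \<gamma>"
    proof (rule max3sat_from_edge_deletion[OF b(1)])
      fix n E Q p xs assume "simple_graph {..<n} E" "hub \<sigma> 6 {..<n} E Q" "card Q = p" "encodes_instance n E Q xs"
      note P[OF this]
      moreover have "(real q - \<epsilon>) ^ p * (real n + 2) ^ c \<le> b ^ p * (real n + 2) ^ c"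
        using b(3) nonneg by (intro mult_right_mono power_mono) auto
      ultimately show "computes_within P xs (\<lambda>ys. \<exists>X. min_edge_deletion q {..<n} E X \<and> encodes_edges X ys) (b ^ p * (real n + 2) ^ c)"
        by (rule computes_within_mono)
    qed
    then obtain \<gamma> where "\<gamma> < 2" "max3sat_solvable_in_base \<gamma>" by blast
    then have "2 - \<gamma> > 0" "max3sat_solvable_in_base (2 - (2 - \<gamma>))" by simp_all
    then show False using e(2) unfolding M3SH_def by blast
  qed
qed

end
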